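(* Let $\Lambda$ be a basic finite dimensional algebra over an algebraically closed field $K$ whose Jacobson radical $J$ satisfies $J^2=0$, and let $T$ be a semisimple left $\Lambda$-module which is realizable with respect to the dimension vector $\mathbf d$. Then the modules in the closed subvariety $\overline{\mathbf{Rep}^T_{\mathbf d}}$ of $\mathbf{Rep}_{\mathbf d}(\Lambda)$ are precisely those modules with dimension vector $\mathbf d$ which have the form $M\oplus U$, where $M$ has top $T$ and $U$ is semisimple.
   Context: Write $\Lambda=KQ/I$ with $Q$ a finite quiver with $n$ vertices and arrow set $Q_1$, and $I$ an admissible ideal. Modules are finite dimensional left modules; $\operatorname{top}M=M/JM$; "form" is understood up to isomorphism, and $U$ may be zero. For $\mathbf d=(d_1,\dots,d_n)$, $\mathbf{Rep}_{\mathbf d}(\Lambda)$ is the affine variety of tuples $(x_\alpha)_{\alpha\in Q_1}\in\prod_\alpha \operatorname{Hom}_K(K^{d_{\mathrm{start}(\alpha)}},K^{d_{\mathrm{end}(\alpha)}})$ satisfying all relations in $I$; points correspond to modules with dimension vector $\mathbf d$, and a module is "in" a subset if it corresponds to one of its points. $\mathbf{Rep}^T_{\mathbf d}$ is the locally closed subvariety of points whose modules have top isomorphic to $T$. $T$ is realizable with respect to $\mathbf d$ if $\mathbf{Rep}^T_{\mathbf d}\ne\varnothing$. *)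

theory Defs
  imports
    "HOL-Algebra.Ideal_Product"
    "HOL-Algebra.QuotRing"
    "HOL-Algebra.Generated_Groups"
    "HOL-Algebra.Module"
    "HOL-Analysis.Abstract_Topology"
    "HOL-Computational_Algebra.Polynomial"
    "Graph_Theory.Arc_Walk"
    "Jordan_Normal_Form.Matrix"
begin

section \<open>Left modules over a ring that need not be commutative\<close>

text \<open>The locale \<^locale>\<open>module\<close> of the library insists on a commutative ring. We use
  the same record type; its multiplication and unit fields are irrelevant for modules.\<close>

locale left_module = R?: ring R + M?: abelian_group M
  for R :: "('a, 'r) ring_scheme" (structure) and M :: "('a, 'b, 'm) module_scheme" (structure) +
  assumes smult_closed [simp, intro]:
      "\<lbrakk>a \<in> carrier R; x \<in> carrier M\<rbrakk> \<Longrightarrow> a \<odot>\<^bsub>M\<^esub> x \<in> carrier M"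
    and smult_l_distr:
      "\<lbrakk>a \<in> carrier R; b \<in> carrier R; x \<in> carrier M\<rbrakk> \<Longrightarrow>
        (a \<oplus>\<^bsub>R\<^esub> b) \<odot>\<^bsub>M\<^esub> x = a \<odot>\<^bsub>M\<^esub> x \<oplus>\<^bsub>M\<^esub> b \<odot>\<^bsub>M\<^esub> x"
    and smult_r_distr:
      "\<lbrakk>a \<in> carrier R; x \<in> carrier M; y \<in> carrier M\<rbrakk> \<Longrightarrow>
        a \<odot>\<^bsub>M\<^esub> (x \<oplus>\<^bsub>M\<^esub> y) = a \<odot>\<^bsub>M\<^esub> x \<oplus>\<^bsub>M\<^esub> a \<odot>\<^bsub>M\<^esub> y"
    and smult_assoc1:
      "\<lbrakk>a \<in> carrier R; b \<in> carrier R; x \<in> carrier M\<rbrakk> \<Longrightarrow>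
        (a \<otimes>\<^bsub>R\<^esub> b) \<odot>\<^bsub>M\<^esub> x = a \<odot>\<^bsub>M\<^esub> (b \<odot>\<^bsub>M\<^esub> x)"
    and smult_one [simp]:
      "x \<in> carrier M \<Longrightarrow> \<one>\<^bsub>R\<^esub> \<odot>\<^bsub>M\<^esub> x = x"

definition module_isomorphic ::
  "('a, 'r) ring_scheme \<Rightarrow> ('a, 'b, 'm) module_scheme \<Rightarrow> ('a, 'c, 'n) module_scheme \<Rightarrow> bool" where
  "module_isomorphic R M N \<longleftrightarrow>
     (\<exists>h. bij_betw h (carrier M) (carrier N) \<and>
          (\<forall>x\<in>carrier M. \<forall>y\<in>carrier M. h (x \<oplus>\<^bsub>M\<^esub> y) = h x \<oplus>\<^bsub>N\<^esub> h y) \<and>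
          (\<forall>a\<in>carrier R. \<forall>x\<in>carrier M. h (a \<odot>\<^bsub>M\<^esub> x) = a \<odot>\<^bsub>N\<^esub> h x))"

definition direct_sum_module ::
  "('a, 'b, 'm) module_scheme \<Rightarrow> ('a, 'c, 'n) module_scheme \<Rightarrow> ('a, 'b \<times> 'c) module" where
  "direct_sum_module M N =
     \<lparr>carrier = carrier M \<times> carrier N, monoid.mult = undefined, monoid.one = undefined,
      zero = (\<zero>\<^bsub>M\<^esub>, \<zero>\<^bsub>N\<^esub>),
      add = (\<lambda>(x, y) (x', y'). (x \<oplus>\<^bsub>M\<^esub> x', y \<oplus>\<^bsub>N\<^esub> y')),
      module.smult = (\<lambda>a (x, y). (a \<odot>\<^bsub>M\<^esub> x, a \<odot>\<^bsub>N\<^esub> y))\<rparr>"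

definition quotient_module ::
  "('a, 'b, 'm) module_scheme \<Rightarrow> 'b set \<Rightarrow> ('a, 'b set) module" where
  "quotient_module M N =
     \<lparr>carrier = a_rcosets\<^bsub>M\<^esub> N, monoid.mult = undefined, monoid.one = undefined,
      zero = N, add = set_add M,
      module.smult = (\<lambda>a C. \<Union>x\<in>C. N +>\<^bsub>M\<^esub> (a \<odot>\<^bsub>M\<^esub> x))\<rparr>"

definition simple_submodule ::
  "('a, 'r) ring_scheme \<Rightarrow> ('a, 'b, 'm) module_scheme \<Rightarrow> 'b set \<Rightarrow> bool" where
  "simple_submodule R M S \<longleftrightarrow>
     submodule S R M \<and> S \<noteq> {\<zero>\<^bsub>M\<^esub>} \<and>
     (\<forall>N. submodule N R M \<and> N \<subseteq> S \<longrightarrow> N = {\<zero>\<^bsub>M\<^esub>} \<or> N = S)"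

text \<open>A module is semisimple if it is the sum of its simple submodules; the zero module
  is semisimple.\<close>

definition semisimple_module ::
  "('a, 'r) ring_scheme \<Rightarrow> ('a, 'b, 'm) module_scheme \<Rightarrow> bool" where
  "semisimple_module R M \<longleftrightarrow>
     left_module R M \<and>
     carrier M = generate (add_monoid M) (\<Union>{S. simple_submodule R M S})"

definition left_ideal :: "'a set \<Rightarrow> ('a, 'r) ring_scheme \<Rightarrow> bool" where
  "left_ideal L R \<longleftrightarrow>
     additive_subgroup L R \<and> (\<forall>a\<in>carrier R. \<forall>x\<in>L. a \<otimes>\<^bsub>R\<^esub> x \<in> L)"

definition maximal_left_ideal :: "'a set \<Rightarrow> ('a, 'r) ring_scheme \<Rightarrow> bool" where
  "maximal_left_ideal L R \<longleftrightarrow>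
     left_ideal L R \<and> L \<noteq> carrier R \<and>
     (\<forall>L'. left_ideal L' R \<and> L \<subseteq> L' \<longrightarrow> L' = L \<or> L' = carrier R)"

definition jacobson_radical :: "('a, 'r) ring_scheme \<Rightarrow> 'a set" where
  "jacobson_radical R = carrier R \<inter> \<Inter>{L. maximal_left_ideal L R}"

definition radical_submodule ::
  "('a, 'r) ring_scheme \<Rightarrow> ('a, 'b, 'm) module_scheme \<Rightarrow> 'b set" where
  "radical_submodule R M =
     generate (add_monoid M) {a \<odot>\<^bsub>M\<^esub> x | a x. a \<in> jacobson_radical R \<and> x \<in> carrier M}"

definition top_module ::
  "('a, 'r) ring_scheme \<Rightarrow> ('a, 'b, 'm) module_scheme \<Rightarrow> ('a, 'b set) module" where
  "top_module R M = quotient_module M (radical_submodule R M)"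


section \<open>Path algebras modulo admissible ideals\<close>

text \<open>A quiver is a finite directed multigraph (loops allowed), i.e. an instance of
  \<^locale>\<open>fin_digraph\<close>. A path is encoded by its starting vertex and the list of its arrows
  in the order in which they are traversed; the empty list gives the trivial paths.\<close>

type_synonym ('v, 'e) path = "'v \<times> 'e list"

definition paths :: "('v, 'e) pre_digraph \<Rightarrow> ('v, 'e) path set" where
  "paths Q = {(u, p). \<exists>v. pre_digraph.awalk Q u p v}"

text \<open>Elements of the path algebra are finitely supported functions on paths. Since we work with
  left modules, paths are composed like maps: the product of two paths \<open>p\<close> and \<open>q\<close> is
  \<open>q\<close> followed by \<open>p\<close> if \<open>p\<close> starts where \<open>q\<close> ends, and zero otherwise.\<close>

definition path_algebra :: "('v, 'e) pre_digraph \<Rightarrow> (('v, 'e) path \<Rightarrow> 'k::field) ring" where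
  "path_algebra Q =
     \<lparr>carrier = {f. finite {w. f w \<noteq> 0} \<and> {w. f w \<noteq> 0} \<subseteq> paths Q},
      monoid.mult = (\<lambda>f g (u, r). \<Sum>i\<le>length r.
                f (pre_digraph.awlast Q u (take i r), drop i r) * g (u, take i r)),
      monoid.one = (\<lambda>(u, r). if u \<in> verts Q \<and> r = [] then 1 else 0),
      zero = (\<lambda>_. 0),
      add = (\<lambda>f g w. f w + g w)\<rparr>"

text \<open>The \<open>m\<close>-th power of the ideal generated by the arrows.\<close>

definition arrow_ideal_power ::
  "('v, 'e) pre_digraph \<Rightarrow> nat \<Rightarrow> (('v, 'e) path \<Rightarrow> 'k::field) set" where
  "arrow_ideal_power Q m =
     {f \<in> carrier (path_algebra Q). \<forall>u r. f (u, r) \<noteq> 0 \<longrightarrow> m \<le> length r}"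

definition admissible_ideal ::
  "('v, 'e) pre_digraph \<Rightarrow> (('v, 'e) path \<Rightarrow> 'k::field) set \<Rightarrow> bool" where
  "admissible_ideal Q I \<longleftrightarrow>
     ideal I (path_algebra Q) \<and>
     (\<exists>m\<ge>2. arrow_ideal_power Q m \<subseteq> I) \<and> I \<subseteq> arrow_ideal_power Q 2"

definition quiver_algebra ::
  "('v, 'e) pre_digraph \<Rightarrow> (('v, 'e) path \<Rightarrow> 'k::field) set \<Rightarrow> (('v, 'e) path \<Rightarrow> 'k) set ring" where
  "quiver_algebra Q I = path_algebra Q Quot I"


section \<open>The representation varieties\<close>

definition rep_space ::
  "('v, 'e) pre_digraph \<Rightarrow> ('v \<Rightarrow> nat) \<Rightarrow> ('e \<Rightarrow> 'k::field mat) set" where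
  "rep_space Q d = (\<Pi>\<^sub>E \<alpha>\<in>arcs Q. carrier_mat (d (head Q \<alpha>)) (d (tail Q \<alpha>)))"

primrec path_mat ::
  "('v, 'e) pre_digraph \<Rightarrow> ('v \<Rightarrow> nat) \<Rightarrow> ('e \<Rightarrow> 'k::field mat) \<Rightarrow> 'e list \<Rightarrow> 'v \<Rightarrow> 'k mat" where
  "path_mat Q d x [] u = 1\<^sub>m (d u)"
| "path_mat Q d x (\<alpha> # p) u = path_mat Q d x p (head Q \<alpha>) * x \<alpha>"

text \<open>The block from vertex \<open>u\<close> to vertex \<open>v\<close> of the evaluation of \<open>f\<close> at the point \<open>x\<close>.\<close>

definition eval_block ::
  "('v, 'e) pre_digraph \<Rightarrow> ('v \<Rightarrow> nat) \<Rightarrow> ('e \<Rightarrow> 'k::field mat) \<Rightarrow>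
   (('v, 'e) path \<Rightarrow> 'k) \<Rightarrow> 'v \<Rightarrow> 'v \<Rightarrow> 'k mat" where
  "eval_block Q d x f u v =
     mat (d v) (d u) (\<lambda>(i, j).
       \<Sum>p | pre_digraph.awalk Q u p v \<and> f (u, p) \<noteq> 0. f (u, p) * path_mat Q d x p u $$ (i, j))"

definition Rep ::
  "('v, 'e) pre_digraph \<Rightarrow> (('v, 'e) path \<Rightarrow> 'k::field) set \<Rightarrow> ('v \<Rightarrow> nat) \<Rightarrow>
   ('e \<Rightarrow> 'k mat) set" where
  "Rep Q I d = {x \<in> rep_space Q d.
     \<forall>f\<in>I. \<forall>u\<in>verts Q. \<forall>v\<in>verts Q. eval_block Q d x f u v = 0\<^sub>m (d v) (d u)}"

definition path_algebra_action ::
  "('v, 'e) pre_digraph \<Rightarrow> ('v \<Rightarrow> nat) \<Rightarrow> ('e \<Rightarrow> 'k::field mat) \<Rightarrow>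
   (('v, 'e) path \<Rightarrow> 'k) \<Rightarrow> ('v \<Rightarrow> 'k vec) \<Rightarrow> ('v \<Rightarrow> 'k vec)" where
  "path_algebra_action Q d x f m =
     (\<lambda>v\<in>verts Q. vec (d v) (\<lambda>i. \<Sum>u\<in>verts Q. (eval_block Q d x f u v *\<^sub>v m u) $ i))"

text \<open>The left module over the quiver algebra given by a point \<open>x\<close> of \<^const>\<open>Rep\<close>. The elements of
  the algebra are cosets; as \<open>x\<close> satisfies the relations, all representatives of a coset act
  in the same way.\<close>

definition rep_module ::
  "('v, 'e) pre_digraph \<Rightarrow> ('v \<Rightarrow> nat) \<Rightarrow> ('e \<Rightarrow> 'k::field mat) \<Rightarrow>
   ((('v, 'e) path \<Rightarrow> 'k) set, 'v \<Rightarrow> 'k vec) module" where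
  "rep_module Q d x =
     \<lparr>carrier = (\<Pi>\<^sub>E v\<in>verts Q. carrier_vec (d v)),
      monoid.mult = undefined, monoid.one = undefined,
      zero = (\<lambda>v\<in>verts Q. 0\<^sub>v (d v)),
      add = (\<lambda>m m'. \<lambda>v\<in>verts Q. m v + m' v),
      module.smult = (\<lambda>C m. path_algebra_action Q d x (SOME f. f \<in> C) m)\<rparr>"

definition Rep_top ::
  "('v, 'e) pre_digraph \<Rightarrow> (('v, 'e) path \<Rightarrow> 'k::field) set \<Rightarrow> ('v \<Rightarrow> nat) \<Rightarrow>
   ((('v, 'e) path \<Rightarrow> 'k) set, 't) module \<Rightarrow> ('e \<Rightarrow> 'k mat) set" where
  "Rep_top Q I d T = {x \<in> Rep Q I d.
     module_isomorphic (quiver_algebra Q I) (top_module (quiver_algebra Q I) (rep_module Q d x)) T}"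

definition realizable ::
  "('v, 'e) pre_digraph \<Rightarrow> (('v, 'e) path \<Rightarrow> 'k::field) set \<Rightarrow> ('v \<Rightarrow> nat) \<Rightarrow>
   ((('v, 'e) path \<Rightarrow> 'k) set, 't) module \<Rightarrow> bool" where
  "realizable Q I d T \<longleftrightarrow> Rep_top Q I d T \<noteq> {}"


section \<open>The Zariski topology\<close>

text \<open>The polynomial functions on the affine space \<^const>\<open>rep_space\<close>.\<close>

inductive_set rep_polys ::
  "('v, 'e) pre_digraph \<Rightarrow> ('v \<Rightarrow> nat) \<Rightarrow> (('e \<Rightarrow> 'k::field mat) \<Rightarrow> 'k) set"
  for Q d where
  const: "(\<lambda>_. c) \<in> rep_polys Q d"
| coord: "\<lbrakk>\<alpha> \<in> arcs Q; i < d (head Q \<alpha>); j < d (tail Q \<alpha>)\<rbrakk> \<Longrightarrow>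
            (\<lambda>x. x \<alpha> $$ (i, j)) \<in> rep_polys Q d"
| add: "\<lbrakk>f \<in> rep_polys Q d; g \<in> rep_polys Q d\<rbrakk> \<Longrightarrow> (\<lambda>x. f x + g x) \<in> rep_polys Q d"
| mult: "\<lbrakk>f \<in> rep_polys Q d; g \<in> rep_polys Q d\<rbrakk> \<Longrightarrow> (\<lambda>x. f x * g x) \<in> rep_polys Q d"

definition zero_locus ::
  "('v, 'e) pre_digraph \<Rightarrow> ('v \<Rightarrow> nat) \<Rightarrow> (('e \<Rightarrow> 'k::field mat) \<Rightarrow> 'k) set \<Rightarrow> ('e \<Rightarrow> 'k mat) set" where
  "zero_locus Q d F = {x \<in> rep_space Q d. \<forall>f\<in>F. f x = 0}"

definition zariski_topology ::
  "('v, 'e) pre_digraph \<Rightarrow> ('v \<Rightarrow> nat) \<Rightarrow> ('e \<Rightarrow> 'k::field mat) topology" where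
  "zariski_topology Q d =
     topology (\<lambda>U. \<exists>F\<subseteq>rep_polys Q d. U = rep_space Q d - zero_locus Q d F)"

lemma istopology_zariski:
  fixes Q :: "('v, 'e) pre_digraph" and d :: "'v \<Rightarrow> nat"
  shows "istopology (\<lambda>U :: ('e \<Rightarrow> 'k::field mat) set.
           \<exists>F\<subseteq>rep_polys Q d. U = rep_space Q d - zero_locus Q d F)"
  unfolding istopology_def
proof (intro conjI allI impI)
  fix S T :: "('e \<Rightarrow> 'k mat) set"
  assume "\<exists>F\<subseteq>rep_polys Q d. S = rep_space Q d - zero_locus Q d F"
  then obtain F where F: "F \<subseteq> rep_polys Q d" "S = rep_space Q d - zero_locus Q d F" by blast
  assume "\<exists>F\<subseteq>rep_polys Q d. T = rep_space Q d - zero_locus Q d F"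
  then obtain G where G: "G \<subseteq> rep_polys Q d" "T = rep_space Q d - zero_locus Q d G" by blast
  let ?H = "{\<lambda>x. f x * g x | f g. f \<in> F \<and> g \<in> G}"
  have "?H \<subseteq> rep_polys Q d" using F G by (auto intro!: rep_polys.mult)
  moreover have "S \<inter> T = rep_space Q d - zero_locus Q d ?H"
    unfolding F(2) G(2) zero_locus_def by fastforce
  ultimately show "\<exists>F\<subseteq>rep_polys Q d. S \<inter> T = rep_space Q d - zero_locus Q d F" by blast
next
  fix K :: "('e \<Rightarrow> 'k mat) set set"
  assume K: "\<forall>S\<in>K. \<exists>F\<subseteq>rep_polys Q d. S = rep_space Q d - zero_locus Q d F"
  let ?H = "\<Union>{F. F \<subseteq> rep_polys Q d \<and> rep_space Q d - zero_locus Q d F \<in> K}"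
  have "\<Union>K = rep_space Q d - zero_locus Q d ?H"
  proof (intro equalityI subsetI)
    fix x assume "x \<in> \<Union>K"
    then obtain S where "S \<in> K" "x \<in> S" by blast
    with K obtain F where "F \<subseteq> rep_polys Q d" "S = rep_space Q d - zero_locus Q d F" by blast
    with \<open>S \<in> K\<close> \<open>x \<in> S\<close> show "x \<in> rep_space Q d - zero_locus Q d ?H"
      unfolding zero_locus_def by blast
  next
    fix x assume "x \<in> rep_space Q d - zero_locus Q d ?H"
    then show "x \<in> \<Union>K" unfolding zero_locus_def by blast
  qed
  moreover have "?H \<subseteq> rep_polys Q d" by blast
  ultimately show "\<exists>F\<subseteq>rep_polys Q d. \<Union>K = rep_space Q d - zero_locus Q d F" by blast
qed

lemma openin_zariski_topology:
  "openin (zariski_topology Q d) U \<longleftrightarrow>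
     (\<exists>F\<subseteq>rep_polys Q d. U = rep_space Q d - zero_locus Q d F)"
  by (simp add: zariski_topology_def istopology_zariski)

definition Rep_topology ::
  "('v, 'e) pre_digraph \<Rightarrow> (('v, 'e) path \<Rightarrow> 'k::field) set \<Rightarrow> ('v \<Rightarrow> nat) \<Rightarrow>
   ('e \<Rightarrow> 'k mat) topology" where
  "Rep_topology Q I d = subtopology (zariski_topology Q d) (Rep Q I d)"

end

theory Submission
  imports Defs "Jordan_Normal_Form.Determinant"
begin

text \<open>Since \<open>J\<^sup>2 = 0\<close>, the ideal \<open>I\<close> consists of all combinations of paths of length at least two, so a
  representation is a family of matrices \<open>x\<^sub>\<alpha>\<close> with \<open>x\<^sub>\<beta> x\<^sub>\<alpha> = 0\<close> whenever \<open>\<beta>\<close> starts where \<open>\<alpha>\<close> ends.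
  For such an \<open>x\<close>, let \<open>R\<^sub>v\<close> be the sum of the images of the arrows ending in \<open>v\<close> and \<open>S\<^sub>v\<close> the common
  kernel of the arrows starting in \<open>v\<close>, so that \<open>R\<^sub>v \<subseteq> S\<^sub>v\<close>; the \<open>R\<^sub>v\<close> form the radical of the module.
  If \<open>e\<^sub>v\<close> is the dimension of \<open>R\<^sub>v\<close> for the points with top \<open>T\<close>, then both the closure and the set of
  all \<open>M \<oplus> U\<close> are described by the condition \<open>dim R\<^sub>v \<le> e\<^sub>v \<le> dim S\<^sub>v\<close>, that is, by the existence of \<open>W\<^sub>v\<close>
  with \<open>R\<^sub>v \<subseteq> W\<^sub>v \<subseteq> S\<^sub>v\<close> and \<open>dim W\<^sub>v = e\<^sub>v\<close>. At the vertex \<open>v\<close>, the module \<open>U\<close> is a complement of \<open>R\<^sub>v\<close> in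
  \<open>W\<^sub>v\<close>. The rank conditions are closed, and any point satisfying them is joined by a line to a point
  with top \<open>T\<close> and radical \<open>W\<close>; a generic point of this line has top \<open>T\<close>.\<close>

section \<open>Frames of vector spaces\<close>

text \<open>The relations in \<open>zero_composites\<close> are quadratic, so the line through two
  points of \<open>Rep Q I d\<close> leaves the variety in general. Once the spaces W_v are fixed,
  however, the conditions "every image lies in W" and "every arrow kills W" are linear in x and
  imply all relations, so a whole line of such points stays inside. This is why the locus is stated
  with W_v and not with ranks. The numbers e_v depend on T alone: the component of T at v is a
  quotient of the space at v, and e_v is the dimension of the kernel. For a point with top T this
  kernel is the radical; for a sum of M and U it is the radical of M together with U, which is the
  wanted W. Algebraic closedness enters through \<open>alg_closed_poly_zero\<close>: a polynomial on
  the line that vanishes at all scalars is zero. Dimensions are numbers attached to invertible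
  matrices: a subspace is the span of an initial segment of columns, and the dimension comparisons
  go back to counting unknowns against equations in \<open>pigeonhole_kernel\<close>.\<close>

definition vec_subspace :: "nat \<Rightarrow> 'k::field vec set \<Rightarrow> bool" where
  "vec_subspace n S \<longleftrightarrow> S \<subseteq> carrier_vec n \<and> 0\<^sub>v n \<in> S \<and>
     (\<forall>v\<in>S. \<forall>w\<in>S. v + w \<in> S) \<and> (\<forall>c. \<forall>v\<in>S. c \<cdot>\<^sub>v v \<in> S)"

text \<open>Coefficient vectors keep their full length and vanish from \<open>s\<close> on, so for
  an invertible \<open>g\<close> membership can be tested with the inverse matrix, see
  \<open>frame_span_iff\<close>.\<close>

definition frame_span :: "'k::field mat \<Rightarrow> nat \<Rightarrow> 'k vec set" where
  "frame_span g s = {g *\<^sub>v c | c. c \<in> carrier_vec (dim_col g) \<and>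
     (\<forall>i<dim_col g. s \<le> i \<longrightarrow> c $ i = 0)}"

text \<open>The columns are an ordered basis. A frame together with an index
  \<open>s \<le> n\<close> stands for a subspace with its dimension, so that dimensions become plain
  natural numbers.\<close>

definition frame :: "nat \<Rightarrow> 'k::field mat \<Rightarrow> bool" where
  "frame n g \<longleftrightarrow> g \<in> carrier_mat n n \<and> det g \<noteq> 0"

text \<open>Linearity as an induction principle: vectors supported below \<open>s\<close> are built
  from the first \<open>s\<close> unit vectors by sums and scalings. The predicate is arbitrary
  because it serves for subspaces and later for a linear relation between two spaces.\<close>

lemma vec_support_induct:
  fixes c :: "'k::field vec"
  assumes c: "c \<in> carrier_vec n" "\<And>i. i < n \<Longrightarrow> s \<le> i \<Longrightarrow> c $ i = 0" and s: "s \<le> n"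
    and zero: "P (0\<^sub>v n)"
    and add: "\<And>c c'. \<lbrakk>c \<in> carrier_vec n; c' \<in> carrier_vec n; P c; P c'\<rbrakk> \<Longrightarrow> P (c + c')"
    and smult: "\<And>a c. \<lbrakk>c \<in> carrier_vec n; P c\<rbrakk> \<Longrightarrow> P (a \<cdot>\<^sub>v c)"
    and unit: "\<And>i. i < s \<Longrightarrow> P (unit_vec n i)"
  shows "P c"
  using c s unit
proof (induction s arbitrary: c)
  case 0
  then have "c = 0\<^sub>v n" by (intro eq_vecI) auto
  then show ?case using zero by simp
next
  case (Suc s)
  define c' where "c' = vec n (\<lambda>i. if i = s then 0 else c $ i)"
  have "P c'"
  proof (rule Suc.IH)
    show "c' \<in> carrier_vec n" by (simp add: c'_def)
    fix i assume "i < n" "s \<le> i"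
    then show "c' $ i = 0" using Suc.prems(2)[of i] by (auto simp: c'_def)
  qed (use Suc.prems in auto)
  moreover have "P (c $ s \<cdot>\<^sub>v unit_vec n s)"
    using Suc.prems by (intro smult) auto
  ultimately have "P (c' + c $ s \<cdot>\<^sub>v unit_vec n s)"
    by (intro add) (auto simp: c'_def)
  also have "c' + c $ s \<cdot>\<^sub>v unit_vec n s = c"
    using Suc.prems by (intro eq_vecI) (auto simp: c'_def)
  finally show ?case .
qed

lemma mult_mat_unit_vec:
  assumes "A \<in> carrier_mat m n" "i < n"
  shows "(A :: 'k::field mat) *\<^sub>v unit_vec n i = col A i"
  using assms by (intro eq_vecI) (auto simp: scalar_prod_right_unit)

lemma mult_mat_zero_vec:
  assumes "A \<in> carrier_mat m n"
  shows "(A :: 'k::field mat) *\<^sub>v 0\<^sub>v n = 0\<^sub>v m"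
  using assms by (intro eq_vecI) auto

lemma vec_subspace_diff:
  assumes "vec_subspace n S" "v \<in> S" "w \<in> S"
  shows "v - w \<in> S"
proof -
  have "v + (-1) \<cdot>\<^sub>v w \<in> S" using assms by (simp add: vec_subspace_def)
  moreover have "v + (-1) \<cdot>\<^sub>v w = v - w"
  proof (rule eq_vecI)
    have "v \<in> carrier_vec n" "w \<in> carrier_vec n" using assms by (auto simp: vec_subspace_def)
    then show "\<And>i. i < dim_vec (v - w) \<Longrightarrow> (v + (-1) \<cdot>\<^sub>v w) $ i = (v - w) $ i" 
      "dim_vec (v + (-1) \<cdot>\<^sub>v w) = dim_vec (v - w)" by auto
  qed
  ultimately show ?thesis by simp
qed

lemma vec_subspace_carrier: "vec_subspace n S \<Longrightarrow> v \<in> S \<Longrightarrow> v \<in> carrier_vec n"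
  by (auto simp: vec_subspace_def)

text \<open>The expression has the form of one component of \<open>first_order_action\<close>: a
  scaled vector plus a weighted sum over arrows. Taking 0 for \<open>c\<close> leaves the arrow part
  alone.\<close>

lemma vec_subspace_sum:
  fixes w :: "'k::field vec"
  assumes S: "vec_subspace n S" and A: "finite A" and w: "w \<in> S" and u: "\<And>a. a \<in> A \<Longrightarrow> u a \<in> S"
  shows "vec n (\<lambda>i. c * w $ i + (\<Sum>a\<in>A. k a * u a $ i)) \<in> S"
  using A u
proof induction
  case empty
  have "vec n (\<lambda>i. c * w $ i) = c \<cdot>\<^sub>v w" using S w by (intro eq_vecI) (auto simp: vec_subspace_def)
  then show ?case using S w by (simp add: vec_subspace_def)
next
  case (insert a A)
  have uw: "u a \<in> S" "dim_vec (u a) = n" using insert.prems vec_subspace_carrier[OF S] by auto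
  have "vec n (\<lambda>i. c * w $ i + (\<Sum>a\<in>insert a A. k a * u a $ i))
      = vec n (\<lambda>i. c * w $ i + (\<Sum>a\<in>A. k a * u a $ i)) + k a \<cdot>\<^sub>v u a"
    using insert.hyps uw(2) by (intro eq_vecI) auto
  then show ?case using insert uw(1) S by (simp add: vec_subspace_def)
qed

text \<open>The matrix may be rectangular: besides frames, \<open>g\<close> will also be an arrow
  matrix, with \<open>s\<close> the number of all its columns.\<close>

lemma mult_mat_vec_in_subspace:
  assumes S: "vec_subspace m S" and g: "g \<in> carrier_mat m n" and s: "s \<le> n"
    and col: "\<And>i. i < s \<Longrightarrow> col g i \<in> S"
    and c: "c \<in> carrier_vec n" "\<And>i. i < n \<Longrightarrow> s \<le> i \<Longrightarrow> c $ i = 0"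
  shows "g *\<^sub>v c \<in> S"
  using c s
proof (rule vec_support_induct)
  show "g *\<^sub>v 0\<^sub>v n \<in> S" using S g by (simp add: mult_mat_zero_vec[of _ m n] vec_subspace_def)
  show "\<And>c c'. \<lbrakk>c \<in> carrier_vec n; c' \<in> carrier_vec n; g *\<^sub>v c \<in> S; g *\<^sub>v c' \<in> S\<rbrakk> \<Longrightarrow> g *\<^sub>v (c + c') \<in> S"
    using S g by (simp add: mult_add_distrib_mat_vec[of _ m n] vec_subspace_def)
  show "\<And>a c. \<lbrakk>c \<in> carrier_vec n; g *\<^sub>v c \<in> S\<rbrakk> \<Longrightarrow> g *\<^sub>v (a \<cdot>\<^sub>v c) \<in> S"
    using S g by (simp add: mult_mat_vec[of _ m n] vec_subspace_def)
  show "\<And>i. i < s \<Longrightarrow> g *\<^sub>v unit_vec n i \<in> S"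
    using col g s by (simp add: mult_mat_unit_vec[of _ m n])
qed

section \<open>Spans of initial segments of a frame\<close>

lemma frame_carrier [simp]: "frame n g \<Longrightarrow> g \<in> carrier_mat n n"
  and frame_dims [simp]: "frame n g \<Longrightarrow> dim_row g = n" "frame n g \<Longrightarrow> dim_col g = n"
  by (auto simp: frame_def)

lemma frame_mult_vec [simp]: "frame n g \<Longrightarrow> v \<in> carrier_vec n \<Longrightarrow> g *\<^sub>v v \<in> carrier_vec n"
  by (rule mult_mat_vec_carrier[OF frame_carrier])

lemma frame_span_subset:
  assumes S: "vec_subspace n S" and g: "g \<in> carrier_mat n n" and s: "s \<le> n"
    and col: "\<And>i. i < s \<Longrightarrow> col g i \<in> S"
  shows "frame_span g s \<subseteq> S"
proof
  fix w assume "w \<in> frame_span g s"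
  then obtain c where "w = g *\<^sub>v c" "c \<in> carrier_vec n" "\<forall>i<n. s \<le> i \<longrightarrow> c $ i = 0"
    using g by (auto simp: frame_span_def)
  then show "w \<in> S" using mult_mat_vec_in_subspace[OF S g s col, of c] by auto
qed

lemma frame_span_memI:
  assumes "g \<in> carrier_mat n n" "c \<in> carrier_vec n" "\<And>i. i < n \<Longrightarrow> s \<le> i \<Longrightarrow> c $ i = 0"
  shows "g *\<^sub>v c \<in> frame_span g s"
  using assms by (auto simp: frame_span_def)

lemma vec_subspace_frame_span:
  assumes g: "g \<in> carrier_mat n n"
  shows "vec_subspace n (frame_span g s)"
  unfolding vec_subspace_def
proof (intro conjI ballI allI subsetI)
  fix w assume "w \<in> frame_span g s"
  then show "w \<in> carrier_vec n" using g by (auto simp: frame_span_def)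
next
  have "g *\<^sub>v 0\<^sub>v n \<in> frame_span g s" by (rule frame_span_memI[OF g]) auto
  then show "0\<^sub>v n \<in> frame_span g s" using mult_mat_zero_vec[OF g] by simp
next
  fix v w assume "v \<in> frame_span g s" "w \<in> frame_span g s"
  then obtain c c' where c: "v = g *\<^sub>v c" "c \<in> carrier_vec n" "\<forall>i<n. s \<le> i \<longrightarrow> c $ i = 0"
    "w = g *\<^sub>v c'" "c' \<in> carrier_vec n" "\<forall>i<n. s \<le> i \<longrightarrow> c' $ i = 0"
    using g by (auto simp: frame_span_def)
  have "g *\<^sub>v (c + c') \<in> frame_span g s" by (rule frame_span_memI[OF g]) (use c in auto)
  then show "v + w \<in> frame_span g s" using c mult_add_distrib_mat_vec[OF g, of c c'] by simp
next
  fix a v assume "v \<in> frame_span g s"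
  then obtain c where c: "v = g *\<^sub>v c" "c \<in> carrier_vec n" "\<forall>i<n. s \<le> i \<longrightarrow> c $ i = 0"
    using g by (auto simp: frame_span_def)
  have "g *\<^sub>v (a \<cdot>\<^sub>v c) \<in> frame_span g s" by (rule frame_span_memI[OF g]) (use c in auto)
  then show "a \<cdot>\<^sub>v v \<in> frame_span g s" using c mult_mat_vec[OF g, of c a] by simp
qed

lemma col_in_frame_span:
  assumes "g \<in> carrier_mat n n" "i < s" "i < n"
  shows "col g i \<in> frame_span g s"
  using frame_span_memI[of g n "unit_vec n i" s] mult_mat_unit_vec[of g n n i] assms by auto

lemma frame_span_mono: "s \<le> t \<Longrightarrow> frame_span g s \<subseteq> frame_span g t"
  by (auto simp: frame_span_def)

lemma frame_span_cong:
  assumes "g \<in> carrier_mat n n" "g' \<in> carrier_mat n n" "s \<le> n" "\<And>i. i < s \<Longrightarrow> col g i = col g' i"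
  shows "frame_span g s = frame_span g' s"
proof
  show "frame_span g s \<subseteq> frame_span g' s"
    using assms col_in_frame_span[of g' n _ s]
    by (intro frame_span_subset[OF vec_subspace_frame_span]) auto
  show "frame_span g' s \<subseteq> frame_span g s"
    using assms(1-3) col_in_frame_span[of g n _ s] assms(4)[symmetric]
    by (intro frame_span_subset[OF vec_subspace_frame_span]) auto
qed

lemma frame_one: "frame n (1\<^sub>m n)"
  unfolding frame_def by simp

section \<open>Coordinates, counting and exchange\<close>

lemma frame_inverse:
  assumes "frame n g"
  obtains h where "frame n h" "h * g = 1\<^sub>m n" "g * h = 1\<^sub>m n"
proof -
  have "g \<in> Units (ring_mat TYPE('a) n ())"
    using assms unfolding frame_def by (intro det_non_zero_imp_unit) auto
  then obtain h where h: "h \<in> carrier_mat n n" "h * g = 1\<^sub>m n" "g * h = 1\<^sub>m n"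
    by (auto simp: Units_def ring_mat_def)
  have "det h * det g = 1" using det_mult[of h n g] h assms by simp
  then have "frame n h" using h unfolding frame_def by auto
  then show ?thesis using h that by blast
qed

lemma frame_mult: "frame n g \<Longrightarrow> frame n h \<Longrightarrow> frame n (g * h)"
  unfolding frame_def by (auto simp: det_mult[of _ n])

lemma inverse_mult_vec:
  assumes "g * h = (1\<^sub>m n :: 'k::field mat)" "g \<in> carrier_mat n n" "h \<in> carrier_mat n n" "v \<in> carrier_vec n"
  shows "g *\<^sub>v (h *\<^sub>v v) = v"
  using assms assoc_mult_mat_vec[of g n n h n v] by simp

text \<open>The inverse \<open>h\<close> computes the coordinates of \<open>w\<close> with respect
  to the columns of \<open>g\<close>.\<close>

lemma frame_span_iff:
  assumes g: "frame n g" and h: "frame n h" "h * g = 1\<^sub>m n" "g * h = 1\<^sub>m n"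
  shows "w \<in> frame_span g s \<longleftrightarrow> w \<in> carrier_vec n \<and> (\<forall>i<n. s \<le> i \<longrightarrow> (h *\<^sub>v w) $ i = 0)"
proof
  assume "w \<in> frame_span g s"
  then obtain c where c: "w = g *\<^sub>v c" "c \<in> carrier_vec n" "\<forall>i<n. s \<le> i \<longrightarrow> c $ i = 0"
    using g by (auto simp: frame_span_def)
  moreover have "h *\<^sub>v w = c" using c inverse_mult_vec[OF h(2), of c] g h by simp
  ultimately show "w \<in> carrier_vec n \<and> (\<forall>i<n. s \<le> i \<longrightarrow> (h *\<^sub>v w) $ i = 0)"
    using frame_mult_vec[OF g, of c] by simp
next
  assume w: "w \<in> carrier_vec n \<and> (\<forall>i<n. s \<le> i \<longrightarrow> (h *\<^sub>v w) $ i = 0)"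
  have "g *\<^sub>v (h *\<^sub>v w) \<in> frame_span g s"
    using w by (intro frame_span_memI[of _ n]) (use g h in auto)
  then show "w \<in> frame_span g s" using inverse_mult_vec[OF h(3)] w g h by simp
qed

lemma frame_mult_eq_0:
  assumes "frame n g" "c \<in> carrier_vec n" "g *\<^sub>v c = 0\<^sub>v n"
  shows "c = 0\<^sub>v n"
  using assms det_0_iff_vec_prod_zero_field[of g n] unfolding frame_def by blast

text \<open>The count on which the dimension arguments rest: rows in \<open>I\<close> are equations,
  coordinates in \<open>J\<close> are unknowns, and the chosen submatrix, padded with zero rows to a
  square, is singular. Index sets are arbitrary because both initial and final blocks will be
  selected.\<close>

lemma pigeonhole_kernel:
  fixes A :: "'k::field mat"
  assumes A: "A \<in> carrier_mat m n" and I: "I \<subseteq> {0..<m}" and J: "J \<subseteq> {0..<n}"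
    and card: "card I < card J"
  obtains c where "c \<in> carrier_vec n" "c \<noteq> 0\<^sub>v n" "\<And>j. j < n \<Longrightarrow> j \<notin> J \<Longrightarrow> c $ j = 0"
    "\<And>i. i \<in> I \<Longrightarrow> (A *\<^sub>v c) $ i = 0"
proof -
  define k where "k = card J"
  have "finite I" "finite J" using I J finite_subset by blast+
  then obtain e f where e: "bij_betw e {0..<card I} I" and f: "bij_betw f {0..<k} J"
    unfolding k_def using ex_bij_betw_nat_finite by metis
  \<comment> \<open>Rows are padded with zeros up to size \<open>k\<close>. Since
    \<open>card I < k\<close>, row \<open>card I\<close> is among the zero rows, and the conditional
    in \<open>B\<close> displays it in the form that \<open>det_row_0\<close> expects.\<close>
  define r where "r = (\<lambda>i. if i < card I then vec k (\<lambda>j. A $$ (e i, f j)) else 0\<^sub>v k)"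
  define B where "B = mat\<^sub>r k k (\<lambda>i. if i = card I then 0\<^sub>v k else r i)"
  have "det B = 0" unfolding B_def using card
    by (intro det_row_0) (auto simp: k_def r_def)
  then obtain b where b: "b \<in> carrier_vec k" "b \<noteq> 0\<^sub>v k" "B *\<^sub>v b = 0\<^sub>v k"
    using det_0_iff_vec_prod_zero_field[of B k] by (auto simp: B_def)
  let ?f = "inv_into {0..<k} f"
  \<comment> \<open>The solution \<open>b\<close> is spread over \<open>J\<close> along the
    enumeration \<open>f\<close> and extended by 0.\<close>
  define c where "c = vec n (\<lambda>j. if j \<in> J then b $ ?f j else 0)"
  have fJ: "\<And>j. j < k \<Longrightarrow> f j \<in> J" and ff: "\<And>j. j < k \<Longrightarrow> ?f (f j) = j"
    using f by (auto simp: bij_betw_def)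
  show ?thesis
  proof
    show "c \<in> carrier_vec n" by (simp add: c_def)
    obtain j where j: "j < k" "b $ j \<noteq> 0" using b by (metis carrier_vecD eq_vecI index_zero_vec)
    then have "c $ f j \<noteq> 0" "f j < n" using fJ[of j] ff[of j] J by (auto simp: c_def)
    then show "c \<noteq> 0\<^sub>v n" by auto
    show "\<And>j. j < n \<Longrightarrow> j \<notin> J \<Longrightarrow> c $ j = 0" by (simp add: c_def)
    fix i assume i: "i \<in> I"
    then obtain i' where i': "i' < card I" "e i' = i" using e
        by (metis atLeastLessThan_iff bij_betw_imp_surj_on imageE)
    have "i < m" using i I by auto
    have "(A *\<^sub>v c) $ i = (\<Sum>j=0..<n. A $$ (i, j) * c $ j)"
    proof -
      have "dim_vec c = n" by (simp add: c_def)
      then show ?thesis using A \<open>i < m\<close> by (simp add: scalar_prod_def)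
    qed
    also have "\<dots> = (\<Sum>j\<in>J. A $$ (i, j) * b $ ?f j)"
      using J by (intro sum.mono_neutral_cong_right) (auto simp: c_def)
    also have "\<dots> = (\<Sum>j=0..<k. A $$ (i, f j) * b $ j)"
      unfolding sum.reindex_bij_betw[OF f, symmetric] by (intro sum.cong refl) (simp add: ff)
    also have "\<dots> = (B *\<^sub>v b) $ i'"
    proof -
      have *: "i' < k" "i' \<noteq> card I" "dim_vec b = k" using i' card b by (auto simp: k_def)
      have "row B i' = r i'" using * unfolding B_def by (subst row_mat_of_row_fun) (auto simp: r_def)
      then show ?thesis using * i' by (simp add: scalar_prod_def r_def B_def)
    qed
    also have "\<dots> = 0" using b i' card by (auto simp: k_def)
    finally show "(A *\<^sub>v c) $ i = 0" .
  qed
qed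

text \<open>If \<open>s < r\<close>, some nonzero combination of the first \<open>r\<close> columns
  of \<open>g\<close> has vanishing coordinates below \<open>s\<close> in the frame
  \<open>g'\<close>; by \<open>sub\<close> those from \<open>s\<close> on vanish too, so an
  invertible matrix would kill a nonzero vector.\<close>

lemma frame_span_dim_le:
  assumes g: "frame n g" and g': "frame n g'" and r: "r \<le> n"
    and sub: "\<And>i. i < r \<Longrightarrow> col g i \<in> frame_span g' s"
  shows "r \<le> s"
proof (rule ccontr)
  assume "\<not> r \<le> s"
  obtain h where h: "frame n h" "h * g' = 1\<^sub>m n" "g' * h = 1\<^sub>m n" using frame_inverse[OF g'] .
  have hg: "h * g \<in> carrier_mat n n" using frame_carrier[OF frame_mult[OF h(1) g]] .
  obtain c where c: "c \<in> carrier_vec n" "c \<noteq> 0\<^sub>v n" "\<And>j. j < n \<Longrightarrow> j \<notin> {0..<r} \<Longrightarrow> c $ j = 0"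
    "\<And>i. i \<in> {0..<s} \<Longrightarrow> ((h * g) *\<^sub>v c) $ i = 0"
    using pigeonhole_kernel[OF hg, of "{0..<s}" "{0..<r}"] \<open>\<not> r \<le> s\<close> r by auto
  have "g *\<^sub>v c \<in> frame_span g' s"
    using mult_mat_vec_in_subspace[OF vec_subspace_frame_span[OF frame_carrier[OF g']] frame_carrier[OF g] r sub c(1)] c
    by auto
  then have "\<forall>i<n. s \<le> i \<longrightarrow> (h *\<^sub>v (g *\<^sub>v c)) $ i = 0" using frame_span_iff[OF g' h] by simp
  moreover have hgc: "(h * g) *\<^sub>v c = h *\<^sub>v (g *\<^sub>v c)" using g h c by (intro assoc_mult_mat_vec) auto
  ultimately have "(h * g) *\<^sub>v c = 0\<^sub>v n" using c h
    by (intro eq_vecI) (simp_all del: index_mult_mat_vec, metis atLeastLessThan_iff le0 not_less)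
  then show False using frame_mult_eq_0[OF frame_mult[OF h(1) g]] c by simp
qed

text \<open>Steinitz exchange. As \<open>w\<close> is outside the span, it has a nonzero coordinate
  at some position \<open>j \<ge> s\<close>; by Cramer's rule, putting \<open>w\<close> into column
  \<open>j\<close> multiplies the determinant by this coordinate. A swap then brings
  \<open>w\<close> to position \<open>s\<close>.\<close>

lemma frame_exchange:
  assumes g: "frame n g" and w: "w \<in> carrier_vec n" "w \<notin> frame_span g s" and s: "s \<le> n"
  obtains g' where "frame n g'" "\<And>i. i < s \<Longrightarrow> col g' i = col g i" "col g' s = w" "s < n"
proof -
  obtain h where h: "frame n h" "h * g = 1\<^sub>m n" "g * h = 1\<^sub>m n" using frame_inverse[OF g] .
  define c where "c = h *\<^sub>v w"
  have c: "c \<in> carrier_vec n" "g *\<^sub>v c = w"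
    unfolding c_def using inverse_mult_vec[OF h(3), of w] g h w by auto
  obtain j where j: "j < n" "s \<le> j" "c $ j \<noteq> 0"
    using frame_span_iff[OF g h, of w s] w by (auto simp: c_def)
  define g1 where "g1 = replace_col g w j"
  have "det g1 = c $ j * det g" unfolding g1_def c(2)[symmetric]
    by (rule cramer_lemma_mat[OF frame_carrier[OF g] c(1) j(1)])
  then have g1: "frame n g1" using j g unfolding frame_def by (auto simp: g1_def replace_col_def)
  have cols: "\<And>i. i < n \<Longrightarrow> col g1 i = (if i = j then w else col g i)"
    using g w by (intro eq_vecI) (auto simp: g1_def replace_col_def)
  define g' where "g' = (if j = s then g1 else swapcols s j g1)"
  have g': "frame n g'" using g1 j det_swapcols[of s n j g1]
    unfolding frame_def by (auto simp: g'_def)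
  have cols': "col g' i = (if i = s then w else if i = j then col g s else col g i)" if "i < n" for i
  proof -
    have "col (swapcols s j g1) i = (if i = s then col g1 j else if i = j then col g1 s else col g1 i)"
      using g1 that j by (intro eq_vecI) auto
    then show ?thesis using cols[of i] cols[of j] cols[of s] that j by (auto simp: g'_def)
  qed
  show ?thesis using that[OF g'] cols' j by auto
qed

text \<open>Exchange is repeated until the span contains \<open>G\<close>. The new columns are
  members of \<open>G\<close> itself and not only of its span, as \<open>rank_leD\<close> and the
  minors in \<open>locus_subset_closure\<close> require.\<close>

lemma frame_extend:
  assumes "frame n g" "r \<le> n" "G \<subseteq> carrier_vec n"
  obtains g' s where "frame n g'" "r \<le> s" "s \<le> n" "\<And>i. i < r \<Longrightarrow> col g' i = col g i"
    "\<And>i. r \<le> i \<Longrightarrow> i < s \<Longrightarrow> col g' i \<in> G" "G \<subseteq> frame_span g' s"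
proof -
  have "\<exists>g' s. frame n g' \<and> r \<le> s \<and> s \<le> n \<and> (\<forall>i<r. col g' i = col g i) \<and>
    (\<forall>i. r \<le> i \<and> i < s \<longrightarrow> col g' i \<in> G) \<and> G \<subseteq> frame_span g' s"
    using assms
  proof (induction "n - r" arbitrary: g r rule: less_induct)
    case less
    show ?case
    proof (cases "G \<subseteq> frame_span g r")
      case True
      then show ?thesis using less.prems by (intro exI[of _ g] exI[of _ r]) auto
    next
      case False
      then obtain w where w: "w \<in> G" "w \<notin> frame_span g r" by blast
      obtain g1 where g1: "frame n g1" "\<And>i. i < r \<Longrightarrow> col g1 i = col g i" "col g1 r = w" "r < n"
        using frame_exchange[OF less.prems(1) _ w(2) less.prems(2)] w less.prems by blast
      obtain g' s where g': "frame n g'" "Suc r \<le> s" "s \<le> n" "\<forall>i<Suc r. col g' i = col g1 i"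
        "\<forall>i. Suc r \<le> i \<and> i < s \<longrightarrow> col g' i \<in> G" "G \<subseteq> frame_span g' s"
      proof -
        have "n - Suc r < n - r" "Suc r \<le> n" using g1(4) by auto
        from less.hyps[OF this(1) g1(1) this(2) less.prems(3)] show ?thesis using that by blast
      qed
      have "col g' i \<in> G" if "r \<le> i" "i < s" for i
        using g'(4,5) g1(3) w that by (cases "i = r") auto
      then show ?thesis using g' g1 by (intro exI[of _ g'] exI[of _ s]) auto
    qed
  qed
  then show ?thesis using that by blast
qed

text \<open>Adapts one frame to a flag: the subspace spanned by the first \<open>r\<close> columns
  is kept, and the frame is continued inside \<open>S\<close> until it spans
  \<open>S\<close>.\<close>

lemma subspace_frame_extend:
  assumes "frame n g" "r \<le> n" "vec_subspace n S" "frame_span g r \<subseteq> S"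
  obtains g' s where "frame n g'" "r \<le> s" "s \<le> n" "\<And>i. i < r \<Longrightarrow> col g' i = col g i"
    "frame_span g' r = frame_span g r" "S = frame_span g' s"
proof -
  have "S \<subseteq> carrier_vec n" using assms by (simp add: vec_subspace_def)
  from frame_extend[OF assms(1,2) this] obtain g' s where g': "frame n g'" "r \<le> s" "s \<le> n"
      "\<And>i. i < r \<Longrightarrow> col g' i = col g i"
    "\<And>i. r \<le> i \<Longrightarrow> i < s \<Longrightarrow> col g' i \<in> S" "S \<subseteq> frame_span g' s"
    by blast
  have "frame_span g' r = frame_span g r"
    using g' assms by (intro frame_span_cong[of _ n]) auto
  moreover have "col g' i \<in> S" if "i < s" for i
  proof (cases "i < r")
    case True
    then show ?thesis using g'(4)[OF True] col_in_frame_span[of g n i r] assms by auto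
  qed (use g'(5) that in auto)
  then have "frame_span g' s \<subseteq> S" using frame_span_subset[OF assms(3)] g' by auto
  ultimately show ?thesis using that g' by blast
qed

lemma subspace_frame:
  assumes "vec_subspace n S"
  obtains g s where "frame n g" "s \<le> n" "S = frame_span g s"
proof -
  have z: "frame_span (1\<^sub>m n) 0 \<subseteq> S" using assms by (intro frame_span_subset[OF assms]) auto
  obtain g s where "frame n g" "s \<le> n" "S = frame_span g s"
    by (rule subspace_frame_extend[OF frame_one _ assms z]) auto
  then show ?thesis by (rule that)
qed

section \<open>Rank bounds by minors, and annihilators\<close>

text \<open>The span of \<open>G\<close> has dimension at most \<open>m\<close>; stated with determinants, this condition is visibly
  closed.\<close>

definition rank_le :: "nat \<Rightarrow> nat \<Rightarrow> 'k::field vec set \<Rightarrow> bool" where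
  "rank_le n m G \<longleftrightarrow> (m < n \<longrightarrow>
     (\<forall>g\<in>carrier_mat n n. (\<forall>i\<le>m. col g i \<in> G) \<longrightarrow> det g = 0))"

text \<open>A frame grown from members of \<open>G\<close> cannot use more than \<open>m\<close> of
  them: its first \<open>m + 1\<close> columns would lie in \<open>G\<close> although the
  determinant is nonzero.\<close>

lemma rank_leD:
  assumes "rank_le n m G" "G \<subseteq> carrier_vec n"
  obtains g s where "frame n g" "s \<le> m" "s \<le> n" "\<And>i. i < s \<Longrightarrow> col g i \<in> G" "G \<subseteq> frame_span g s"
proof -
  obtain g s where g: "frame n g" "s \<le> n" "\<And>i. i < s \<Longrightarrow> col g i \<in> G" "G \<subseteq> frame_span g s"
    by (rule frame_extend[OF frame_one _ assms(2), of 0]) auto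
  have "s \<le> m"
  proof (rule ccontr)
    assume "\<not> s \<le> m"
    then have "\<forall>i\<le>m. col g i \<in> G" "m < n" using g by auto
    then have "det g = 0" using assms(1) g(1) by (simp add: rank_le_def)
    then show False using g(1) unfolding frame_def by simp
  qed
  then show ?thesis using that g by blast
qed

lemma rank_le_frame_span:
  assumes "frame n g" "G \<subseteq> frame_span g e"
  shows "rank_le n e G"
  unfolding rank_le_def
proof (intro impI ballI)
  fix g' assume e: "e < n" and g': "g' \<in> carrier_mat n n" "\<forall>i\<le>e. col g' i \<in> G"
  show "det g' = 0"
  proof (rule ccontr)
    assume "det g' \<noteq> 0"
    then have "frame n g'" using g' unfolding frame_def by simp
    then have "Suc e \<le> e"
      by (rule frame_span_dim_le[OF _ assms(1)]) (use e g' assms in auto)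
    then show False by simp
  qed
qed

text \<open>The orthogonal space for the standard bilinear form. For the rows of the outgoing arrows
  it is their common kernel, see \<open>annihilator_out_rows\<close>.\<close>

definition annihilator :: "nat \<Rightarrow> 'k::field vec set \<Rightarrow> 'k vec set" where
  "annihilator n G = {w \<in> carrier_vec n. \<forall>v\<in>G. v \<bullet> w = 0}"

lemma vec_subspace_annihilator:
  assumes "G \<subseteq> carrier_vec n"
  shows "vec_subspace n (annihilator n G)"
  using assms by (auto simp: vec_subspace_def annihilator_def subset_iff scalar_prod_add_distrib[of _ n])

text \<open>One half of rank plus nullity. Suppose an invertible \<open>g'\<close> had
  \<open>n - e + 1\<close> columns in \<open>G\<close>. Every combination of the first
  \<open>e\<close> columns of \<open>g\<close> is orthogonal to these, and a nontrivial one can be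
  made orthogonal to the other \<open>e - 1\<close> columns as well; it would then be orthogonal to
  a basis.\<close>

lemma rank_le_annihilator:
  assumes g: "frame n g" and e: "e \<le> n" and sub: "frame_span g e \<subseteq> annihilator n G"
  shows "rank_le n (n - e) G"
  unfolding rank_le_def
proof (intro impI ballI)
  fix g' assume lt: "n - e < n" and g': "g' \<in> carrier_mat n n" "\<forall>i\<le>n - e. col g' i \<in> G"
  show "det g' = 0"
  proof (rule ccontr)
    assume "det g' \<noteq> 0"
    then have t: "frame n (transpose_mat g')" using g' det_transpose[of g' n] unfolding frame_def by simp
    let ?A = "transpose_mat g' * g"
    have A: "?A \<in> carrier_mat n n" using frame_carrier[OF frame_mult[OF t g]] .
    obtain c where c: "c \<in> carrier_vec n" "c \<noteq> 0\<^sub>v n" "\<And>j. j < n \<Longrightarrow> j \<notin> {0..<e} \<Longrightarrow> c $ j = 0"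
      "\<And>i. i \<in> {Suc (n - e)..<n} \<Longrightarrow> (?A *\<^sub>v c) $ i = 0"
      using pigeonhole_kernel[OF A, of "{Suc (n - e)..<n}" "{0..<e}"] lt e by auto
    have "g *\<^sub>v c \<in> frame_span g e" using c g by (intro frame_span_memI[of _ n]) auto
    then have ann: "g *\<^sub>v c \<in> annihilator n G" using sub by blast
    have Ac: "?A *\<^sub>v c = transpose_mat g' *\<^sub>v (g *\<^sub>v c)"
      using g g' c by (intro assoc_mult_mat_vec) auto
    have "?A *\<^sub>v c = 0\<^sub>v n"
    proof (rule eq_vecI)
      fix i assume "i < dim_vec (0\<^sub>v n)"
      then have i: "i < n" by simp
      show "(?A *\<^sub>v c) $ i = 0\<^sub>v n $ i"
      proof (cases "i \<le> n - e")
        case True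
        then have "col g' i \<bullet> (g *\<^sub>v c) = 0" using ann g' by (auto simp: annihilator_def)
        then show ?thesis unfolding Ac using i g' by simp
      qed (use c(4) i in auto)
    qed (use g' in auto)
    then show False using frame_mult_eq_0[OF frame_mult[OF t g]] c by simp
  qed
qed

text \<open>A frame adapted to \<open>R\<close> inside the annihilator has indices
  \<open>r \<le> s\<close>, and its first \<open>e\<close> columns serve once
  \<open>r \<le> e\<close> and \<open>e \<le> s\<close>. The second inequality is the other half of
  rank plus nullity.\<close>

lemma intermediate_frame:
  assumes G: "G \<subseteq> carrier_vec n" "rank_le n (n - e) G" and e: "e \<le> n"
    and R: "vec_subspace n R" "rank_le n e R" "R \<subseteq> annihilator n G"
  obtains g where "frame n g" "R \<subseteq> frame_span g e" "frame_span g e \<subseteq> annihilator n G"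
proof -
  obtain g' s' where g': "frame n g'" "s' \<le> n - e" "s' \<le> n" "\<And>i. i < s' \<Longrightarrow> col g' i \<in> G" "G \<subseteq> frame_span g' s'"
    by (rule rank_leD[OF G(2,1)]) blast
  have "R \<subseteq> carrier_vec n" using R by (simp add: vec_subspace_def)
  then obtain g1 r where g1: "frame n g1" "r \<le> e" "r \<le> n" "\<And>i. i < r \<Longrightarrow> col g1 i \<in> R" "R \<subseteq> frame_span g1 r"
    by (rule rank_leD[OF R(2)]) blast
  have "frame_span g1 r \<subseteq> R" using frame_span_subset[OF R(1), of g1 r] g1 by simp
  with R(3) have "frame_span g1 r \<subseteq> annihilator n G" by simp
  then obtain g2 s where g2: "frame n g2" "r \<le> s" "s \<le> n" "frame_span g2 r = frame_span g1 r"
     "annihilator n G = frame_span g2 s"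
    using subspace_frame_extend[OF g1(1,3) vec_subspace_annihilator[OF G(1)]] by metis
  obtain h where h: "frame n h" "h * g2 = 1\<^sub>m n" "g2 * h = 1\<^sub>m n" using frame_inverse[OF g2(1)] .
  have "e \<le> s"
  proof (rule ccontr)
    assume "\<not> e \<le> s"
    let ?A = "transpose_mat g' * g2"
    have A: "?A \<in> carrier_mat n n" using g2 g' by (intro mult_carrier_mat[of _ n n]) auto
    \<comment> \<open>If \<open>s < e\<close>, the last \<open>n - s\<close> columns of
      \<open>g2\<close> outnumber the \<open>s'\<close> columns of \<open>g'\<close> that span
      \<open>G\<close>, so a nonzero combination of them is orthogonal to \<open>G\<close>. It would
      lie in the annihilator, which is the span of the first \<open>s\<close> columns.\<close>
    have "card {0..<s'} < card {s..<n}" using \<open>\<not> e \<le> s\<close> g' e by simp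
    then obtain c where c: "c \<in> carrier_vec n" "c \<noteq> 0\<^sub>v n" "\<And>j. j < n \<Longrightarrow> j \<notin> {s..<n} \<Longrightarrow> c $ j = 0"
      "\<And>i. i \<in> {0..<s'} \<Longrightarrow> (?A *\<^sub>v c) $ i = 0"
      using pigeonhole_kernel[OF A, of "{0..<s'}" "{s..<n}"] g' by auto
    let ?w = "g2 *\<^sub>v c"
    have w: "?w \<in> carrier_vec n" using g2 c by simp
    have Ac: "?A *\<^sub>v c = transpose_mat g' *\<^sub>v ?w"
      using g2 g' c by (intro assoc_mult_mat_vec) auto
    have "col g' i \<in> annihilator n {?w}" if "i < s'" for i
    proof -
      have "(?A *\<^sub>v c) $ i = col g' i \<bullet> ?w" unfolding Ac using that g' by simp
      then have "?w \<bullet> col g' i = 0" using c(4)[of i] that w g' comm_scalar_prod[of ?w n "col g' i"]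
        by (metis atLeastLessThan_iff carrier_matD(1) col_carrier_vec col_dim frame_dims(1) carrier_vec_dim_vec g'(1) le0)
      then show ?thesis using that g'(1,3) by (auto simp: annihilator_def intro!: carrier_vecI)
    qed
    then have "frame_span g' s' \<subseteq> annihilator n {?w}"
      using w g' by (intro frame_span_subset[OF vec_subspace_annihilator]) auto
    then have "G \<subseteq> annihilator n {?w}" using g' by blast
    then have "\<And>v. v \<in> G \<Longrightarrow> v \<bullet> ?w = 0" 
      using w comm_scalar_prod[of ?w n] by (auto simp: annihilator_def subset_iff)
    then have "?w \<in> frame_span g2 s" unfolding g2(5)[symmetric] using w by (simp add: annihilator_def)
    then have "\<forall>i<n. s \<le> i \<longrightarrow> (h *\<^sub>v ?w) $ i = 0" using frame_span_iff[OF g2(1) h] by simp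
    moreover have "h *\<^sub>v ?w = c" using inverse_mult_vec[OF h(2)] g2 h c by simp
    ultimately have "\<And>i. i < n \<Longrightarrow> c $ i = 0" using c(3) by (metis atLeastLessThan_iff)
    then have "c = 0\<^sub>v n" using c(1) by (intro eq_vecI) auto
    then show False using c by simp
  qed
  show ?thesis
  proof (rule that[OF g2(1)])
    show "R \<subseteq> frame_span g2 e" using g1(2,5) g2(4) frame_span_mono[of r e g2] by blast
    show "frame_span g2 e \<subseteq> annihilator n G" unfolding g2(5) by (rule frame_span_mono) fact
  qed
qed

section \<open>Dimensions of isomorphic quotients, and changes of frame\<close>

text \<open>The relation \<open>\<rho>\<close> plays the role of an isomorphism between quotient spaces.\<close>

lemma quotient_relation_dim_le:
  fixes g g0 :: "'k::field mat"
  assumes g: "frame n g" and g0: "frame n g0" and a: "a \<le> n" and b: "b \<le> n"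
    and total: "\<And>w. w \<in> carrier_vec n \<Longrightarrow> \<exists>w0\<in>carrier_vec n. \<rho> w w0"
    and add:
        "\<And>w w0 u u0. \<lbrakk>w \<in> carrier_vec n; w0 \<in> carrier_vec n; u \<in> carrier_vec n; u0 \<in> carrier_vec n; \<rho> w w0; \<rho> u u0\<rbrakk> \<Longrightarrow> \<rho> (w + u) (w0 + u0)"
    and smult: "\<And>c w w0. \<lbrakk>w \<in> carrier_vec n; w0 \<in> carrier_vec n; \<rho> w w0\<rbrakk> \<Longrightarrow> \<rho> (c \<cdot>\<^sub>v w) (c \<cdot>\<^sub>v w0)"
    and zero: "\<rho> (0\<^sub>v n) (0\<^sub>v n)"
    and ker: "\<And>w w0. \<lbrakk>w \<in> carrier_vec n; \<rho> w w0; w0 \<in> frame_span g0 b\<rbrakk> \<Longrightarrow> w \<in> frame_span g a"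
  shows "b \<le> a"
proof (rule ccontr)
  assume "\<not> b \<le> a"
  \<comment> \<open>The relation need not be a function, so one partner is chosen for each basis
    vector, and \<open>A0\<close> extends the choice linearly.\<close>
  have "\<exists>w0. \<forall>i<n. w0 i \<in> carrier_vec n \<and> \<rho> (col g i) (w0 i)"
    using total g by (intro choice) (metis col_carrier_vec frame_carrier)
  then obtain w0 where w0: "\<And>i. i < n \<Longrightarrow> w0 i \<in> carrier_vec n" "\<And>i. i < n \<Longrightarrow> \<rho> (col g i) (w0 i)"
    by blast
  define A0 where "A0 = mat n n (\<lambda>(i, j). w0 j $ i)"
  have A0: "A0 \<in> carrier_mat n n" "\<And>i. i < n \<Longrightarrow> col A0 i = w0 i"
    using carrier_vecD[OF w0(1)] by (auto simp: A0_def intro!: eq_vecI)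
  obtain h where h: "frame n h" "h * g = 1\<^sub>m n" "g * h = 1\<^sub>m n" using frame_inverse[OF g] .
  obtain h0 where h0: "frame n h0" "h0 * g0 = 1\<^sub>m n" "g0 * h0 = 1\<^sub>m n" using frame_inverse[OF g0] .
  have hA: "h0 * A0 \<in> carrier_mat n n" using A0 h0 by (intro mult_carrier_mat[of _ n n]) auto
  \<comment> \<open>With \<open>a < b\<close>, the \<open>n - a\<close> last coefficients outnumber
    the \<open>n - b\<close> conditions that put the partner into the span named in
    \<open>ker\<close>. Then \<open>ker\<close> moves a nonzero combination of the last columns of
    \<open>g\<close> into the span of the first \<open>a\<close> ones.\<close>
  have *: "{b..<n} \<subseteq> {0..<n}" "{a..<n} \<subseteq> {0..<n}" "card {b..<n} < card {a..<n}"
    using \<open>\<not> b \<le> a\<close> b by auto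
  obtain c where c: "c \<in> carrier_vec n" "c \<noteq> 0\<^sub>v n" "\<And>j. j < n \<Longrightarrow> j \<notin> {a..<n} \<Longrightarrow> c $ j = 0"
      "\<And>i. i \<in> {b..<n} \<Longrightarrow> ((h0 * A0) *\<^sub>v c) $ i = 0"
    by (rule pigeonhole_kernel[OF hA *]) blast
  have "\<rho> (g *\<^sub>v c) (A0 *\<^sub>v c)"
  proof (rule vec_support_induct[where s = n and n = n and P = "\<lambda>c. \<rho> (g *\<^sub>v c) (A0 *\<^sub>v c)"])
    show "\<rho> (g *\<^sub>v 0\<^sub>v n) (A0 *\<^sub>v 0\<^sub>v n)" using zero A0 g by (simp add: mult_mat_zero_vec[of _ n n])
    show "\<rho> (g *\<^sub>v unit_vec n i) (A0 *\<^sub>v unit_vec n i)" if "i < n" for i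
      using w0 A0 g that by (simp add: mult_mat_unit_vec[of _ n n])
    show "\<And>c c'. c \<in> carrier_vec n \<Longrightarrow> c' \<in> carrier_vec n \<Longrightarrow> \<rho> (g *\<^sub>v c) (A0 *\<^sub>v c) \<Longrightarrow>
        \<rho> (g *\<^sub>v c') (A0 *\<^sub>v c') \<Longrightarrow> \<rho> (g *\<^sub>v (c + c')) (A0 *\<^sub>v (c + c'))"
      using A0 g by (simp add: mult_add_distrib_mat_vec[of _ n n] add)
    show "\<And>a c. c \<in> carrier_vec n \<Longrightarrow> \<rho> (g *\<^sub>v c) (A0 *\<^sub>v c) \<Longrightarrow> \<rho> (g *\<^sub>v (a \<cdot>\<^sub>v c)) (A0 *\<^sub>v (a \<cdot>\<^sub>v c))"
      using A0 g by (simp add: mult_mat_vec[of _ n n] smult)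
  qed (use c in auto)
  moreover have "A0 *\<^sub>v c \<in> frame_span g0 b"
    unfolding frame_span_iff[OF g0 h0]
    using c(1,4) A0 h0 assoc_mult_mat_vec[of h0 n n A0 n c] by auto
  ultimately have "g *\<^sub>v c \<in> frame_span g a" using ker[of "g *\<^sub>v c"] g c by simp
  then have "\<forall>i<n. a \<le> i \<longrightarrow> (h *\<^sub>v (g *\<^sub>v c)) $ i = 0" using frame_span_iff[OF g h] by simp
  moreover have "h *\<^sub>v (g *\<^sub>v c) = c" using inverse_mult_vec[OF h(2)] g h c by simp
  ultimately have "\<And>i. i < n \<Longrightarrow> c $ i = 0" using c(3) by (metis atLeastLessThan_iff)
    then have "c = 0\<^sub>v n" using c(1) by (intro eq_vecI) auto
  then show False using c by simp
qed

lemma frame_span_eq_dim: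
  assumes "frame n g" "frame n g'" "a \<le> n" "b \<le> n" "frame_span g a = frame_span g' b"
  shows "a = b"
proof (rule antisym)
  show "a \<le> b"
  proof (rule frame_span_dim_le[OF assms(1,2,3)])
    fix i assume "i < a"
    then show "col g i \<in> frame_span g' b"
      using col_in_frame_span[of g n i a] assms by auto
  qed
  show "b \<le> a"
  proof (rule frame_span_dim_le[OF assms(2,1,4)])
    fix i assume "i < b"
    then show "col g' i \<in> frame_span g a"
      using col_in_frame_span[of g' n i b] assms by auto
  qed
qed

lemma frame_span_subset_eq:
  assumes "frame n g" "frame n g'" "a \<le> n" "frame_span g' a \<subseteq> frame_span g a"
  shows "frame_span g' a = frame_span g a"
proof -
  have "vec_subspace n (frame_span g a)" using assms by (intro vec_subspace_frame_span) simp
  from subspace_frame_extend[OF assms(2,3) this assms(4)]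
  obtain h s where h: "frame n h" "s \<le> n" "frame_span h a = frame_span g' a" "frame_span g a = frame_span h s"
    by metis
  have "a = s" by (rule frame_span_eq_dim[OF assms(1) h(1) assms(3) h(2,4)])
  then show ?thesis using h by simp
qed

text \<open>The index predicate is arbitrary because the summands in \<open>locus_direct_sum\<close>
  are cut out by complementary blocks of coordinates, not by initial segments.\<close>

lemma coordinate_subspace:
  assumes h: "h \<in> carrier_mat n n"
  shows "vec_subspace n {w \<in> carrier_vec n. \<forall>i<n. P i \<longrightarrow> (h *\<^sub>v w) $ i = (0::'k::field)}"
proof -
  have d: "dim_row h = n" "dim_col h = n" using h by auto
  show ?thesis
    unfolding vec_subspace_def using h d
    by (auto simp: mult_mat_zero_vec[OF h] mult_add_distrib_mat_vec[OF h] mult_mat_vec[OF h] simp del: index_mult_mat_vec)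
qed

lemma vec_add_diff_cancel:
  fixes a :: "'k::ab_group_add vec"
  assumes "a \<in> carrier_vec n" "z \<in> carrier_vec n" "z' \<in> carrier_vec n"
  shows "a + z - (a + z') = z - z'"
  using assms by (intro eq_vecI) auto

lemma vimage_subspace:
  assumes S: "vec_subspace n S" and A: "A \<in> carrier_mat n n"
  shows "vec_subspace n {w \<in> carrier_vec n. A *\<^sub>v w \<in> S}"
  using S unfolding vec_subspace_def
  by (auto simp: mult_mat_zero_vec[OF A] mult_add_distrib_mat_vec[OF A] mult_mat_vec[OF A])

text \<open>\<open>g0 * h\<close> is the change of basis that carries column \<open>i\<close> of
  \<open>g\<close> to column \<open>i\<close> of \<open>g0\<close>, so initial spans
  correspond.\<close>

lemma transport_frame_span_iff:
  assumes g: "frame n g" and h: "frame n h" "h * g = 1\<^sub>m n" "g * h = 1\<^sub>m n" and g0: "frame n g0"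
    and w: "w \<in> carrier_vec n"
  shows "(g0 * h) *\<^sub>v w \<in> frame_span g0 e \<longleftrightarrow> w \<in> frame_span g e"
proof -
  obtain h0 where h0: "frame n h0" "h0 * g0 = 1\<^sub>m n" "g0 * h0 = 1\<^sub>m n" using frame_inverse[OF g0] .
  have hw: "h *\<^sub>v w \<in> carrier_vec n" using h w by simp
  have "(g0 * h) *\<^sub>v w = g0 *\<^sub>v (h *\<^sub>v w)" using g0 h w by (intro assoc_mult_mat_vec) auto
  moreover have "h0 *\<^sub>v (g0 *\<^sub>v (h *\<^sub>v w)) = h *\<^sub>v w"
    using inverse_mult_vec[OF h0(2)] g0 h0(1) hw by simp
  ultimately show ?thesis
    unfolding frame_span_iff[OF g0 h0] frame_span_iff[OF g h] using w hw g0 by simp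
qed

lemma coordinate_split:
  assumes g: "frame n g" and h: "frame n h" "h * g = 1\<^sub>m n" "g * h = 1\<^sub>m n" and w: "w \<in> carrier_vec n"
  shows "\<exists>a\<in>{w \<in> carrier_vec n. \<forall>i<n. P i \<longrightarrow> (h *\<^sub>v w) $ i = 0}.
    \<exists>b\<in>{w \<in> carrier_vec n. \<forall>i<n. \<not> P i \<longrightarrow> (h *\<^sub>v w) $ i = 0}. w = a + b"
proof -
  define c where "c = h *\<^sub>v w"
  let ?a = "vec n (\<lambda>i. if P i then 0 else c $ i)" and ?b = "vec n (\<lambda>i. if P i then c $ i else 0)"
  have c: "c \<in> carrier_vec n" using h w by (simp add: c_def)
  have inv: "h *\<^sub>v (g *\<^sub>v z) = z" if "z \<in> carrier_vec n" for z
    using inverse_mult_vec[OF h(2)] frame_carrier[OF g] frame_carrier[OF h(1)] that by simp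
  have "?a + ?b = c" using c by (intro eq_vecI) auto
  moreover have "w = g *\<^sub>v c"
    unfolding c_def using inverse_mult_vec[OF h(3)] frame_carrier[OF g] frame_carrier[OF h(1)] w by simp
  ultimately have "w = g *\<^sub>v ?a + g *\<^sub>v ?b"
    using mult_add_distrib_mat_vec[OF frame_carrier[OF g], of ?a ?b] by simp
  then show ?thesis
    using g by (intro bexI[of _ "g *\<^sub>v ?a"] bexI[of _ "g *\<^sub>v ?b"]) (simp_all add: inv del: index_mult_mat_vec)
qed

lemma line_mult_mat_vec:
  fixes X Y :: "'k::field mat"
  assumes "X \<in> carrier_mat m n" "Y \<in> carrier_mat m n" "w \<in> carrier_vec n"
  shows "(X + c \<cdot>\<^sub>m (Y - X)) *\<^sub>v w = X *\<^sub>v w + c \<cdot>\<^sub>v (Y *\<^sub>v w - X *\<^sub>v w)"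
proof (rule eq_vecI)
  fix i assume "i < dim_vec (X *\<^sub>v w + c \<cdot>\<^sub>v (Y *\<^sub>v w - X *\<^sub>v w))"
  then have i: "i < m" using assms by simp
  have "((X + c \<cdot>\<^sub>m (Y - X)) *\<^sub>v w) $ i = (\<Sum>j=0..<n. (X $$ (i, j) + c * (Y $$ (i, j) - X $$ (i, j))) * w $ j)"
    using assms i by (simp add: scalar_prod_def)
  also have
      "\<dots> = (\<Sum>j=0..<n. X $$ (i, j) * w $ j) + c * ((\<Sum>j=0..<n. Y $$ (i, j) * w $ j) - (\<Sum>j=0..<n. X $$ (i, j) * w $ j))"
    by (simp add: algebra_simps sum.distrib sum_subtractf sum_distrib_left)
  also have "\<dots> = (X *\<^sub>v w + c \<cdot>\<^sub>v (Y *\<^sub>v w - X *\<^sub>v w)) $ i"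
    using assms i by (simp add: scalar_prod_def)
  finally show "((X + c \<cdot>\<^sub>m (Y - X)) *\<^sub>v w) $ i = (X *\<^sub>v w + c \<cdot>\<^sub>v (Y *\<^sub>v w - X *\<^sub>v w)) $ i" .
qed (use assms in simp)

section \<open>Modules and their tops\<close>

lemma (in abelian_group) minus_eq_zero_iff:
  assumes "x \<in> carrier G" "y \<in> carrier G"
  shows "x \<ominus> y = \<zero> \<longleftrightarrow> x = y"
  using assms minus_equality[of x "\<ominus> y"] by (auto simp: a_minus_def r_neg)

lemma (in abelian_group) minus_zero_right: "x \<in> carrier G \<Longrightarrow> x \<ominus> \<zero> = x"
  using minus_equality[of \<zero> \<zero>] by (simp add: a_minus_def)

lemma (in abelian_group) additive_subgroupI:
  assumes "H \<subseteq> carrier G" "\<zero> \<in> H" "\<And>x y. \<lbrakk>x \<in> H; y \<in> H\<rbrakk> \<Longrightarrow> x \<oplus> y \<in> H" "\<And>x. x \<in> H \<Longrightarrow> \<ominus> x \<in> H"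
  shows "additive_subgroup H G"
  unfolding additive_subgroup_def
  using assms by (intro subgroup.intro) (auto simp flip: a_inv_def)

section \<open>Submodules and quotients of left modules\<close>

context left_module
begin

lemma zero_smult: "x \<in> carrier M \<Longrightarrow> \<zero> \<odot>\<^bsub>M\<^esub> x = \<zero>\<^bsub>M\<^esub>"
  using smult_l_distr[of \<zero> \<zero> x] smult_closed[of \<zero> x] by (simp add: M.add.r_cancel_one')

lemma smult_zero: "a \<in> carrier R \<Longrightarrow> a \<odot>\<^bsub>M\<^esub> \<zero>\<^bsub>M\<^esub> = \<zero>\<^bsub>M\<^esub>"
  using smult_r_distr[of a "\<zero>\<^bsub>M\<^esub>" "\<zero>\<^bsub>M\<^esub>"] smult_closed[of a "\<zero>\<^bsub>M\<^esub>"] by (simp add: M.add.r_cancel_one')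

lemma smult_minus: "\<lbrakk>a \<in> carrier R; x \<in> carrier M\<rbrakk> \<Longrightarrow> a \<odot>\<^bsub>M\<^esub> (\<ominus>\<^bsub>M\<^esub> x) = \<ominus>\<^bsub>M\<^esub> (a \<odot>\<^bsub>M\<^esub> x)"
  using smult_r_distr[of a "\<ominus>\<^bsub>M\<^esub> x" x] smult_zero[of a]
  by (intro M.minus_equality[symmetric]) (auto simp: M.l_neg)

lemma minus_one_smult: "x \<in> carrier M \<Longrightarrow> (\<ominus> \<one>) \<odot>\<^bsub>M\<^esub> x = \<ominus>\<^bsub>M\<^esub> x"
  using smult_l_distr[of "\<ominus> \<one>" \<one> x] zero_smult[of x]
  by (intro M.minus_equality[symmetric]) (auto simp: R.l_neg)

lemma left_submoduleI:
  assumes "H \<subseteq> carrier M" "\<zero>\<^bsub>M\<^esub> \<in> H"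
    and "\<And>x y. \<lbrakk>x \<in> H; y \<in> H\<rbrakk> \<Longrightarrow> x \<oplus>\<^bsub>M\<^esub> y \<in> H"
    and smult: "\<And>a x. \<lbrakk>a \<in> carrier R; x \<in> H\<rbrakk> \<Longrightarrow> a \<odot>\<^bsub>M\<^esub> x \<in> H"
  shows "submodule H R M"
proof -
  have "\<ominus>\<^bsub>M\<^esub> x \<in> H" if "x \<in> H" for x
    using smult[of "\<ominus> \<one>" x] that assms(1) minus_one_smult[of x] by auto
  then have "subgroup H (add_monoid M)"
    using assms by (intro subgroup.intro) (auto simp flip: a_inv_def)
  then show ?thesis using smult by (intro submodule.intro) (simp_all add: submodule_axioms_def)
qed

lemma left_submoduleD:
  assumes "submodule H R M"
  shows "H \<subseteq> carrier M" "\<zero>\<^bsub>M\<^esub> \<in> H" "\<And>x y. \<lbrakk>x \<in> H; y \<in> H\<rbrakk> \<Longrightarrow> x \<oplus>\<^bsub>M\<^esub> y \<in> H"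
    "\<And>a x. \<lbrakk>a \<in> carrier R; x \<in> H\<rbrakk> \<Longrightarrow> a \<odot>\<^bsub>M\<^esub> x \<in> H"
    "\<And>x. x \<in> H \<Longrightarrow> \<ominus>\<^bsub>M\<^esub> x \<in> H"
    "additive_subgroup H M"
proof -
  have s: "subgroup H (add_monoid M)" using assms by (simp add: submodule_def)
  show "H \<subseteq> carrier M" "\<zero>\<^bsub>M\<^esub> \<in> H" "\<And>x y. \<lbrakk>x \<in> H; y \<in> H\<rbrakk> \<Longrightarrow> x \<oplus>\<^bsub>M\<^esub> y \<in> H"
    using subgroup.subset[OF s] subgroup.one_closed[OF s] subgroup.m_closed[OF s] by auto
  show "\<And>a x. \<lbrakk>a \<in> carrier R; x \<in> H\<rbrakk> \<Longrightarrow> a \<odot>\<^bsub>M\<^esub> x \<in> H"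
    using submodule.smult_closed[OF assms] .
  show "\<And>x. x \<in> H \<Longrightarrow> \<ominus>\<^bsub>M\<^esub> x \<in> H"
    using subgroup.m_inv_closed[OF s] by (simp add: a_inv_def)
  show "additive_subgroup H M" using s by (simp add: additive_subgroup_def)
qed

lemma submodule_carrier_update:
  assumes "submodule H R M"
  shows "left_module R (M\<lparr>carrier := H\<rparr>)"
proof -
  note H = left_submoduleD[OF assms]
  have sub: "\<And>x. x \<in> H \<Longrightarrow> x \<in> carrier M" using H by auto
  have "abelian_group (M\<lparr>carrier := H\<rparr>)"
  proof (rule abelian_groupI)
    fix x assume "x \<in> carrier (M\<lparr>carrier := H\<rparr>)"
    then show "\<exists>y\<in>carrier (M\<lparr>carrier := H\<rparr>). y \<oplus>\<^bsub>M\<lparr>carrier := H\<rparr>\<^esub> x = \<zero>\<^bsub>M\<lparr>carrier := H\<rparr>\<^esub>"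
      using sub M.l_neg[of x] H(5)[of x] by auto
  qed (use H sub M.a_assoc M.a_comm in auto)
  then show ?thesis
    using H sub R.ring_axioms
    by (intro left_module.intro left_module_axioms.intro)
      (auto simp: smult_l_distr smult_r_distr smult_assoc1)
qed

lemma generate_subset_submodule:
  assumes "submodule N R M" "S \<subseteq> N"
  shows "generate (add_monoid M) S \<subseteq> N"
proof
  fix x assume "x \<in> generate (add_monoid M) S"
  then show "x \<in> N"
    using left_submoduleD[OF assms(1)] assms(2)
    by induction (auto simp flip: a_inv_def)
qed

lemma minus_in_submodule_iff:
  assumes N: "submodule N R M" and "x \<in> carrier M" "y \<in> carrier M"
  shows "N +>\<^bsub>M\<^esub> x = N +>\<^bsub>M\<^esub> y \<longleftrightarrow> x \<ominus>\<^bsub>M\<^esub> y \<in> N"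
proof -
  interpret N: abelian_subgroup N M
    using left_submoduleD(6)[OF N] M.abelian_group_axioms by (rule abelian_subgroupI3)
  have "N +>\<^bsub>M\<^esub> x = N +>\<^bsub>M\<^esub> y \<longleftrightarrow> x \<in> N +>\<^bsub>M\<^esub> y"
    using assms N.a_rcos_self[of x] M.a_repr_independence[of x N y] N.a_subgroup by auto
  also have "\<dots> \<longleftrightarrow> x \<ominus>\<^bsub>M\<^esub> y \<in> N"
    using N.a_rcos_module[of y x] assms by (simp add: a_minus_def)
  finally show ?thesis .
qed

text \<open>Scalar multiplication on the quotient is a union over all members of a coset; each
  member contributes the same coset, so the union collapses.\<close>

lemma quotient_module_simps:
  assumes N: "submodule N R M"
  shows "carrier (quotient_module M N) = (\<lambda>x. N +>\<^bsub>M\<^esub> x) ` carrier M"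
    and "\<lbrakk>x \<in> carrier M; y \<in> carrier M\<rbrakk> \<Longrightarrow>
      (N +>\<^bsub>M\<^esub> x) \<oplus>\<^bsub>quotient_module M N\<^esub> (N +>\<^bsub>M\<^esub> y) = N +>\<^bsub>M\<^esub> (x \<oplus>\<^bsub>M\<^esub> y)"
    and "\<lbrakk>a \<in> carrier R; x \<in> carrier M\<rbrakk> \<Longrightarrow>
      a \<odot>\<^bsub>quotient_module M N\<^esub> (N +>\<^bsub>M\<^esub> x) = N +>\<^bsub>M\<^esub> (a \<odot>\<^bsub>M\<^esub> x)"
proof -
  interpret N: abelian_subgroup N M
    using left_submoduleD(6)[OF N] M.abelian_group_axioms by (rule abelian_subgroupI3)
  show "carrier (quotient_module M N) = (\<lambda>x. N +>\<^bsub>M\<^esub> x) ` carrier M"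
    by (auto simp: quotient_module_def A_RCOSETS_def')
  show "(N +>\<^bsub>M\<^esub> x) \<oplus>\<^bsub>quotient_module M N\<^esub> (N +>\<^bsub>M\<^esub> y) = N +>\<^bsub>M\<^esub> (x \<oplus>\<^bsub>M\<^esub> y)"
    if "x \<in> carrier M" "y \<in> carrier M"
    using N.a_rcos_sum[OF that] by (simp add: quotient_module_def)
  assume a: "a \<in> carrier R" and x: "x \<in> carrier M"
  have "N +>\<^bsub>M\<^esub> (a \<odot>\<^bsub>M\<^esub> y) = N +>\<^bsub>M\<^esub> (a \<odot>\<^bsub>M\<^esub> x)" if y: "y \<in> N +>\<^bsub>M\<^esub> x" for y
  proof -
    have yc: "y \<in> carrier M" using y x N.a_elemrcos_carrier by blast
    have "y \<ominus>\<^bsub>M\<^esub> x \<in> N" using N.a_rcos_module[OF x yc] y by (simp add: a_minus_def)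
    then have "a \<odot>\<^bsub>M\<^esub> (y \<ominus>\<^bsub>M\<^esub> x) \<in> N" using left_submoduleD(4)[OF N a] by simp
    then have "a \<odot>\<^bsub>M\<^esub> y \<ominus>\<^bsub>M\<^esub> a \<odot>\<^bsub>M\<^esub> x \<in> N"
      using a x yc by (simp add: a_minus_def smult_r_distr smult_minus)
    then show ?thesis using minus_in_submodule_iff[OF N] a x yc by simp
  qed
  show "a \<odot>\<^bsub>quotient_module M N\<^esub> (N +>\<^bsub>M\<^esub> x) = N +>\<^bsub>M\<^esub> (a \<odot>\<^bsub>M\<^esub> x)"
  proof -
    have "(\<Union>y\<in>N +>\<^bsub>M\<^esub> x. N +>\<^bsub>M\<^esub> (a \<odot>\<^bsub>M\<^esub> y)) = (\<Union>y\<in>N +>\<^bsub>M\<^esub> x. N +>\<^bsub>M\<^esub> (a \<odot>\<^bsub>M\<^esub> x))"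
      by (intro SUP_cong refl) fact
    also have "\<dots> = N +>\<^bsub>M\<^esub> (a \<odot>\<^bsub>M\<^esub> x)" using N.a_rcos_self[OF x] by blast
    finally show ?thesis by (simp add: quotient_module_def)
  qed
qed

end

section \<open>Epimorphisms and the homomorphism theorem\<close>

definition module_epi ::
  "('a, 'r) ring_scheme \<Rightarrow> ('a, 'b, 'm) module_scheme \<Rightarrow> ('a, 'c, 'n) module_scheme \<Rightarrow> ('b \<Rightarrow> 'c) \<Rightarrow> bool" where
  "module_epi R M N p \<longleftrightarrow> p ` carrier M = carrier N \<and>
     (\<forall>x\<in>carrier M. \<forall>y\<in>carrier M. p (x \<oplus>\<^bsub>M\<^esub> y) = p x \<oplus>\<^bsub>N\<^esub> p y) \<and>
     (\<forall>a\<in>carrier R. \<forall>x\<in>carrier M. p (a \<odot>\<^bsub>M\<^esub> x) = a \<odot>\<^bsub>N\<^esub> p x)"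

lemma module_epi_simps:
  assumes "module_epi R M N p" "left_module R M" "left_module R N"
  shows "x \<in> carrier M \<Longrightarrow> p x \<in> carrier N"
    and "\<lbrakk>x \<in> carrier M; y \<in> carrier M\<rbrakk> \<Longrightarrow> p (x \<oplus>\<^bsub>M\<^esub> y) = p x \<oplus>\<^bsub>N\<^esub> p y"
    and "\<lbrakk>a \<in> carrier R; x \<in> carrier M\<rbrakk> \<Longrightarrow> p (a \<odot>\<^bsub>M\<^esub> x) = a \<odot>\<^bsub>N\<^esub> p x"
    and "p \<zero>\<^bsub>M\<^esub> = \<zero>\<^bsub>N\<^esub>"
    and "\<lbrakk>x \<in> carrier M; y \<in> carrier M\<rbrakk> \<Longrightarrow> p (x \<ominus>\<^bsub>M\<^esub> y) = p x \<ominus>\<^bsub>N\<^esub> p y"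
    and "\<lbrakk>x \<in> carrier M; y \<in> carrier M\<rbrakk> \<Longrightarrow> p x = p y \<longleftrightarrow> p (x \<ominus>\<^bsub>M\<^esub> y) = \<zero>\<^bsub>N\<^esub>"
proof -
  interpret M: left_module R M by fact
  interpret N: left_module R N by fact
  show cl: "x \<in> carrier M \<Longrightarrow> p x \<in> carrier N" for x using assms by (auto simp: module_epi_def)
  show add: "\<lbrakk>x \<in> carrier M; y \<in> carrier M\<rbrakk> \<Longrightarrow> p (x \<oplus>\<^bsub>M\<^esub> y) = p x \<oplus>\<^bsub>N\<^esub> p y" for x y
    using assms by (auto simp: module_epi_def)
  show sm: "\<lbrakk>a \<in> carrier R; x \<in> carrier M\<rbrakk> \<Longrightarrow> p (a \<odot>\<^bsub>M\<^esub> x) = a \<odot>\<^bsub>N\<^esub> p x" for a x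
    using assms by (auto simp: module_epi_def)
  show "p \<zero>\<^bsub>M\<^esub> = \<zero>\<^bsub>N\<^esub>"
    using sm[of "\<zero>\<^bsub>R\<^esub>" "\<zero>\<^bsub>M\<^esub>"] cl[of "\<zero>\<^bsub>M\<^esub>"] by (simp add: M.zero_smult N.zero_smult)
  have neg: "y \<in> carrier M \<Longrightarrow> p (\<ominus>\<^bsub>M\<^esub> y) = \<ominus>\<^bsub>N\<^esub> p y" for y
    using sm[of "\<ominus>\<^bsub>R\<^esub> \<one>\<^bsub>R\<^esub>" y] cl[of y] by (simp add: M.minus_one_smult N.minus_one_smult)
  show diff: "\<lbrakk>x \<in> carrier M; y \<in> carrier M\<rbrakk> \<Longrightarrow> p (x \<ominus>\<^bsub>M\<^esub> y) = p x \<ominus>\<^bsub>N\<^esub> p y" for x y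
    using add[of x "\<ominus>\<^bsub>M\<^esub> y"] neg[of y] by (simp add: a_minus_def)
  show "\<lbrakk>x \<in> carrier M; y \<in> carrier M\<rbrakk> \<Longrightarrow> p x = p y \<longleftrightarrow> p (x \<ominus>\<^bsub>M\<^esub> y) = \<zero>\<^bsub>N\<^esub>"
    using cl[of x] cl[of y] diff[of x y] N.minus_eq_zero_iff[of "p x" "p y"] by simp
qed

text \<open>The homomorphism theorem in both directions. Tops can then be compared through
  epimorphisms defined on the module itself, without arithmetic of cosets.\<close>

lemma quotient_isomorphic_iff:
  assumes M: "left_module R M" and T: "left_module R T" and N: "submodule N R M"
  shows "module_isomorphic R (quotient_module M N) T \<longleftrightarrow>
    (\<exists>p. module_epi R M T p \<and> (\<forall>x\<in>carrier M. p x = \<zero>\<^bsub>T\<^esub> \<longleftrightarrow> x \<in> N))"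
proof
  interpret M: left_module R M by fact
  interpret T: left_module R T by fact
  note Q = M.quotient_module_simps[OF N]
  assume "module_isomorphic R (quotient_module M N) T"
  then obtain h where h: "bij_betw h ((\<lambda>x. N +>\<^bsub>M\<^esub> x) ` carrier M) (carrier T)"
    "\<And>x y. \<lbrakk>x \<in> carrier M; y \<in> carrier M\<rbrakk> \<Longrightarrow> h (N +>\<^bsub>M\<^esub> (x \<oplus>\<^bsub>M\<^esub> y)) = h (N +>\<^bsub>M\<^esub> x) \<oplus>\<^bsub>T\<^esub> h (N +>\<^bsub>M\<^esub> y)"
    "\<And>a x. \<lbrakk>a \<in> carrier R; x \<in> carrier M\<rbrakk> \<Longrightarrow> h (N +>\<^bsub>M\<^esub> (a \<odot>\<^bsub>M\<^esub> x)) = a \<odot>\<^bsub>T\<^esub> h (N +>\<^bsub>M\<^esub> x)"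
    using Q by (auto simp: module_isomorphic_def)
  have epi: "module_epi R M T (\<lambda>x. h (N +>\<^bsub>M\<^esub> x))"
    using h bij_betw_imp_surj_on[OF h(1)] by (auto simp: module_epi_def image_image)
  have "h (N +>\<^bsub>M\<^esub> x) = \<zero>\<^bsub>T\<^esub> \<longleftrightarrow> x \<in> N" if x: "x \<in> carrier M" for x
  proof -
    have "h (N +>\<^bsub>M\<^esub> x) = \<zero>\<^bsub>T\<^esub> \<longleftrightarrow> h (N +>\<^bsub>M\<^esub> x) = h (N +>\<^bsub>M\<^esub> \<zero>\<^bsub>M\<^esub>)"
      using module_epi_simps(4)[OF epi M T] by simp
    also have "\<dots> \<longleftrightarrow> N +>\<^bsub>M\<^esub> x = N +>\<^bsub>M\<^esub> \<zero>\<^bsub>M\<^esub>"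
      using h(1) x by (auto simp: bij_betw_def inj_on_def)
    also have "\<dots> \<longleftrightarrow> x \<in> N"
      using M.minus_in_submodule_iff[OF N x, of "\<zero>\<^bsub>M\<^esub>"] x by (simp add: M.minus_zero_right)
    finally show ?thesis .
  qed
  with epi show "\<exists>p. module_epi R M T p \<and> (\<forall>x\<in>carrier M. p x = \<zero>\<^bsub>T\<^esub> \<longleftrightarrow> x \<in> N)" by blast
next
  interpret M: left_module R M by fact
  interpret T: left_module R T by fact
  note Q = M.quotient_module_simps[OF N]
  interpret N: abelian_subgroup N M
    using M.left_submoduleD(6)[OF N] M.abelian_group_axioms by (rule abelian_subgroupI3)
  assume "\<exists>p. module_epi R M T p \<and> (\<forall>x\<in>carrier M. p x = \<zero>\<^bsub>T\<^esub> \<longleftrightarrow> x \<in> N)"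
  then obtain p where p: "module_epi R M T p" "\<And>x. x \<in> carrier M \<Longrightarrow> p x = \<zero>\<^bsub>T\<^esub> \<longleftrightarrow> x \<in> N" by blast
  note E = module_epi_simps[OF p(1) M T]
  have eq: "p x = p y \<longleftrightarrow> N +>\<^bsub>M\<^esub> x = N +>\<^bsub>M\<^esub> y" if "x \<in> carrier M" "y \<in> carrier M" for x y
    unfolding E(6)[OF that] M.minus_in_submodule_iff[OF N that] using that by (intro p(2)) auto
  \<comment> \<open>The induced map evaluates \<open>p\<close> at a representative; the choice is
    immaterial because \<open>p\<close> is constant on cosets.\<close>
  define h where "h C = p (SOME x. x \<in> C)" for C
  have h: "h (N +>\<^bsub>M\<^esub> x) = p x" if x: "x \<in> carrier M" for x
  proof -
    have y: "(SOME y. y \<in> N +>\<^bsub>M\<^esub> x) \<in> N +>\<^bsub>M\<^esub> x" using N.a_rcos_self[OF x] by (rule someI)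
    show ?thesis unfolding h_def
      using y x eq[of "SOME y. y \<in> N +>\<^bsub>M\<^esub> x" x] M.a_repr_independence[OF y x N.a_subgroup]
        N.a_elemrcos_carrier[OF x y] by simp
  qed
  show "module_isomorphic R (quotient_module M N) T"
    unfolding module_isomorphic_def
  proof (intro exI[of _ h] conjI ballI)
    show "bij_betw h (carrier (quotient_module M N)) (carrier T)"
      unfolding bij_betw_def Q(1)
    proof (intro conjI inj_onI)
      show "h ` (\<lambda>x. N +>\<^bsub>M\<^esub> x) ` carrier M = carrier T"
        using h p(1) by (auto simp: module_epi_def image_image)
    qed (use h eq in auto)
  next
    fix C D assume "C \<in> carrier (quotient_module M N)" "D \<in> carrier (quotient_module M N)"
    then show "h (C \<oplus>\<^bsub>quotient_module M N\<^esub> D) = h C \<oplus>\<^bsub>T\<^esub> h D" using Q h E(2) by auto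
  next
    fix a C assume "a \<in> carrier R" "C \<in> carrier (quotient_module M N)"
    then show "h (a \<odot>\<^bsub>quotient_module M N\<^esub> C) = a \<odot>\<^bsub>T\<^esub> h C" using Q h E(3) by auto
  qed
qed

section \<open>Modules over a ring whose radical squares to zero\<close>

locale radical_square_zero_ring = ring R for R :: "('a, 'r) ring_scheme" (structure) +
  assumes radical_ideal: "ideal (jacobson_radical R) R"
    and radical_mult: "\<lbrakk>a \<in> jacobson_radical R; b \<in> jacobson_radical R\<rbrakk> \<Longrightarrow> a \<otimes> b = \<zero>"
begin

lemma radical_carrier: "a \<in> jacobson_radical R \<Longrightarrow> a \<in> carrier R"
  using additive_subgroup.a_Hcarr[OF ideal.axioms(1)[OF radical_ideal]] .

text \<open>The radical submodule is generated as an additive group only. It is stable under the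
  ring because J absorbs multiplication from the left, which is followed through sums and
  negatives.\<close>

lemma submodule_radical:
  assumes "left_module R M"
  shows "submodule (radical_submodule R M) R M"
proof -
  interpret M: left_module R M by fact
  let ?S = "{a \<odot>\<^bsub>M\<^esub> x | a x. a \<in> jacobson_radical R \<and> x \<in> carrier M}"
  have S: "?S \<subseteq> carrier M" using radical_carrier by auto
  have sub: "subgroup (generate (add_monoid M) ?S) (add_monoid M)"
    using S by (intro group.generate_is_subgroup M.a_group) simp
  have "a \<odot>\<^bsub>M\<^esub> x \<in> generate (add_monoid M) ?S"
    if "x \<in> generate (add_monoid M) ?S" and a: "a \<in> carrier R" for a x
    using that(1)
  proof induction
    case one
    then show ?case using M.smult_zero[OF a] subgroup.one_closed[OF sub] by simp
  next
    case (incl h)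
    then obtain b y where "h = b \<odot>\<^bsub>M\<^esub> y" "b \<in> jacobson_radical R" "y \<in> carrier M" by blast
    then have "a \<odot>\<^bsub>M\<^esub> h = (a \<otimes> b) \<odot>\<^bsub>M\<^esub> y" "a \<otimes> b \<in> jacobson_radical R" "y \<in> carrier M"
      using a radical_carrier ideal.I_l_closed[OF radical_ideal] by (auto simp: M.smult_assoc1)
    then show ?case by (intro generate.incl) blast
  next
    case (inv h)
    then obtain b y where h: "h = b \<odot>\<^bsub>M\<^esub> y" "b \<in> jacobson_radical R" "y \<in> carrier M" by blast
    then have "a \<odot>\<^bsub>M\<^esub> (inv\<^bsub>add_monoid M\<^esub> h) = inv\<^bsub>add_monoid M\<^esub> ((a \<otimes> b) \<odot>\<^bsub>M\<^esub> y)"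
      using a radical_carrier by (simp add: M.smult_assoc1 M.smult_minus flip: a_inv_def)
    moreover have "a \<otimes> b \<in> jacobson_radical R" using a h ideal.I_l_closed[OF radical_ideal] by blast
    ultimately show ?case using h(3) by (metis (mono_tags, lifting) generate.inv mem_Collect_eq)
  next
    case (eng h1 h2)
    then have "h1 \<in> carrier M" "h2 \<in> carrier M" using subgroup.subset[OF sub] by auto
    then have "a \<odot>\<^bsub>M\<^esub> (h1 \<otimes>\<^bsub>add_monoid M\<^esub> h2) = a \<odot>\<^bsub>M\<^esub> h1 \<otimes>\<^bsub>add_monoid M\<^esub> (a \<odot>\<^bsub>M\<^esub> h2)"
      using a by (simp add: M.smult_r_distr)
    then show ?case using generate.eng[OF eng.IH] by simp
  qed
  then show ?thesis unfolding radical_submodule_def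
    using subgroup.subset[OF sub] subgroup.one_closed[OF sub] subgroup.m_closed[OF sub]
    by (intro M.left_submoduleI) auto
qed

lemma radical_smult_in:
  "\<lbrakk>a \<in> jacobson_radical R; x \<in> carrier M\<rbrakk> \<Longrightarrow> a \<odot>\<^bsub>M\<^esub> x \<in> radical_submodule R M"
  unfolding radical_submodule_def by (intro generate.incl) blast

lemma radical_submodule_least:
  assumes "left_module R M" "submodule N R M"
    and "\<And>a x. \<lbrakk>a \<in> jacobson_radical R; x \<in> carrier M\<rbrakk> \<Longrightarrow> a \<odot>\<^bsub>M\<^esub> x \<in> N"
  shows "radical_submodule R M \<subseteq> N"
  unfolding radical_submodule_def
  using assms(3) by (intro left_module.generate_subset_submodule[OF assms(1,2)]) auto

text \<open>Stability holds because J absorbs multiplication from the right: b (a x) = (b a) x. The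
  next two lemmas show that this submodule contains the radical and, for a semisimple module,
  everything.\<close>

lemma submodule_radical_annihilator:
  assumes "left_module R M"
  shows "submodule {x \<in> carrier M. \<forall>a\<in>jacobson_radical R. a \<odot>\<^bsub>M\<^esub> x = \<zero>\<^bsub>M\<^esub>} R M"
proof -
  interpret M: left_module R M by fact
  show ?thesis
  proof (rule M.left_submoduleI)
    fix a x assume a: "a \<in> carrier R" and x: "x \<in> {x \<in> carrier M. \<forall>a\<in>jacobson_radical R. a \<odot>\<^bsub>M\<^esub> x = \<zero>\<^bsub>M\<^esub>}"
    have "b \<odot>\<^bsub>M\<^esub> (a \<odot>\<^bsub>M\<^esub> x) = \<zero>\<^bsub>M\<^esub>" if "b \<in> jacobson_radical R" for b
    proof -
      have "b \<otimes> a \<in> jacobson_radical R" using that a ideal.I_r_closed[OF radical_ideal] by blast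
      then show ?thesis using x a that radical_carrier[of b] M.smult_assoc1[of b a x] by auto
    qed
    then show "a \<odot>\<^bsub>M\<^esub> x \<in> {x \<in> carrier M. \<forall>a\<in>jacobson_radical R. a \<odot>\<^bsub>M\<^esub> x = \<zero>\<^bsub>M\<^esub>}"
      using a x by auto
  qed (use radical_carrier in \<open>auto simp: M.smult_zero M.smult_r_distr\<close>)
qed

lemma radical_smult_radical_submodule:
  assumes "left_module R M" "x \<in> radical_submodule R M" "a \<in> jacobson_radical R"
  shows "a \<odot>\<^bsub>M\<^esub> x = \<zero>\<^bsub>M\<^esub>"
proof -
  interpret M: left_module R M by fact
  have "radical_submodule R M \<subseteq> {x \<in> carrier M. \<forall>a\<in>jacobson_radical R. a \<odot>\<^bsub>M\<^esub> x = \<zero>\<^bsub>M\<^esub>}"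
    using submodule_radical_annihilator[OF assms(1)]
  proof (rule radical_submodule_least[OF assms(1)])
    fix b y assume "b \<in> jacobson_radical R" "y \<in> carrier M"
    then show "b \<odot>\<^bsub>M\<^esub> y \<in> {x \<in> carrier M. \<forall>a\<in>jacobson_radical R. a \<odot>\<^bsub>M\<^esub> x = \<zero>\<^bsub>M\<^esub>}"
      using radical_carrier radical_mult by (auto simp: M.zero_smult simp flip: M.smult_assoc1)
  qed
  then show ?thesis using assms by blast
qed

text \<open>A simple submodule S meets the annihilator of J in 0 or in S. In the first case J S lies
  in this intersection, because J squares to zero, and therefore vanishes as well.\<close>

lemma radical_smult_semisimple:
  assumes ss: "semisimple_module R U" and a: "a \<in> jacobson_radical R" and u: "u \<in> carrier U"
  shows "a \<odot>\<^bsub>U\<^esub> u = \<zero>\<^bsub>U\<^esub>"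
proof -
  interpret U: left_module R U using ss by (simp add: semisimple_module_def)
  let ?A = "{x \<in> carrier U. \<forall>a\<in>jacobson_radical R. a \<odot>\<^bsub>U\<^esub> x = \<zero>\<^bsub>U\<^esub>}"
  note A = submodule_radical_annihilator[OF U.left_module_axioms]
  have "S \<subseteq> ?A" if S: "simple_submodule R U S" for S
  proof
    fix s assume s: "s \<in> S"
    have Ssub: "submodule S R U" using S by (simp add: simple_submodule_def)
    note SD = U.left_submoduleD[OF Ssub] and AD = U.left_submoduleD[OF A]
    have "submodule (S \<inter> ?A) R U"
      using SD(1-4) AD(2-4) by (intro U.left_submoduleI) auto
    then have cases: "S \<inter> ?A = {\<zero>\<^bsub>U\<^esub>} \<or> S \<inter> ?A = S" using S by (simp add: simple_submodule_def)
    have sc: "s \<in> carrier U" using s SD(1) by blast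
    have "b \<odot>\<^bsub>U\<^esub> s = \<zero>\<^bsub>U\<^esub>" if b: "b \<in> jacobson_radical R" for b
      using cases
    proof
      assume "S \<inter> ?A = {\<zero>\<^bsub>U\<^esub>}"
      moreover have "b \<odot>\<^bsub>U\<^esub> s \<in> S \<inter> ?A"
        using s sc b SD(4) radical_carrier radical_mult
        by (auto simp: U.zero_smult simp flip: U.smult_assoc1)
      ultimately show ?thesis by blast
    next
      assume "S \<inter> ?A = S"
      then show ?thesis using s b by blast
    qed
    then show "s \<in> ?A" using sc by blast
  qed
  then have "carrier U \<subseteq> ?A"
    using ss U.generate_subset_submodule[OF A, of "\<Union>{S. simple_submodule R U S}"]
    by (auto simp: semisimple_module_def)
  then show ?thesis using a u by blast
qed

lemma top_isomorphic_iff: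
  assumes "left_module R M" "left_module R T"
  shows "module_isomorphic R (top_module R M) T \<longleftrightarrow>
    (\<exists>p. module_epi R M T p \<and> (\<forall>x\<in>carrier M. p x = \<zero>\<^bsub>T\<^esub> \<longleftrightarrow> x \<in> radical_submodule R M))"
  unfolding top_module_def by (intro quotient_isomorphic_iff assms submodule_radical)

text \<open>The map \<open>\<theta>\<close> respects the ring action only modulo the radical of
  \<open>N\<close>; followed by the epimorphism from \<open>N\<close> onto \<open>T\<close> it
  becomes a homomorphism. Vertexwise linear maps between representations need this slack, since they
  need not commute with the arrows.\<close>

lemma top_isomorphic_transfer:
  assumes M: "left_module R M" and N: "left_module R N" and T: "left_module R T"
    and iso: "module_isomorphic R (top_module R N) T"
    and cl: "\<And>x. x \<in> carrier M \<Longrightarrow> \<theta> x \<in> carrier N"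
    and add: "\<And>x y. \<lbrakk>x \<in> carrier M; y \<in> carrier M\<rbrakk> \<Longrightarrow> \<theta> (x \<oplus>\<^bsub>M\<^esub> y) = \<theta> x \<oplus>\<^bsub>N\<^esub> \<theta> y"
    and smult: "\<And>a x. \<lbrakk>a \<in> carrier R; x \<in> carrier M\<rbrakk> \<Longrightarrow>
      \<theta> (a \<odot>\<^bsub>M\<^esub> x) \<ominus>\<^bsub>N\<^esub> a \<odot>\<^bsub>N\<^esub> \<theta> x \<in> radical_submodule R N"
    and ker: "\<And>x. x \<in> carrier M \<Longrightarrow> \<theta> x \<in> radical_submodule R N \<longleftrightarrow> x \<in> radical_submodule R M"
    and surj: "\<And>y. y \<in> carrier N \<Longrightarrow> \<exists>x\<in>carrier M. y \<ominus>\<^bsub>N\<^esub> \<theta> x \<in> radical_submodule R N"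
  shows "module_isomorphic R (top_module R M) T"
proof -
  interpret N: left_module R N by fact
  interpret M: left_module R M by fact
  obtain p where p: "module_epi R N T p"
    "\<And>x. x \<in> carrier N \<Longrightarrow> p x = \<zero>\<^bsub>T\<^esub> \<longleftrightarrow> x \<in> radical_submodule R N"
    using iso top_isomorphic_iff[OF N T] by blast
  note E = module_epi_simps[OF p(1) N T]
  have eq: "p x = p y" if "x \<in> carrier N" "y \<in> carrier N" "x \<ominus>\<^bsub>N\<^esub> y \<in> radical_submodule R N" for x y
    using E(6)[OF that(1,2)] p(2) that by simp
  have "module_epi R M T (p \<circ> \<theta>)"
    unfolding module_epi_def
  proof (intro conjI ballI)
    show "(p \<circ> \<theta>) ` carrier M = carrier T"
    proof
      show "(p \<circ> \<theta>) ` carrier M \<subseteq> carrier T" using cl E(1) by auto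
      show "carrier T \<subseteq> (p \<circ> \<theta>) ` carrier M"
      proof
        fix t assume "t \<in> carrier T"
        then obtain y where y: "y \<in> carrier N" "t = p y" using p(1) unfolding module_epi_def by blast
        then obtain x where x: "x \<in> carrier M" "y \<ominus>\<^bsub>N\<^esub> \<theta> x \<in> radical_submodule R N" using surj by blast
        then have "t = (p \<circ> \<theta>) x" using eq y cl by simp
        then show "t \<in> (p \<circ> \<theta>) ` carrier M" using x by blast
      qed
    qed
  next
    fix x y assume "x \<in> carrier M" "y \<in> carrier M"
    then show "(p \<circ> \<theta>) (x \<oplus>\<^bsub>M\<^esub> y) = (p \<circ> \<theta>) x \<oplus>\<^bsub>T\<^esub> (p \<circ> \<theta>) y" using add cl E(2) by simp
  next
    fix a x assume ax: "a \<in> carrier R" "x \<in> carrier M"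
    then have "p (\<theta> (a \<odot>\<^bsub>M\<^esub> x)) = p (a \<odot>\<^bsub>N\<^esub> \<theta> x)" by (intro eq smult) (simp_all add: cl)
    then show "(p \<circ> \<theta>) (a \<odot>\<^bsub>M\<^esub> x) = a \<odot>\<^bsub>T\<^esub> (p \<circ> \<theta>) x" using E(3) ax cl by simp
  qed
  moreover have "\<forall>x\<in>carrier M. (p \<circ> \<theta>) x = \<zero>\<^bsub>T\<^esub> \<longleftrightarrow> x \<in> radical_submodule R M"
    using p(2) cl ker by simp
  ultimately show ?thesis using top_isomorphic_iff[OF M T] by blast
qed

text \<open>The epimorphism is the projection to \<open>M\<close> followed by the map onto the top.
  Its kernel corresponds to the radical of \<open>M\<close> together with \<open>U\<close>. It
  contains J N because first components of products lie in J M, and J kills it because J squares to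
  zero and annihilates the semisimple \<open>U\<close>.\<close>

lemma direct_sum_top_epi:
  assumes N: "left_module R N" and M: "left_module R M" and T: "left_module R T"
    and U: "semisimple_module R U"
    and top: "module_isomorphic R (top_module R M) T"
    and iso: "module_isomorphic R N (direct_sum_module M U)"
  obtains p where "module_epi R N T p"
    "\<And>a x. \<lbrakk>a \<in> jacobson_radical R; x \<in> carrier N\<rbrakk> \<Longrightarrow> p (a \<odot>\<^bsub>N\<^esub> x) = \<zero>\<^bsub>T\<^esub>"
    "\<And>a x. \<lbrakk>a \<in> jacobson_radical R; x \<in> carrier N; p x = \<zero>\<^bsub>T\<^esub>\<rbrakk> \<Longrightarrow> a \<odot>\<^bsub>N\<^esub> x = \<zero>\<^bsub>N\<^esub>"
proof -
  interpret N: left_module R N by fact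
  interpret M: left_module R M by fact
  interpret T: left_module R T by fact
  interpret U: left_module R U using U by (simp add: semisimple_module_def)
  obtain p where p: "module_epi R M T p"
    "\<And>x. x \<in> carrier M \<Longrightarrow> p x = \<zero>\<^bsub>T\<^esub> \<longleftrightarrow> x \<in> radical_submodule R M"
    using top top_isomorphic_iff[OF M T] by blast
  note E = module_epi_simps[OF p(1) M T]
  obtain h where h: "bij_betw h (carrier N) (carrier M \<times> carrier U)"
    "\<And>x y. \<lbrakk>x \<in> carrier N; y \<in> carrier N\<rbrakk> \<Longrightarrow> h (x \<oplus>\<^bsub>N\<^esub> y) = (fst (h x) \<oplus>\<^bsub>M\<^esub> fst (h y), snd (h x) \<oplus>\<^bsub>U\<^esub> snd (h y))"
    "\<And>a x. \<lbrakk>a \<in> carrier R; x \<in> carrier N\<rbrakk> \<Longrightarrow> h (a \<odot>\<^bsub>N\<^esub> x) = (a \<odot>\<^bsub>M\<^esub> fst (h x), a \<odot>\<^bsub>U\<^esub> snd (h x))"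
    using iso by (auto simp: module_isomorphic_def direct_sum_module_def case_prod_beta)
  have hc: "fst (h x) \<in> carrier M" "snd (h x) \<in> carrier U" if "x \<in> carrier N" for x
    using bij_betwE[OF h(1)] that by (auto simp: mem_Times_iff)
  have h0: "h \<zero>\<^bsub>N\<^esub> = (\<zero>\<^bsub>M\<^esub>, \<zero>\<^bsub>U\<^esub>)"
    using h(3)[of "\<zero>" "\<zero>\<^bsub>N\<^esub>"] hc[of "\<zero>\<^bsub>N\<^esub>"] by (simp add: N.zero_smult M.zero_smult U.zero_smult)
  show ?thesis
  proof (rule that[of "\<lambda>x. p (fst (h x))"])
    have "fst ` h ` carrier N = carrier M"
      using bij_betw_imp_surj_on[OF h(1)] U.M.zero_closed by auto
    then have "(\<lambda>x. p (fst (h x))) ` carrier N = carrier T"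
      using p(1) by (metis (no_types, lifting) image_cong image_image module_epi_def)
    then show "module_epi R N T (\<lambda>x. p (fst (h x)))"
      using h hc E by (auto simp: module_epi_def)
  next
    fix a x assume ax: "a \<in> jacobson_radical R" "x \<in> carrier N"
    then show "p (fst (h (a \<odot>\<^bsub>N\<^esub> x))) = \<zero>\<^bsub>T\<^esub>"
      using h(3) hc p(2) radical_smult_in radical_carrier by fastforce
    assume "p (fst (h x)) = \<zero>\<^bsub>T\<^esub>"
    then have "fst (h x) \<in> radical_submodule R M" using p(2) hc ax by simp
    then have "h (a \<odot>\<^bsub>N\<^esub> x) = h \<zero>\<^bsub>N\<^esub>"
      using h(3) ax radical_carrier h0 hc radical_smult_radical_submodule[OF M]
        radical_smult_semisimple[OF U] by simp
    then show "a \<odot>\<^bsub>N\<^esub> x = \<zero>\<^bsub>N\<^esub>"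
      using h(1) ax radical_carrier by (auto simp: bij_betw_def inj_on_def)
  qed
qed

end

section \<open>Submodules as direct summands and as kernels\<close>

lemma (in left_module) isomorphic_internal_direct_sum:
  assumes A: "submodule A R M" and B: "submodule B R M"
    and sum: "\<And>x. x \<in> carrier M \<Longrightarrow> \<exists>a\<in>A. \<exists>b\<in>B. x = a \<oplus>\<^bsub>M\<^esub> b"
    and disj: "A \<inter> B \<subseteq> {\<zero>\<^bsub>M\<^esub>}"
  shows "module_isomorphic R M (direct_sum_module (M\<lparr>carrier := A\<rparr>) (M\<lparr>carrier := B\<rparr>))"
proof -
  note AD = left_submoduleD[OF A] and BD = left_submoduleD[OF B]
  let ?f = "\<lambda>(a, b). a \<oplus>\<^bsub>M\<^esub> b"
  have uniq: "a = a' \<and> b = b'" if "a \<in> A" "b \<in> B" "a' \<in> A" "b' \<in> B" "a \<oplus>\<^bsub>M\<^esub> b = a' \<oplus>\<^bsub>M\<^esub> b'" for a b a' b'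
  proof -
    have c: "a \<in> carrier M" "b \<in> carrier M" "a' \<in> carrier M" "b' \<in> carrier M" using that AD(1) BD(1) by auto
    have "a \<ominus>\<^bsub>M\<^esub> a' = b' \<ominus>\<^bsub>M\<^esub> b"
    proof -
      have "a \<ominus>\<^bsub>M\<^esub> a' = (a \<oplus>\<^bsub>M\<^esub> b) \<ominus>\<^bsub>M\<^esub> b \<ominus>\<^bsub>M\<^esub> a'"
        using c by (simp add: a_minus_def M.a_assoc M.r_neg)
      also have "\<dots> = (a' \<oplus>\<^bsub>M\<^esub> b') \<ominus>\<^bsub>M\<^esub> b \<ominus>\<^bsub>M\<^esub> a'" using that(5) by simp
      also have "\<dots> = b' \<ominus>\<^bsub>M\<^esub> b" 
      proof -
        have "a' \<oplus>\<^bsub>M\<^esub> b' \<ominus>\<^bsub>M\<^esub> b \<ominus>\<^bsub>M\<^esub> a' = a' \<oplus>\<^bsub>M\<^esub> (b' \<oplus>\<^bsub>M\<^esub> (\<ominus>\<^bsub>M\<^esub> a' \<oplus>\<^bsub>M\<^esub> \<ominus>\<^bsub>M\<^esub> b))"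
          using c by (simp add: a_minus_def M.a_ac)
        also have "\<dots> = b' \<oplus>\<^bsub>M\<^esub> (a' \<oplus>\<^bsub>M\<^esub> (\<ominus>\<^bsub>M\<^esub> a' \<oplus>\<^bsub>M\<^esub> \<ominus>\<^bsub>M\<^esub> b))"
          using c by (intro M.a_lcomm) auto
        also have "\<dots> = b' \<ominus>\<^bsub>M\<^esub> b" using c by (simp add: a_minus_def M.r_neg2)
        finally show ?thesis .
      qed
      finally show ?thesis .
    qed
    moreover have "a \<ominus>\<^bsub>M\<^esub> a' \<in> A" "b' \<ominus>\<^bsub>M\<^esub> b \<in> B"
      using that AD(3,5) BD(3,5) by (auto simp: a_minus_def)
    ultimately have "a \<ominus>\<^bsub>M\<^esub> a' = \<zero>\<^bsub>M\<^esub>" "b' \<ominus>\<^bsub>M\<^esub> b = \<zero>\<^bsub>M\<^esub>" using disj by auto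
    then show ?thesis using c by (simp add: M.minus_eq_zero_iff)
  qed
  have bij: "bij_betw ?f (A \<times> B) (carrier M)"
    unfolding bij_betw_def
  proof (intro conjI inj_onI)
    show "?f ` (A \<times> B) = carrier M"
    proof
      show "?f ` (A \<times> B) \<subseteq> carrier M" using AD(1) BD(1) by auto
      show "carrier M \<subseteq> ?f ` (A \<times> B)"
      proof
        fix x assume "x \<in> carrier M"
        then obtain a b where "a \<in> A" "b \<in> B" "x = a \<oplus>\<^bsub>M\<^esub> b" using sum by blast
        then show "x \<in> ?f ` (A \<times> B)" by (intro image_eqI[of _ _ "(a, b)"]) simp_all
      qed
    qed
  next
    fix c c' assume "c \<in> A \<times> B" "c' \<in> A \<times> B" "?f c = ?f c'"
    then show "c = c'" using uniq[of "fst c" "snd c" "fst c'" "snd c'"]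
      by (simp add: case_prod_beta mem_Times_iff prod_eq_iff)
  qed
  let ?h = "the_inv_into (A \<times> B) ?f"
  have h: "?h (a \<oplus>\<^bsub>M\<^esub> b) = (a, b)" if "a \<in> A" "b \<in> B" for a b
    using the_inv_into_f_f[OF bij_betw_imp_inj_on[OF bij], of "(a, b)"] that by simp
  show ?thesis
    unfolding module_isomorphic_def
  proof (intro exI[of _ ?h] conjI ballI)
    show "bij_betw ?h (carrier M)
        (carrier (direct_sum_module (M\<lparr>carrier := A\<rparr>) (M\<lparr>carrier := B\<rparr>)))"
      using bij_betw_the_inv_into[OF bij] by (simp add: direct_sum_module_def)
  next
    fix x y assume "x \<in> carrier M" "y \<in> carrier M"
    then obtain a b a' b' where x: "a \<in> A" "b \<in> B" "x = a \<oplus>\<^bsub>M\<^esub> b" and y: "a' \<in> A" "b' \<in> B" "y = a' \<oplus>\<^bsub>M\<^esub> b'"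
      using sum by metis
    have "x \<oplus>\<^bsub>M\<^esub> y = (a \<oplus>\<^bsub>M\<^esub> a') \<oplus>\<^bsub>M\<^esub> (b \<oplus>\<^bsub>M\<^esub> b')"
    proof -
      have "a \<in> carrier M" "b \<in> carrier M" "a' \<in> carrier M" "b' \<in> carrier M" using x y AD(1) BD(1) by auto
      then show ?thesis unfolding x(3) y(3) by (simp add: M.a_ac)
    qed
    then show "?h (x \<oplus>\<^bsub>M\<^esub> y) = ?h x \<oplus>\<^bsub>direct_sum_module (M\<lparr>carrier := A\<rparr>) (M\<lparr>carrier := B\<rparr>)\<^esub> ?h y"
      using x y h AD(3) BD(3) by (simp add: direct_sum_module_def)
  next
    fix c x assume c: "c \<in> carrier R" and "x \<in> carrier M"
    then obtain a b where x: "a \<in> A" "b \<in> B" "x = a \<oplus>\<^bsub>M\<^esub> b"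
      using sum by metis
    then have "c \<odot>\<^bsub>M\<^esub> x = (c \<odot>\<^bsub>M\<^esub> a) \<oplus>\<^bsub>M\<^esub> (c \<odot>\<^bsub>M\<^esub> b)"
      using AD(1) BD(1) c by (auto simp: smult_r_distr subset_iff)
    then show "?h (c \<odot>\<^bsub>M\<^esub> x) = c \<odot>\<^bsub>direct_sum_module (M\<lparr>carrier := A\<rparr>) (M\<lparr>carrier := B\<rparr>)\<^esub> ?h x"
      using x h AD(4) BD(4) c by (simp add: direct_sum_module_def)
  qed
qed

lemma (in left_module) submodule_trans:
  assumes S: "submodule S R M" and H: "submodule H R (M\<lparr>carrier := S\<rparr>)"
  shows "submodule H R M"
proof -
  interpret S: left_module R "M\<lparr>carrier := S\<rparr>" by (rule submodule_carrier_update[OF S])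
  show ?thesis using S.left_submoduleD[OF H] left_submoduleD(1)[OF S]
    by (intro left_submoduleI) auto
qed

lemma (in left_module) carrier_submodule: "submodule (carrier M) R M"
  by (rule left_submoduleI) auto

lemma (in left_module) kernel_submodule:
  assumes T: "left_module R T" and p: "module_epi R M T p"
  shows "submodule {m \<in> carrier M. p m = \<zero>\<^bsub>T\<^esub>} R M"
proof -
  interpret T: left_module R T by fact
  note E = module_epi_simps[OF p left_module_axioms T]
  show ?thesis using E(2-4) by (intro left_submoduleI) (auto simp: T.smult_zero)
qed

section \<open>Quiver algebras with radical square zero\<close>

lemma path_algebra_simps:
  "carrier (path_algebra Q) = {f. finite {w. f w \<noteq> 0} \<and> {w. f w \<noteq> 0} \<subseteq> paths Q}"
  "\<zero>\<^bsub>path_algebra Q\<^esub> = (\<lambda>_. 0)"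
  "f \<oplus>\<^bsub>path_algebra Q\<^esub> g = (\<lambda>w. f w + g w)"
  "\<one>\<^bsub>path_algebra Q\<^esub> (u, r) = (if u \<in> verts Q \<and> r = [] then 1 else 0)"
  "(f \<otimes>\<^bsub>path_algebra Q\<^esub> g) (u, r) =
     (\<Sum>i\<le>length r. f (pre_digraph.awlast Q u (take i r), drop i r) * g (u, take i r))"
  by (simp_all add: path_algebra_def)

lemma path_mult_nil: "(f \<otimes>\<^bsub>path_algebra Q\<^esub> g) (u, []) = f (u, []) * g (u, [])"
  by (simp add: path_algebra_simps pre_digraph.awalk_verts.simps)

lemma path_mult_arrow:
  "(f \<otimes>\<^bsub>path_algebra Q\<^esub> g) (u, [\<alpha>]) = f (u, [\<alpha>]) * g (u, []) + f (head Q \<alpha>, []) * g (u, [\<alpha>])"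
  by (simp add: path_algebra_simps pre_digraph.awalk_verts.simps)

lemma path_mult_nonzero:
  assumes "(f \<otimes>\<^bsub>path_algebra Q\<^esub> g) (u, r) \<noteq> 0"
  obtains i where "i \<le> length r" "f (pre_digraph.awlast Q u (take i r), drop i r) \<noteq> 0" "g (u, take i r) \<noteq> 0"
proof -
  have "\<exists>i\<in>{..length r}. f (pre_digraph.awlast Q u (take i r), drop i r) * g (u, take i r) \<noteq> 0"
    using assms unfolding path_algebra_simps by (metis (no_types, lifting) sum.neutral)
  then show ?thesis using that by auto
qed

text \<open>The scalar is part of the element because scaling a module element is available only
  through the action of the algebra.\<close>

definition vertex_elem :: "'k::field \<Rightarrow> 'v \<Rightarrow> ('v, 'e) path \<Rightarrow> 'k" where
  "vertex_elem k v = (\<lambda>w. if w = (v, []) then k else 0)"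

definition arrow_elem :: "('v, 'e) pre_digraph \<Rightarrow> 'e \<Rightarrow> ('v, 'e) path \<Rightarrow> 'k::field" where
  "arrow_elem Q \<alpha> = (\<lambda>w. if w = (tail Q \<alpha>, [\<alpha>]) then 1 else 0)"

section \<open>Cosets modulo the admissible ideal\<close>

locale square_zero_quiver =
  fixes Q :: "('v, 'e) pre_digraph" and I :: "(('v, 'e) path \<Rightarrow> 'k::field) set"
  assumes quiver: "fin_digraph Q"
    and admissible: "admissible_ideal Q I"
    and radical_square:
      "ideal_prod (quiver_algebra Q I)
         (jacobson_radical (quiver_algebra Q I)) (jacobson_radical (quiver_algebra Q I))
       = {\<zero>\<^bsub>quiver_algebra Q I\<^esub>}"
begin

sublocale fin_digraph Q by (rule quiver)

abbreviation PA where "PA \<equiv> path_algebra Q :: (('v, 'e) path \<Rightarrow> 'k) ring"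
abbreviation \<Lambda> where "\<Lambda> \<equiv> quiver_algebra Q I"
definition cls :: "(('v, 'e) path \<Rightarrow> 'k) \<Rightarrow> (('v, 'e) path \<Rightarrow> 'k) set" where
  "cls = (+>\<^bsub>PA\<^esub>) I"

lemma I_ideal: "ideal I PA"
  using admissible by (simp add: admissible_ideal_def)

sublocale PA: ideal I PA by (rule I_ideal)

sublocale cls: ring_hom_ring PA \<Lambda> cls
  unfolding quiver_algebra_def cls_def by (rule PA.rcos_ring_hom_ring)

lemma I_length: "f \<in> I \<Longrightarrow> f (u, r) \<noteq> 0 \<Longrightarrow> 2 \<le> length r"
  using admissible by (auto simp: admissible_ideal_def arrow_ideal_power_def)

lemma carrier_Lambda: "carrier \<Lambda> = cls ` carrier PA"
  unfolding quiver_algebra_def FactRing_def A_RCOSETS_def' cls_def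
      by (simp only: partial_object.simps UNION_singleton_eq_range)

lemma carrier_LambdaE:
  assumes "C \<in> carrier \<Lambda>"
  obtains f where "f \<in> carrier PA" "C = cls f"
  using assms carrier_Lambda by auto

lemma zero_Lambda: "\<zero>\<^bsub>\<Lambda>\<^esub> = I"
  unfolding quiver_algebra_def FactRing_def by (simp only: ring.simps)

lemma a_inv_PA: "f \<in> carrier PA \<Longrightarrow> \<ominus>\<^bsub>PA\<^esub> f = (\<lambda>w. - f w)"
  by (rule PA.minus_equality) (auto simp: path_algebra_simps)

lemma uminus_PA_closed: "f \<in> carrier PA \<Longrightarrow> (\<lambda>w. - f w) \<in> carrier PA"
  using PA.a_inv_closed[of f] by (simp add: a_inv_PA)

text \<open>Elements of \<open>I\<close> have no terms of length below 2, so the coefficients at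
  trivial paths and arrows are invariants of the coset.\<close>

lemma coset_coeff:
  assumes "f \<in> carrier PA" "g \<in> cls f" "length r < 2"
  shows "g (u, r) = f (u, r)"
proof -
  have g: "g \<in> carrier PA" using assms PA.a_elemrcos_carrier unfolding cls_def by blast
  then have "g \<oplus>\<^bsub>PA\<^esub> \<ominus>\<^bsub>PA\<^esub> f \<in> I" using PA.a_rcos_module[OF assms(1) g] assms(2) unfolding cls_def by simp
  then have "g (u, r) - f (u, r) \<noteq> 0 \<Longrightarrow> 2 \<le> length r"
    using I_length[of "g \<oplus>\<^bsub>PA\<^esub> \<ominus>\<^bsub>PA\<^esub> f" u r] assms by (simp add: a_inv_PA path_algebra_simps(3))
  then show ?thesis using assms(3) by fastforce
qed

lemma cls_eq_coeff:
  assumes "f \<in> carrier PA" "g \<in> carrier PA" "cls f = cls g" "length r < 2"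
  shows "f (u, r) = g (u, r)"
  using coset_coeff[of g f r u] PA.a_rcos_self[of f] assms unfolding cls_def by simp

lemma carrier_PA_nonzero: "f \<in> carrier PA \<Longrightarrow> f (u, r) \<noteq> 0 \<Longrightarrow> (u, r) \<in> paths Q"
  by (auto simp: path_algebra_simps)

lemma path_nil: "(u, []) \<in> paths Q \<longleftrightarrow> u \<in> verts Q"
  by (auto simp: paths_def awalk_Nil_iff)

lemma path_arrow: "(u, [\<alpha>]) \<in> paths Q \<longleftrightarrow> \<alpha> \<in> arcs Q \<and> u = tail Q \<alpha>"
  by (auto simp: paths_def awalk_simps)

lemma vertex_elem_carrier: "v \<in> verts Q \<Longrightarrow> vertex_elem k v \<in> carrier PA"
  using path_nil[of v] by (auto simp: vertex_elem_def path_algebra_simps)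

lemma arrow_elem_carrier: "\<alpha> \<in> arcs Q \<Longrightarrow> arrow_elem Q \<alpha> \<in> carrier PA"
  using path_arrow[of "tail Q \<alpha>" \<alpha>] by (auto simp: arrow_elem_def path_algebra_simps)

section \<open>Computation of the Jacobson radical\<close>

lemma arrow_ideal_power_mult:
  assumes "f \<in> arrow_ideal_power Q j" "g \<in> arrow_ideal_power Q k"
  shows "f \<otimes>\<^bsub>PA\<^esub> g \<in> arrow_ideal_power Q (j + k)"
  unfolding arrow_ideal_power_def
proof (intro CollectI conjI allI impI)
  show "f \<otimes>\<^bsub>PA\<^esub> g \<in> carrier PA" using assms by (auto simp: arrow_ideal_power_def)
  fix u r assume "(f \<otimes>\<^bsub>PA\<^esub> g) (u, r) \<noteq> 0"
  then obtain i where i: "i \<le> length r" "f (awlast u (take i r), drop i r) \<noteq> 0" "g (u, take i r) \<noteq> 0"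
    by (rule path_mult_nonzero)
  then have "j \<le> length (drop i r)" "k \<le> length (take i r)"
    using assms unfolding arrow_ideal_power_def by blast+
  then show "j + k \<le> length r" using i(1) by simp
qed

lemma arrow_ideal_power_ideal: "ideal (arrow_ideal_power Q k) PA"
proof (rule idealI)
  have 0: "carrier PA = arrow_ideal_power Q 0" by (simp add: arrow_ideal_power_def)
  show "\<And>a x. a \<in> arrow_ideal_power Q k \<Longrightarrow> x \<in> carrier PA \<Longrightarrow> x \<otimes>\<^bsub>PA\<^esub> a \<in> arrow_ideal_power Q k"
    "\<And>a x. a \<in> arrow_ideal_power Q k \<Longrightarrow> x \<in> carrier PA \<Longrightarrow> a \<otimes>\<^bsub>PA\<^esub> x \<in> arrow_ideal_power Q k"
    using arrow_ideal_power_mult[of _ 0 _ k] arrow_ideal_power_mult[of _ k _ 0] unfolding 0 by auto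
  have "additive_subgroup (arrow_ideal_power Q k) PA"
  proof (rule PA.additive_subgroupI)
    fix f g :: "('v, 'e) path \<Rightarrow> 'k" assume fg: "f \<in> arrow_ideal_power Q k" "g \<in> arrow_ideal_power Q k"
    then have "f \<oplus>\<^bsub>PA\<^esub> g \<in> carrier PA" by (auto simp: arrow_ideal_power_def)
    then show "f \<oplus>\<^bsub>PA\<^esub> g \<in> arrow_ideal_power Q k"
      using fg unfolding arrow_ideal_power_def path_algebra_simps(3)
      by (clarify, metis add_0)
  next
    fix f :: "('v, 'e) path \<Rightarrow> 'k" assume f: "f \<in> arrow_ideal_power Q k"
    then have "f \<in> carrier PA" by (simp add: arrow_ideal_power_def)
    then have "\<ominus>\<^bsub>PA\<^esub> f \<in> carrier PA" "\<ominus>\<^bsub>PA\<^esub> f = (\<lambda>w. - f w)"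
      using PA.a_inv_closed a_inv_PA by metis+
    then show "\<ominus>\<^bsub>PA\<^esub> f \<in> arrow_ideal_power Q k"
      using f by (simp add: arrow_ideal_power_def)
  next
    have "\<zero>\<^bsub>PA\<^esub> \<in> carrier PA" by simp
    then show "\<zero>\<^bsub>PA\<^esub> \<in> arrow_ideal_power Q k"
      by (simp add: arrow_ideal_power_def path_algebra_simps(2))
  qed (auto simp: arrow_ideal_power_def)
  then show "subgroup (arrow_ideal_power Q k) (add_monoid PA)" by (simp add: additive_subgroup_def)
qed (rule PA.ring_axioms)

lemma cls_arrow_ideal: "ideal (cls ` arrow_ideal_power Q k) \<Lambda>"
  unfolding quiver_algebra_def cls_def
      by (rule PA.ring_ideal_imp_quot_ideal[OF I_ideal arrow_ideal_power_ideal])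

text \<open>The quotient by this ideal is one-dimensional. Concretely, let a larger left ideal
  contain some \<open>cls g\<close> with nonzero coefficient at \<open>v\<close>. A scaled trivial
  path times \<open>g\<close> matches the coefficient of any given \<open>f\<close> there, and the
  difference already lies in the smaller ideal.\<close>

lemma maximal_left_ideal_vertex:
  assumes v: "v \<in> verts Q"
  shows "maximal_left_ideal {cls f | f. f \<in> carrier PA \<and> f (v, []) = 0} \<Lambda>"
proof -
  define L where "L = {cls f | f. f \<in> carrier PA \<and> f (v, []) = 0}"
  have L_iff: "cls f \<in> L \<longleftrightarrow> f (v, []) = 0" if "f \<in> carrier PA" for f
  proof
    assume "cls f \<in> L"
    then obtain g where g: "g \<in> carrier PA" "g (v, []) = 0" "cls f = cls g" unfolding L_def by blast
    then show "f (v, []) = 0" using cls_eq_coeff[OF that g(1,3), of "[]" v] by simp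
  qed (use that in \<open>auto simp: L_def\<close>)
  have LE: "\<exists>f. f \<in> carrier PA \<and> f (v, []) = 0 \<and> C = cls f" if "C \<in> L" for C
    using that by (auto simp: L_def)
  have "additive_subgroup L \<Lambda>"
  proof (rule cls.S.additive_subgroupI)
    show "L \<subseteq> carrier \<Lambda>" by (auto simp: L_def)
    fix C assume "C \<in> L"
    then obtain f where f: "f \<in> carrier PA" "f (v, []) = 0" "C = cls f" using LE by blast
    then have "\<ominus>\<^bsub>\<Lambda>\<^esub> C = cls (\<ominus>\<^bsub>PA\<^esub> f)" by simp
    then show "\<ominus>\<^bsub>\<Lambda>\<^esub> C \<in> L" using f L_iff[of "\<ominus>\<^bsub>PA\<^esub> f"] by (simp add: a_inv_PA uminus_PA_closed)
  next
    fix C D assume "C \<in> L" "D \<in> L"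
    then obtain f g where f: "f \<in> carrier PA" "f (v, []) = 0" "C = cls f"
      and g: "g \<in> carrier PA" "g (v, []) = 0" "D = cls g" using LE by meson
    then have "C \<oplus>\<^bsub>\<Lambda>\<^esub> D = cls (f \<oplus>\<^bsub>PA\<^esub> g)" by simp
    then show "C \<oplus>\<^bsub>\<Lambda>\<^esub> D \<in> L"
      using f g L_iff[of "f \<oplus>\<^bsub>PA\<^esub> g"] PA.add.m_closed[of f g] by (simp add: path_algebra_simps(3))
  next
    show "\<zero>\<^bsub>\<Lambda>\<^esub> \<in> L"
    proof -
      have "cls \<zero>\<^bsub>PA\<^esub> \<in> L" using L_iff[OF PA.zero_closed] by (simp only: path_algebra_simps(2) simp_thms)
      then show ?thesis by simp
    qed
  qed
  moreover have mult: "C \<otimes>\<^bsub>\<Lambda>\<^esub> D \<in> L" if CD: "C \<in> carrier \<Lambda>" "D \<in> L" for C D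
  proof -
    obtain f g where f: "f \<in> carrier PA" "C = cls f" and g: "g \<in> carrier PA" "g (v, []) = 0" "D = cls g"
      using CD LE carrier_LambdaE by metis
    then have "C \<otimes>\<^bsub>\<Lambda>\<^esub> D = cls (f \<otimes>\<^bsub>PA\<^esub> g)" by simp
    then show ?thesis using f g L_iff[of "f \<otimes>\<^bsub>PA\<^esub> g"] by (simp add: path_mult_nil)
  qed
  ultimately have left: "left_ideal L \<Lambda>" by (simp add: left_ideal_def)
  have "cls \<one>\<^bsub>PA\<^esub> \<notin> L" using v by (subst L_iff) (auto simp: path_algebra_simps(4))
  then have neq: "L \<noteq> carrier \<Lambda>" by auto
  have "L' = L \<or> L' = carrier \<Lambda>" if L': "left_ideal L' \<Lambda>" "L \<subseteq> L'" for L'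
  proof (rule disjCI)
    assume ne: "L' \<noteq> carrier \<Lambda>"
    have sub: "L' \<subseteq> carrier \<Lambda>" and add: "\<And>C D. C \<in> L' \<Longrightarrow> D \<in> L' \<Longrightarrow> C \<oplus>\<^bsub>\<Lambda>\<^esub> D \<in> L'"
      and mul: "\<And>C D. C \<in> carrier \<Lambda> \<Longrightarrow> D \<in> L' \<Longrightarrow> C \<otimes>\<^bsub>\<Lambda>\<^esub> D \<in> L'"
      using L'(1) by (auto simp: left_ideal_def additive_subgroup.a_subset additive_subgroup.a_closed
          dest: additive_subgroup.a_Hcarr)
    have "L' \<subseteq> L"
    proof (rule ccontr)
      assume "\<not> L' \<subseteq> L"
      then obtain D where D: "D \<in> L'" "D \<notin> L" by blast
      then have "D \<in> carrier \<Lambda>" using sub by blast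
      then obtain g where "g \<in> carrier PA" "D = cls g" by (rule carrier_LambdaE)
      then have g: "g \<in> carrier PA" "cls g \<in> L'" "g (v, []) \<noteq> 0"
        using D L_iff[of g] by blast+
      have "carrier \<Lambda> \<subseteq> L'"
      proof
        fix C assume "C \<in> carrier \<Lambda>"
        then obtain f where f: "f \<in> carrier PA" "C = cls f" by (rule carrier_LambdaE)
        define e where "e = (vertex_elem (f (v, []) / g (v, [])) v :: ('v, 'e) path \<Rightarrow> 'k)"
        have e: "e \<in> carrier PA" using vertex_elem_carrier[OF v] by (simp add: e_def)
        have eg: "e \<otimes>\<^bsub>PA\<^esub> g \<in> carrier PA" "(e \<otimes>\<^bsub>PA\<^esub> g) (v, []) = f (v, [])"
          using e g by (auto simp: path_mult_nil) (simp add: e_def vertex_elem_def)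
        have "\<ominus>\<^bsub>PA\<^esub> (e \<otimes>\<^bsub>PA\<^esub> g) \<in> carrier PA" using eg by simp
        then have fe: "f \<oplus>\<^bsub>PA\<^esub> \<ominus>\<^bsub>PA\<^esub> (e \<otimes>\<^bsub>PA\<^esub> g) \<in> carrier PA" using f by simp
        have "cls (f \<oplus>\<^bsub>PA\<^esub> \<ominus>\<^bsub>PA\<^esub> (e \<otimes>\<^bsub>PA\<^esub> g)) \<in> L"
          using L_iff[OF fe] eg by (simp add: path_algebra_simps(3) a_inv_PA)
        then have "cls (f \<oplus>\<^bsub>PA\<^esub> \<ominus>\<^bsub>PA\<^esub> (e \<otimes>\<^bsub>PA\<^esub> g)) \<oplus>\<^bsub>\<Lambda>\<^esub> (cls e \<otimes>\<^bsub>\<Lambda>\<^esub> cls g) \<in> L'"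
          using L'(2) g e by (intro add mul) auto
        also have "cls (f \<oplus>\<^bsub>PA\<^esub> \<ominus>\<^bsub>PA\<^esub> (e \<otimes>\<^bsub>PA\<^esub> g)) \<oplus>\<^bsub>\<Lambda>\<^esub> (cls e \<otimes>\<^bsub>\<Lambda>\<^esub> cls g)
            = cls (f \<oplus>\<^bsub>PA\<^esub> \<ominus>\<^bsub>PA\<^esub> (e \<otimes>\<^bsub>PA\<^esub> g) \<oplus>\<^bsub>PA\<^esub> (e \<otimes>\<^bsub>PA\<^esub> g))"
          using e g fe by simp
        also have "f \<oplus>\<^bsub>PA\<^esub> \<ominus>\<^bsub>PA\<^esub> (e \<otimes>\<^bsub>PA\<^esub> g) \<oplus>\<^bsub>PA\<^esub> (e \<otimes>\<^bsub>PA\<^esub> g) = f"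
          using eg f by (simp add: PA.a_assoc PA.l_neg)
        finally show "C \<in> L'" using f by simp
      qed
      then show False using ne sub by blast
    qed
    then show "L' = L" using L'(2) by blast
  qed
  with left neq have "maximal_left_ideal L \<Lambda>" by (auto simp: maximal_left_ideal_def)
  then show ?thesis by (simp add: L_def)
qed

text \<open>If \<open>A\<^sup>k \<subseteq> L\<close> fails for a maximal left ideal \<open>L\<close>, then \<open>1 = l + c\<close> with \<open>l \<in> L\<close> and \<open>c \<in> A\<^sup>k\<close>, and
  \<open>c = c l + c\<^sup>2\<close> lies in \<open>L\<close> as soon as \<open>A\<^sup>k\<^sup>+\<^sup>1\<close> does; descending induction starts at a power of \<open>A\<close>
  contained in \<open>I\<close>.\<close>

lemma arrow_ideal_subset_maximal:
  assumes L: "maximal_left_ideal L \<Lambda>"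
  shows "cls ` arrow_ideal_power Q 1 \<subseteq> L"
proof -
  let ?A = "\<lambda>k. cls ` arrow_ideal_power Q k"
  have left: "left_ideal L \<Lambda>" and neq: "L \<noteq> carrier \<Lambda>"
    and max: "\<And>L'. left_ideal L' \<Lambda> \<Longrightarrow> L \<subseteq> L' \<Longrightarrow> L' = L \<or> L' = carrier \<Lambda>"
    using L by (auto simp: maximal_left_ideal_def)
  interpret L: additive_subgroup L \<Lambda> using left by (simp add: left_ideal_def)
  have mul: "\<And>C D. C \<in> carrier \<Lambda> \<Longrightarrow> D \<in> L \<Longrightarrow> C \<otimes>\<^bsub>\<Lambda>\<^esub> D \<in> L"
    using left by (auto simp: left_ideal_def)
  obtain m where m: "2 \<le> m" "arrow_ideal_power Q m \<subseteq> I"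
    using admissible by (auto simp: admissible_ideal_def)
  have "1 \<le> m" using m by simp
  then show ?thesis
  proof (induction rule: inc_induct)
    case base
    have "cls f = \<zero>\<^bsub>\<Lambda>\<^esub>" if "f \<in> arrow_ideal_power Q m" for f
      unfolding zero_Lambda cls_def using that m by (intro PA.a_rcos_const) auto
    then show ?case by auto
  next
    case (step k)
    interpret A: ideal "?A k" \<Lambda> by (rule cls_arrow_ideal)
    show ?case
    proof (rule ccontr)
      assume not: "\<not> ?A k \<subseteq> L"
      define L2 where "L2 = {l \<oplus>\<^bsub>\<Lambda>\<^esub> c | l c. l \<in> L \<and> c \<in> ?A k}"
      have "additive_subgroup L2 \<Lambda>"
      proof (rule cls.S.additive_subgroupI)
        show "L2 \<subseteq> carrier \<Lambda>" using A.a_Hcarr by (auto simp: L2_def)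
        have "\<zero>\<^bsub>\<Lambda>\<^esub> = \<zero>\<^bsub>\<Lambda>\<^esub> \<oplus>\<^bsub>\<Lambda>\<^esub> \<zero>\<^bsub>\<Lambda>\<^esub>" by simp
        then show "\<zero>\<^bsub>\<Lambda>\<^esub> \<in> L2" unfolding L2_def using L.zero_closed A.zero_closed by blast
        fix x assume "x \<in> L2"
        then obtain l c where x: "x = l \<oplus>\<^bsub>\<Lambda>\<^esub> c" "l \<in> L" "c \<in> ?A k" by (auto simp: L2_def)
        then have "\<ominus>\<^bsub>\<Lambda>\<^esub> x = \<ominus>\<^bsub>\<Lambda>\<^esub> l \<oplus>\<^bsub>\<Lambda>\<^esub> \<ominus>\<^bsub>\<Lambda>\<^esub> c"
          using cls.S.minus_add[of l c] by auto
        then show "\<ominus>\<^bsub>\<Lambda>\<^esub> x \<in> L2" using x L.a_inv_closed A.a_inv_closed unfolding L2_def by blast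
      next
        fix x y assume "x \<in> L2" "y \<in> L2"
        then obtain l c l' c' where x: "x = l \<oplus>\<^bsub>\<Lambda>\<^esub> c" "l \<in> L" "c \<in> ?A k"
          and y: "y = l' \<oplus>\<^bsub>\<Lambda>\<^esub> c'" "l' \<in> L" "c' \<in> ?A k" by (auto simp: L2_def)
        have cc: "l \<in> carrier \<Lambda>" "l' \<in> carrier \<Lambda>" "c \<in> carrier \<Lambda>" "c' \<in> carrier \<Lambda>"
          using x y A.a_Hcarr by auto
        have "x \<oplus>\<^bsub>\<Lambda>\<^esub> y = (l \<oplus>\<^bsub>\<Lambda>\<^esub> l') \<oplus>\<^bsub>\<Lambda>\<^esub> (c \<oplus>\<^bsub>\<Lambda>\<^esub> c')"
          unfolding x y using cc by (simp add: cls.S.a_ac)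
        then show "x \<oplus>\<^bsub>\<Lambda>\<^esub> y \<in> L2"
          using x y L.a_closed[of l l'] A.a_closed[of c c'] unfolding L2_def by auto
      qed
      moreover have "a \<otimes>\<^bsub>\<Lambda>\<^esub> x \<in> L2" if a: "a \<in> carrier \<Lambda>" and "x \<in> L2" for a x
      proof -
        obtain l c where x: "x = l \<oplus>\<^bsub>\<Lambda>\<^esub> c" "l \<in> L" "c \<in> ?A k" using \<open>x \<in> L2\<close> by (auto simp: L2_def)
        then have "a \<otimes>\<^bsub>\<Lambda>\<^esub> x = a \<otimes>\<^bsub>\<Lambda>\<^esub> l \<oplus>\<^bsub>\<Lambda>\<^esub> a \<otimes>\<^bsub>\<Lambda>\<^esub> c"
          using a cls.S.r_distr[of l c a] L.a_Hcarr[of l] A.a_Hcarr[of c] by simp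
        moreover have "a \<otimes>\<^bsub>\<Lambda>\<^esub> l \<in> L" "a \<otimes>\<^bsub>\<Lambda>\<^esub> c \<in> ?A k"
          using mul[OF a x(2)] A.I_l_closed[OF x(3) a] by auto
        ultimately show ?thesis unfolding L2_def by blast
      qed
      ultimately have "left_ideal L2 \<Lambda>" by (simp add: left_ideal_def)
      moreover have "L \<subseteq> L2"
      proof
        fix l assume "l \<in> L"
        moreover have "l = l \<oplus>\<^bsub>\<Lambda>\<^esub> \<zero>\<^bsub>\<Lambda>\<^esub>" using \<open>l \<in> L\<close> L.a_Hcarr by simp
        ultimately show "l \<in> L2" using A.zero_closed unfolding L2_def by blast
      qed
      ultimately have "L2 = L \<or> L2 = carrier \<Lambda>" using max by blast
      moreover have "?A k \<subseteq> L2"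
      proof
        fix c assume "c \<in> ?A k"
        moreover have "c = \<zero>\<^bsub>\<Lambda>\<^esub> \<oplus>\<^bsub>\<Lambda>\<^esub> c" using \<open>c \<in> ?A k\<close> A.a_Hcarr by simp
        ultimately show "c \<in> L2" using L.zero_closed unfolding L2_def by blast
      qed
      ultimately have "L2 = carrier \<Lambda>" using not by blast
      then have "\<one>\<^bsub>\<Lambda>\<^esub> \<in> L2" by simp
      then obtain l c where lc: "\<one>\<^bsub>\<Lambda>\<^esub> = l \<oplus>\<^bsub>\<Lambda>\<^esub> c" "l \<in> L" "c \<in> ?A k" by (auto simp: L2_def)
      have cc: "l \<in> carrier \<Lambda>" "c \<in> carrier \<Lambda>" using lc L.a_Hcarr A.a_Hcarr by auto
      obtain f where f: "c = cls f" "f \<in> arrow_ideal_power Q k" using lc by blast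
      then have fc: "f \<in> carrier PA" by (simp add: arrow_ideal_power_def)
      have "f \<otimes>\<^bsub>PA\<^esub> f \<in> arrow_ideal_power Q (k + k)" using f arrow_ideal_power_mult by blast
      \<comment> \<open>As \<open>k\<close> is at least 1, \<open>k + k\<close> is at least
        \<open>Suc k\<close>, so the induction hypothesis applies to the square of
        \<open>c\<close>.\<close>
      then have "f \<otimes>\<^bsub>PA\<^esub> f \<in> arrow_ideal_power Q (Suc k)"
        using step by (force simp: arrow_ideal_power_def)
      then have "c \<otimes>\<^bsub>\<Lambda>\<^esub> c \<in> L" using step.IH f fc by auto
      moreover have "c = c \<otimes>\<^bsub>\<Lambda>\<^esub> l \<oplus>\<^bsub>\<Lambda>\<^esub> c \<otimes>\<^bsub>\<Lambda>\<^esub> c"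
        using cc lc(1) cls.S.r_distr[of l c c] by (metis cls.S.r_one)
      ultimately have "c \<in> L" using mul[of c l] cc lc L.a_closed by metis
      then have "\<one>\<^bsub>\<Lambda>\<^esub> \<in> L" using lc L.a_closed by simp
      then have "carrier \<Lambda> \<subseteq> L" using mul[of _ "\<one>\<^bsub>\<Lambda>\<^esub>"] by (metis cls.S.r_one subsetI)
      then show False using neq L.a_subset by blast
    qed
  qed
qed

text \<open>One inclusion is \<open>arrow_ideal_subset_maximal\<close>. For the other, the maximal
  left ideals attached to the vertices suffice: membership in all of them removes every trivial
  path.\<close>

lemma jacobson_radical_eq: "jacobson_radical \<Lambda> = cls ` arrow_ideal_power Q 1"
proof
  show "cls ` arrow_ideal_power Q 1 \<subseteq> jacobson_radical \<Lambda>"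
    using arrow_ideal_subset_maximal additive_subgroup.a_subset[OF ideal.axioms(1)[OF cls_arrow_ideal[of 1]]]
    by (auto simp: jacobson_radical_def)
  show "jacobson_radical \<Lambda> \<subseteq> cls ` arrow_ideal_power Q 1"
  proof
    fix C assume C: "C \<in> jacobson_radical \<Lambda>"
    then have "C \<in> carrier \<Lambda>" by (simp add: jacobson_radical_def)
    then obtain f where f: "f \<in> carrier PA" "C = cls f" by (rule carrier_LambdaE)
    have "f (v, []) = 0" for v
    proof (cases "v \<in> verts Q")
      case True
      then have "C \<in> {cls f | f. f \<in> carrier PA \<and> f (v, []) = 0}"
        using C maximal_left_ideal_vertex[OF True] unfolding jacobson_radical_def by blast
      then obtain g where g: "g \<in> carrier PA" "g (v, []) = 0" "cls f = cls g" using f(2) by blast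
      then show ?thesis using cls_eq_coeff[OF f(1) g(1,3), of "[]" v] by simp
    next
      case False
      then show ?thesis using carrier_PA_nonzero[OF f(1), of v "[]"] path_nil by blast
    qed
    then have "f (u, r) \<noteq> 0 \<Longrightarrow> 1 \<le> length r" for u r by (cases r) auto
    then have "f \<in> arrow_ideal_power Q 1" using f by (simp add: arrow_ideal_power_def)
    then show "C \<in> cls ` arrow_ideal_power Q 1" using f by blast
  qed
qed

sublocale radical_square_zero_ring \<Lambda>
proof (intro radical_square_zero_ring.intro radical_square_zero_ring_axioms.intro cls.S.ring_axioms)
  show "ideal (jacobson_radical \<Lambda>) \<Lambda>" unfolding jacobson_radical_eq by (rule cls_arrow_ideal)
  fix a b assume "a \<in> jacobson_radical \<Lambda>" "b \<in> jacobson_radical \<Lambda>"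
  then have "a \<otimes>\<^bsub>\<Lambda>\<^esub> b \<in> ideal_prod \<Lambda> (jacobson_radical \<Lambda>) (jacobson_radical \<Lambda>)"
    by (rule ideal_prod.prod)
  then show "a \<otimes>\<^bsub>\<Lambda>\<^esub> b = \<zero>\<^bsub>\<Lambda>\<^esub>" using radical_square by simp
qed

lemma arrow_elem_radical: "\<alpha> \<in> arcs Q \<Longrightarrow> cls (arrow_elem Q \<alpha>) \<in> jacobson_radical \<Lambda>"
  unfolding jacobson_radical_eq using arrow_elem_carrier[of \<alpha>]
  by (auto simp: arrow_ideal_power_def arrow_elem_def)

text \<open>Here the hypothesis on the radical turns into relations: the path is a product of two
  arrows, whose classes lie in the radical and multiply to zero. Products are read like maps, so
  \<open>\<beta>\<close> stands on the left.\<close>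

lemma two_step_path_in_I:
  assumes \<alpha>: "\<alpha> \<in> arcs Q" and \<beta>: "\<beta> \<in> arcs Q" and comp: "head Q \<alpha> = tail Q \<beta>"
  shows "(\<lambda>w. if w = (tail Q \<alpha>, [\<alpha>, \<beta>]) then 1 else 0) \<in> I"
proof -
  let ?f = "arrow_elem Q \<beta> \<otimes>\<^bsub>PA\<^esub> arrow_elem Q \<alpha>"
  have c: "arrow_elem Q \<alpha> \<in> carrier PA" "arrow_elem Q \<beta> \<in> carrier PA"
    using \<alpha> \<beta> by (auto intro: arrow_elem_carrier)
  have "cls ?f = \<zero>\<^bsub>\<Lambda>\<^esub>"
    using radical_mult[OF arrow_elem_radical[OF \<beta>] arrow_elem_radical[OF \<alpha>]] c by simp
  then have "?f \<in> I" using PA.a_rcos_self[of ?f] c by (simp add: zero_Lambda cls_def)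
  also have "?f = (\<lambda>w. if w = (tail Q \<alpha>, [\<alpha>, \<beta>]) then 1 else 0)"
  proof
    fix w :: "('v, 'e) path"
    obtain u r where w: "w = (u, r)" by force
    show "?f w = (if w = (tail Q \<alpha>, [\<alpha>, \<beta>]) then 1 else 0)"
    proof (cases "w = (tail Q \<alpha>, [\<alpha>, \<beta>])")
      case True
      then show ?thesis using comp
        by (simp add: path_algebra_simps(5) arrow_elem_def atMost_Suc numeral_2_eq_2)
    next
      case False
      have "?f (u, r) = 0"
      proof (rule ccontr)
        assume "?f (u, r) \<noteq> 0"
        then obtain i where i: "i \<le> length r" "arrow_elem Q \<beta> (awlast u (take i r), drop i r) \<noteq> (0::'k)"
          "arrow_elem Q \<alpha> (u, take i r) \<noteq> (0::'k)" by (rule path_mult_nonzero)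
        then have "u = tail Q \<alpha>" "take i r = [\<alpha>]" "drop i r = [\<beta>]"
          by (auto simp: arrow_elem_def split: if_splits)
        moreover from this have "r = [\<alpha>] @ [\<beta>]" by (metis append_take_drop_id)
        ultimately show False using False w by simp
      qed
      then show ?thesis using False w by simp
    qed
  qed
  finally show ?thesis .
qed

end

section \<open>Representations\<close>

definition zero_composites :: "('v, 'e) pre_digraph \<Rightarrow> ('v \<Rightarrow> nat) \<Rightarrow> ('e \<Rightarrow> 'k::field mat) \<Rightarrow> bool" where
  "zero_composites Q d x \<longleftrightarrow> (\<forall>\<alpha>\<in>arcs Q. \<forall>\<beta>\<in>arcs Q. head Q \<alpha> = tail Q \<beta> \<longrightarrow>
     x \<beta> * x \<alpha> = 0\<^sub>m (d (head Q \<beta>)) (d (tail Q \<alpha>)))"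

text \<open>The action truncated after paths of length 1. It agrees with the full action when longer
  paths act as zero, and it involves only those coefficients that \<open>coset_coeff\<close> shows
  to be invariant.\<close>

definition first_order_action ::
  "('v, 'e) pre_digraph \<Rightarrow> ('v \<Rightarrow> nat) \<Rightarrow> ('e \<Rightarrow> 'k::field mat) \<Rightarrow>
   (('v, 'e) path \<Rightarrow> 'k) \<Rightarrow> ('v \<Rightarrow> 'k vec) \<Rightarrow> ('v \<Rightarrow> 'k vec)" where
  "first_order_action Q d x f m = (\<lambda>v\<in>verts Q. vec (d v) (\<lambda>i. f (v, []) * m v $ i +
     (\<Sum>\<alpha> | \<alpha> \<in> arcs Q \<and> head Q \<alpha> = v. f (tail Q \<alpha>, [\<alpha>]) * (x \<alpha> *\<^sub>v m (tail Q \<alpha>)) $ i)))"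

text \<open>The inclusion of the space at \<open>v\<close>; its image is the part of the module on
  which the trivial path at \<open>v\<close> acts as the identity.\<close>

definition vertex_embed :: "('v, 'e) pre_digraph \<Rightarrow> ('v \<Rightarrow> nat) \<Rightarrow> 'v \<Rightarrow> 'k::field vec \<Rightarrow> 'v \<Rightarrow> 'k vec" where
  "vertex_embed Q d v w = (\<lambda>u\<in>verts Q. if u = v then w else 0\<^sub>v (d u))"

section \<open>Relations and the evaluation of paths\<close>

context square_zero_quiver
begin

lemma rep_space_mat:
  "\<lbrakk>x \<in> rep_space Q d; \<alpha> \<in> arcs Q\<rbrakk> \<Longrightarrow> x \<alpha> \<in> carrier_mat (d (head Q \<alpha>)) (d (tail Q \<alpha>))"
  by (auto simp: rep_space_def)

lemma path_mat_carrier: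
  assumes "x \<in> rep_space Q d" "awalk u p v"
  shows "path_mat Q d x p u \<in> carrier_mat (d v) (d u)"
  using assms(2)
proof (induction p arbitrary: u)
  case Nil
  then show ?case by (simp add: awalk_Nil_iff)
next
  case (Cons \<alpha> p)
  then have "\<alpha> \<in> arcs Q" "u = tail Q \<alpha>" "awalk (head Q \<alpha>) p v" by (auto simp: awalk_Cons_iff)
  then show ?case using Cons.IH rep_space_mat[OF assms(1)] by (auto intro: mult_carrier_mat)
qed

lemma path_mat_zero:
  assumes x: "x \<in> rep_space Q d" "zero_composites Q d x" and p: "awalk u p v" "2 \<le> length p"
  shows "path_mat Q d x p u = 0\<^sub>m (d v) (d u)"
proof -
  obtain \<alpha> \<beta> q where p': "p = \<alpha> # \<beta> # q"
    using p(2) by (cases p; cases "tl p") auto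
  then have ab: "\<alpha> \<in> arcs Q" "\<beta> \<in> arcs Q" "u = tail Q \<alpha>" "head Q \<alpha> = tail Q \<beta>" "awalk (head Q \<beta>) q v"
    using p(1) by (auto simp: awalk_Cons_iff)
  note c = path_mat_carrier[OF x(1) ab(5)] rep_space_mat[OF x(1) ab(1)] rep_space_mat[OF x(1) ab(2)]
  have "path_mat Q d x p u = path_mat Q d x q (head Q \<beta>) * (x \<beta> * x \<alpha>)"
    unfolding p' using c ab(4) by (simp add: assoc_mult_mat[of _ "d v" "d (head Q \<beta>)" _ "d (tail Q \<beta>)" _
        "d (tail Q \<alpha>)"])
  also have "x \<beta> * x \<alpha> = 0\<^sub>m (d (head Q \<beta>)) (d (tail Q \<alpha>))"
    using x(2) ab by (simp add: zero_composites_def)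
  finally show ?thesis using c ab(3) by simp
qed

text \<open>Forwards, the relation consisting of a single path of length 2 is evaluated. Backwards,
  each path in the support of a relation begins with two arrows whose matrices multiply to
  zero.\<close>

lemma Rep_iff: "x \<in> Rep Q I d \<longleftrightarrow> x \<in> rep_space Q d \<and> zero_composites Q d x"
proof
  assume x: "x \<in> Rep Q I d"
  then have xs: "x \<in> rep_space Q d" by (simp add: Rep_def)
  have "x \<beta> * x \<alpha> = 0\<^sub>m (d (head Q \<beta>)) (d (tail Q \<alpha>))"
    if ab: "\<alpha> \<in> arcs Q" "\<beta> \<in> arcs Q" "head Q \<alpha> = tail Q \<beta>" for \<alpha> \<beta>
  proof -
    let ?u = "tail Q \<alpha>" and ?v = "head Q \<beta>"
    let ?f = "\<lambda>w. if w = (?u, [\<alpha>, \<beta>]) then 1 else (0::'k)"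
    have uv: "?u \<in> verts Q" "?v \<in> verts Q" using ab by auto
    have c: "x \<beta> * x \<alpha> \<in> carrier_mat (d ?v) (d ?u)" "x \<beta> \<in> carrier_mat (d ?v) (d (tail Q \<beta>))"
      using rep_space_mat[OF xs ab(1)] rep_space_mat[OF xs ab(2)] ab(3) by auto
    have "eval_block Q d x ?f ?u ?v = 0\<^sub>m (d ?v) (d ?u)"
      using x uv two_step_path_in_I[OF ab] unfolding Rep_def by blast
    moreover have "eval_block Q d x ?f ?u ?v = x \<beta> * x \<alpha>"
    proof (rule eq_matI)
      fix i j assume ij: "i < dim_row (x \<beta> * x \<alpha>)" "j < dim_col (x \<beta> * x \<alpha>)"
      have "{p. awalk ?u p ?v \<and> ?f (?u, p) \<noteq> 0} = {[\<alpha>, \<beta>]}"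
        using ab uv by (auto simp: awalk_simps)
      then show "eval_block Q d x ?f ?u ?v $$ (i, j) = (x \<beta> * x \<alpha>) $$ (i, j)"
        using ij c rep_space_mat[OF xs ab(1)] by (simp add: eval_block_def)
    qed (use c in \<open>auto simp: eval_block_def\<close>)
    ultimately show ?thesis by simp
  qed
  then show "x \<in> rep_space Q d \<and> zero_composites Q d x" using xs by (simp add: zero_composites_def)
next
  assume x: "x \<in> rep_space Q d \<and> zero_composites Q d x"
  have "eval_block Q d x f u v = 0\<^sub>m (d v) (d u)" if f: "f \<in> I" for f u v
  proof (rule eq_matI)
    fix i j assume ij: "i < dim_row (0\<^sub>m (d v) (d u))" "j < dim_col (0\<^sub>m (d v) (d u))"
    have "f (u, p) * path_mat Q d x p u $$ (i, j) = 0"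
      if "p \<in> {p. awalk u p v \<and> f (u, p) \<noteq> 0}" for p
      using path_mat_zero[of x d u p v] x I_length[OF f, of u p] that ij by simp
    then show "eval_block Q d x f u v $$ (i, j) = 0\<^sub>m (d v) (d u) $$ (i, j)"
      using ij by (simp add: eval_block_def)
  qed (auto simp: eval_block_def)
  then show "x \<in> Rep Q I d" using x by (simp add: Rep_def)
qed

lemma eval_block_entry:
  assumes x: "x \<in> rep_space Q d" "zero_composites Q d x" and f: "f \<in> carrier PA"
    and uv: "u \<in> verts Q" "i < d v" "j < d u"
  shows "eval_block Q d x f u v $$ (i, j) = (if u = v then f (v, []) * 1\<^sub>m (d v) $$ (i, j) else 0) +
    (\<Sum>\<alpha> | \<alpha> \<in> arcs Q \<and> tail Q \<alpha> = u \<and> head Q \<alpha> = v. f (u, [\<alpha>]) * x \<alpha> $$ (i, j))"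
proof -
  let ?t = "\<lambda>p. f (u, p) * path_mat Q d x p u $$ (i, j)"
  let ?S = "{p. awalk u p v \<and> f (u, p) \<noteq> 0}"
  let ?A = "{\<alpha> \<in> arcs Q. tail Q \<alpha> = u \<and> head Q \<alpha> = v}"
  \<comment> \<open>Walks are separated into trivial ones, single arrows and longer ones; a trivial
    walk exists only for equal ends, and the longer ones evaluate to zero.\<close>
  let ?P0 = "if u = v then {[]} else {}" and ?P1 = "(\<lambda>\<alpha>. [\<alpha>]) ` ?A"
  have "?S \<subseteq> snd ` {w. f w \<noteq> 0}" by force
  moreover have "finite {w. f w \<noteq> 0}" using f unfolding path_algebra_simps(1) by blast
  ultimately have finS: "finite ?S" by (rule finite_subset[OF _ finite_imageI])
  have finA: "finite ?A" using finite_arcs by simp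
  have walks: "awalk u p v" if "p \<in> ?P0 \<union> ?P1" for p
    using that uv(1) by (auto simp: awalk_simps split: if_splits)
  have long: "2 \<le> length p" if "awalk u p v" "p \<notin> ?P0 \<union> ?P1" for p
  proof (rule ccontr)
    assume "\<not> 2 \<le> length p"
    then consider "p = []" | \<alpha> where "p = [\<alpha>]" by (cases p; cases "tl p") auto
    then show False using that by cases (auto simp: awalk_simps)
  qed
  have "eval_block Q d x f u v $$ (i, j) = sum ?t ?S"
    using uv by (simp add: eval_block_def)
  also have "\<dots> = sum ?t (?P0 \<union> ?P1)"
  proof (rule sum.mono_neutral_cong)
    show "finite ?S" "finite (?P0 \<union> ?P1)" using finS finA by auto
    show "?t p = 0" if "p \<in> ?P0 \<union> ?P1 - ?S" for p using that walks[of p] by auto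
    show "?t p = 0" if "p \<in> ?S - (?P0 \<union> ?P1)" for p
      using that path_mat_zero[OF x, of u p v] long[of p] uv by auto
  qed simp
  also have "\<dots> = sum ?t ?P0 + sum ?t ?P1"
    using finA by (intro sum.union_disjoint) auto
  also have "sum ?t ?P1 = (\<Sum>\<alpha>\<in>?A. f (u, [\<alpha>]) * x \<alpha> $$ (i, j))"
  proof -
    have "sum ?t ?P1 = (\<Sum>\<alpha>\<in>?A. ?t [\<alpha>])" by (intro sum.reindex_cong[of "\<lambda>\<alpha>. [\<alpha>]"]) (auto simp: inj_on_def)
    also have "\<dots> = (\<Sum>\<alpha>\<in>?A. f (u, [\<alpha>]) * x \<alpha> $$ (i, j))"
    proof (intro sum.cong refl)
      fix \<alpha> assume "\<alpha> \<in> ?A"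
      then have "head Q \<alpha> = v" "x \<alpha> \<in> carrier_mat (d v) (d u)" using rep_space_mat[OF x(1), of \<alpha>] by auto
      then show "?t [\<alpha>] = f (u, [\<alpha>]) * x \<alpha> $$ (i, j)" using left_mult_one_mat[of "x \<alpha>" "d v" "d u"] by simp
    qed
    finally show ?thesis .
  qed
  also have "sum ?t ?P0 = (if u = v then f (v, []) * 1\<^sub>m (d v) $$ (i, j) else 0)" by simp
  finally show ?thesis .
qed

lemma path_algebra_action_eq:
  assumes x: "x \<in> rep_space Q d" "zero_composites Q d x" and f: "f \<in> carrier PA"
    and m: "\<And>v. v \<in> verts Q \<Longrightarrow> m v \<in> carrier_vec (d v)"
  shows "path_algebra_action Q d x f m = first_order_action Q d x f m"
proof
  fix v
  show "path_algebra_action Q d x f m v = first_order_action Q d x f m v"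
  proof (cases "v \<in> verts Q")
    case v: True
    have "(\<Sum>u\<in>verts Q. (eval_block Q d x f u v *\<^sub>v m u) $ i) = f (v, []) * m v $ i +
       (\<Sum>\<alpha> | \<alpha> \<in> arcs Q \<and> head Q \<alpha> = v. f (tail Q \<alpha>, [\<alpha>]) * (x \<alpha> *\<^sub>v m (tail Q \<alpha>)) $ i)"
      if i: "i < d v" for i
    proof -
      let ?A = "\<lambda>u. {\<alpha> \<in> arcs Q. tail Q \<alpha> = u \<and> head Q \<alpha> = v}"
      have "(eval_block Q d x f u v *\<^sub>v m u) $ i = (if u = v then f (v, []) * m v $ i else 0) +
          (\<Sum>\<alpha>\<in>?A u. f (tail Q \<alpha>, [\<alpha>]) * (x \<alpha> *\<^sub>v m (tail Q \<alpha>)) $ i)" if u: "u \<in> verts Q" for u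
      proof -
        have dm: "dim_vec (m u) = d u" using m[OF u] by simp
        have "(eval_block Q d x f u v *\<^sub>v m u) $ i = (\<Sum>j=0..<d u. eval_block Q d x f u v $$ (i, j) * m u $ j)"
          using i dm by (simp add: eval_block_def scalar_prod_def)
        also have "\<dots> = (\<Sum>j=0..<d u. (if u = v then f (v, []) * 1\<^sub>m (d v) $$ (i, j) else 0) * m u $ j +
            (\<Sum>\<alpha>\<in>?A u. f (u, [\<alpha>]) * x \<alpha> $$ (i, j) * m u $ j))"
          using eval_block_entry[OF x f u i] by (intro sum.cong) (auto simp: distrib_right sum_distrib_right)
        also have "\<dots> = (\<Sum>j=0..<d u. (if u = v then f (v, []) * 1\<^sub>m (d v) $$ (i, j) else 0) * m u $ j) +
            (\<Sum>\<alpha>\<in>?A u. \<Sum>j=0..<d u. f (u, [\<alpha>]) * x \<alpha> $$ (i, j) * m u $ j)"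
          by (simp only: sum.distrib sum.swap[of _ "?A u"])
        also have "(\<Sum>j=0..<d u. (if u = v then f (v, []) * 1\<^sub>m (d v) $$ (i, j) else 0) * m u $ j)
            = (if u = v then f (v, []) * m v $ i else 0)"
        proof (cases "u = v")
          case True
          have "(\<Sum>j=0..<d u. (if u = v then f (v, []) * 1\<^sub>m (d v) $$ (i, j) else 0) * m u $ j)
            = (\<Sum>j=0..<d v. if i = j then f (v, []) * m v $ j else 0)"
            using True i by (intro sum.cong) auto
          then show ?thesis using True i by simp
        qed simp
        also have "(\<Sum>\<alpha>\<in>?A u. \<Sum>j=0..<d u. f (u, [\<alpha>]) * x \<alpha> $$ (i, j) * m u $ j)
            = (\<Sum>\<alpha>\<in>?A u. f (tail Q \<alpha>, [\<alpha>]) * (x \<alpha> *\<^sub>v m (tail Q \<alpha>)) $ i)"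
        proof (intro sum.cong refl)
          fix \<alpha> assume a: "\<alpha> \<in> ?A u"
          then have xa: "x \<alpha> \<in> carrier_mat (d v) (d u)" using rep_space_mat[OF x(1), of \<alpha>] by auto
          then have "(x \<alpha> *\<^sub>v m u) $ i = (\<Sum>j=0..<d u. x \<alpha> $$ (i, j) * m u $ j)"
            using i dm by (simp add: scalar_prod_def)
          then show "(\<Sum>j=0..<d u. f (u, [\<alpha>]) * x \<alpha> $$ (i, j) * m u $ j)
              = f (tail Q \<alpha>, [\<alpha>]) * (x \<alpha> *\<^sub>v m (tail Q \<alpha>)) $ i"
            using a by (simp add: sum_distrib_left mult.assoc)
        qed
        finally show ?thesis .
      qed
      then have "(\<Sum>u\<in>verts Q. (eval_block Q d x f u v *\<^sub>v m u) $ i) =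
          (\<Sum>u\<in>verts Q. if u = v then f (v, []) * m v $ i else 0) +
          (\<Sum>u\<in>verts Q. \<Sum>\<alpha>\<in>?A u. f (tail Q \<alpha>, [\<alpha>]) * (x \<alpha> *\<^sub>v m (tail Q \<alpha>)) $ i)"
        by (simp add: sum.distrib)
      also have "(\<Sum>u\<in>verts Q. if u = v then f (v, []) * m v $ i else 0) = f (v, []) * m v $ i"
        using v finite_verts by simp
      also have "(\<Sum>u\<in>verts Q. \<Sum>\<alpha>\<in>?A u. f (tail Q \<alpha>, [\<alpha>]) * (x \<alpha> *\<^sub>v m (tail Q \<alpha>)) $ i)
          = (\<Sum>\<alpha> | \<alpha> \<in> arcs Q \<and> head Q \<alpha> = v. f (tail Q \<alpha>, [\<alpha>]) * (x \<alpha> *\<^sub>v m (tail Q \<alpha>)) $ i)"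
      proof -
        have "?A u = {\<alpha> \<in> {\<alpha> \<in> arcs Q. head Q \<alpha> = v}. tail Q \<alpha> = u}" for u by auto
        then show ?thesis using finite_verts finite_arcs
          by (simp only:) (intro sum.group; auto)
      qed
      finally show ?thesis .
    qed
    then show ?thesis using v by (auto simp: path_algebra_action_def first_order_action_def)
  qed (simp add: path_algebra_action_def first_order_action_def)
qed

section \<open>The module of a representation\<close>

lemma carrier_rep_module: "carrier (rep_module Q d x) = (\<Pi>\<^sub>E v\<in>verts Q. carrier_vec (d v))"
  and zero_rep_module: "\<zero>\<^bsub>rep_module Q d x\<^esub> = (\<lambda>v\<in>verts Q. 0\<^sub>v (d v))"
  and add_rep_module: "m \<oplus>\<^bsub>rep_module Q d x\<^esub> m' = (\<lambda>v\<in>verts Q. m v + m' v)"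
  by (simp_all add: rep_module_def)

lemma rep_module_component: "m \<in> carrier (rep_module Q d x) \<Longrightarrow> v \<in> verts Q \<Longrightarrow> m v \<in> carrier_vec (d v)"
  by (auto simp: carrier_rep_module)

text \<open>The action uses some representative of the coset. It can differ from \<open>f\<close>
  only on paths of length at least 2, which \<open>first_order_action\<close> does not see.\<close>

lemma smult_rep_module:
  assumes x: "x \<in> Rep Q I d" and f: "f \<in> carrier PA" and m: "m \<in> carrier (rep_module Q d x)"
  shows "cls f \<odot>\<^bsub>rep_module Q d x\<^esub> m = first_order_action Q d x f m"
proof -
  define g where "g = (SOME g. g \<in> cls f)"
  have "g \<in> cls f" unfolding g_def using PA.a_rcos_self[OF f] by (metis cls_def someI)
  then have g: "g \<in> carrier PA" "\<And>u r. length r < 2 \<Longrightarrow> g (u, r) = f (u, r)"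
    using PA.a_elemrcos_carrier[OF f] coset_coeff[OF f] by (auto simp: cls_def)
  have "cls f \<odot>\<^bsub>rep_module Q d x\<^esub> m = path_algebra_action Q d x g m"
    by (simp add: rep_module_def g_def)
  also have "\<dots> = first_order_action Q d x g m"
    using x g m by (intro path_algebra_action_eq) (auto simp: Rep_iff carrier_rep_module)
  also have "\<dots> = first_order_action Q d x f m"
    using g by (simp add: first_order_action_def)
  finally show ?thesis .
qed

lemma rep_module_eqI:
  assumes "m \<in> carrier (rep_module Q d x)" "m' \<in> carrier (rep_module Q d x)"
    and "\<And>v i. \<lbrakk>v \<in> verts Q; i < d v\<rbrakk> \<Longrightarrow> m v $ i = m' v $ i"
  shows "m = m'"
proof (rule PiE_ext)
  show "m \<in> (\<Pi>\<^sub>E v\<in>verts Q. carrier_vec (d v))" "m' \<in> (\<Pi>\<^sub>E v\<in>verts Q. carrier_vec (d v))"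
    using assms(1,2) by (simp_all add: carrier_rep_module)
  fix v assume v: "v \<in> verts Q"
  show "m v = m' v"
    using assms(3)[OF v] rep_module_component[OF assms(1) v] rep_module_component[OF assms(2) v]
    by (intro eq_vecI) auto
qed

lemma first_order_action_carrier: "first_order_action Q d x f m \<in> carrier (rep_module Q d x)"
  by (auto simp: first_order_action_def carrier_rep_module)

lemma first_order_action_entry:
  "\<lbrakk>v \<in> verts Q; i < d v\<rbrakk> \<Longrightarrow> first_order_action Q d x f m v $ i = f (v, []) * m v $ i +
     (\<Sum>\<alpha> | \<alpha> \<in> arcs Q \<and> head Q \<alpha> = v. f (tail Q \<alpha>, [\<alpha>]) * (x \<alpha> *\<^sub>v m (tail Q \<alpha>)) $ i)"
  by (simp add: first_order_action_def)

lemma add_rep_module_entry: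
  assumes "m \<in> carrier (rep_module Q d x)" "m' \<in> carrier (rep_module Q d x)" "v \<in> verts Q" "i < d v"
  shows "(m \<oplus>\<^bsub>rep_module Q d x\<^esub> m') v $ i = m v $ i + m' v $ i"
  using assms rep_module_component[OF assms(2,3)] by (simp add: add_rep_module)

lemma arrow_mult_vec:
  assumes "x \<in> rep_space Q d" "\<alpha> \<in> arcs Q" "w \<in> carrier_vec (d (tail Q \<alpha>))"
  shows "x \<alpha> *\<^sub>v w \<in> carrier_vec (d (head Q \<alpha>))"
  using rep_space_mat[OF assms(1,2)] assms(3) by (rule mult_mat_vec_carrier)

text \<open>The contributions that reach the tail of \<open>\<alpha>\<close> through another arrow
  die under \<open>x \<alpha>\<close>, because composites vanish; only the scalar of the trivial
  path survives. This is the core of associativity in \<open>left_module_rep\<close>.\<close>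

lemma arrow_first_order_action:
  assumes x: "x \<in> Rep Q I d" and m: "m \<in> carrier (rep_module Q d x)" and \<alpha>: "\<alpha> \<in> arcs Q"
  shows "x \<alpha> *\<^sub>v first_order_action Q d x g m (tail Q \<alpha>) = g (tail Q \<alpha>, []) \<cdot>\<^sub>v (x \<alpha> *\<^sub>v m (tail Q \<alpha>))"
proof (rule eq_vecI)
  let ?u = "tail Q \<alpha>" and ?B = "{\<beta>. \<beta> \<in> arcs Q \<and> head Q \<beta> = tail Q \<alpha>}"
  have xs: "x \<in> rep_space Q d" "zero_composites Q d x" using x by (auto simp: Rep_iff)
  note A = rep_space_mat[OF xs(1) \<alpha>]
  have u: "?u \<in> verts Q" using \<alpha> by simp
  note mu = rep_module_component[OF m u]
  have "dim_row (x \<alpha>) = d (head Q \<alpha>)" using A by auto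
  then show
      "dim_vec (x \<alpha> *\<^sub>v first_order_action Q d x g m ?u) = dim_vec (g (?u, []) \<cdot>\<^sub>v (x \<alpha> *\<^sub>v m ?u))" by simp
  fix i assume "i < dim_vec (g (?u, []) \<cdot>\<^sub>v (x \<alpha> *\<^sub>v m ?u))"
  then have i: "i < d (head Q \<alpha>)" using A by simp
  have ent: "(x \<alpha> *\<^sub>v w) $ i = (\<Sum>j=0..<d ?u. x \<alpha> $$ (i, j) * w $ j)" if "w \<in> carrier_vec (d ?u)" for w
    using that i A by (simp add: scalar_prod_def)
  have fc: "first_order_action Q d x g m ?u \<in> carrier_vec (d ?u)"
    using rep_module_component[OF first_order_action_carrier u] .
  have zero: "(x \<alpha> *\<^sub>v (x \<beta> *\<^sub>v m (tail Q \<beta>))) $ i = 0" if b: "\<beta> \<in> ?B" for \<beta>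
  proof -
    have B: "x \<beta> \<in> carrier_mat (d ?u) (d (tail Q \<beta>))" using rep_space_mat[OF xs(1), of \<beta>] b by simp
    have mb: "m (tail Q \<beta>) \<in> carrier_vec (d (tail Q \<beta>))" using b by (intro rep_module_component[OF m]) auto
    have "x \<alpha> *\<^sub>v (x \<beta> *\<^sub>v m (tail Q \<beta>)) = (x \<alpha> * x \<beta>) *\<^sub>v m (tail Q \<beta>)"
      using A B mb by (rule assoc_mult_mat_vec[symmetric])
    also have "x \<alpha> * x \<beta> = 0\<^sub>m (d (head Q \<alpha>)) (d (tail Q \<beta>))"
      using xs(2) \<alpha> b by (simp add: zero_composites_def)
    finally show ?thesis using i mb by simp
  qed
  have "(x \<alpha> *\<^sub>v first_order_action Q d x g m ?u) $ i =
      (\<Sum>j=0..<d ?u. x \<alpha> $$ (i, j) * (g (?u, []) * m ?u $ j +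
         (\<Sum>\<beta>\<in>?B. g (tail Q \<beta>, [\<beta>]) * (x \<beta> *\<^sub>v m (tail Q \<beta>)) $ j)))"
    unfolding ent[OF fc] using u by (intro sum.cong refl) (simp add: first_order_action_entry)
  also have "\<dots> = (\<Sum>j=0..<d ?u. g (?u, []) * (x \<alpha> $$ (i, j) * m ?u $ j)) +
      (\<Sum>j=0..<d ?u. \<Sum>\<beta>\<in>?B. g (tail Q \<beta>, [\<beta>]) * (x \<alpha> $$ (i, j) * (x \<beta> *\<^sub>v m (tail Q \<beta>)) $ j))"
    by (simp add: distrib_left sum.distrib sum_distrib_left mult.left_commute)
  also have "(\<Sum>j=0..<d ?u. \<Sum>\<beta>\<in>?B. g (tail Q \<beta>, [\<beta>]) * (x \<alpha> $$ (i, j) * (x \<beta> *\<^sub>v m (tail Q \<beta>)) $ j))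
      = (\<Sum>\<beta>\<in>?B. g (tail Q \<beta>, [\<beta>]) * (\<Sum>j=0..<d ?u. x \<alpha> $$ (i, j) * (x \<beta> *\<^sub>v m (tail Q \<beta>)) $ j))"
    by (subst sum.swap) (simp add: sum_distrib_left)
  also have "\<dots> = (\<Sum>\<beta>\<in>?B. g (tail Q \<beta>, [\<beta>]) * (x \<alpha> *\<^sub>v (x \<beta> *\<^sub>v m (tail Q \<beta>))) $ i)"
  proof (intro sum.cong refl)
    fix \<beta> assume b: "\<beta> \<in> ?B"
    then have "x \<beta> *\<^sub>v m (tail Q \<beta>) \<in> carrier_vec (d ?u)"
      using arrow_mult_vec[OF xs(1), of \<beta> "m (tail Q \<beta>)"] rep_module_component[OF m, of "tail Q \<beta>"] by auto
    then show "g (tail Q \<beta>, [\<beta>]) * (\<Sum>j=0..<d ?u. x \<alpha> $$ (i, j) * (x \<beta> *\<^sub>v m (tail Q \<beta>)) $ j) =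
        g (tail Q \<beta>, [\<beta>]) * (x \<alpha> *\<^sub>v (x \<beta> *\<^sub>v m (tail Q \<beta>))) $ i" using ent by simp
  qed
  also have "\<dots> = 0" using zero by (intro sum.neutral) simp
  also have "(\<Sum>j=0..<d ?u. g (?u, []) * (x \<alpha> $$ (i, j) * m ?u $ j)) = g (?u, []) * (x \<alpha> *\<^sub>v m ?u) $ i"
    using ent[OF mu] by (simp add: sum_distrib_left)
  finally show "(x \<alpha> *\<^sub>v first_order_action Q d x g m ?u) $ i = (g (?u, []) \<cdot>\<^sub>v (x \<alpha> *\<^sub>v m ?u)) $ i"
    using i A by (simp del: index_mult_mat_vec)
qed

text \<open>In the law for products, the coefficient at a trivial path has one term and the
  coefficient at an arrow has two. The term in which the arrow belongs to the outer factor is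
  settled by \<open>arrow_first_order_action\<close>.\<close>

lemma left_module_rep:
  assumes x: "x \<in> Rep Q I d"
  shows "left_module \<Lambda> (rep_module Q d x)"
proof (intro left_module.intro left_module_axioms.intro cls.S.ring_axioms)
  let ?N = "rep_module Q d x"
  note eqI = rep_module_eqI[of _ d x]
  have xs: "x \<in> rep_space Q d" using x by (simp add: Rep_iff)
  have addc: "m \<oplus>\<^bsub>?N\<^esub> m' \<in> carrier ?N" if "m \<in> carrier ?N" "m' \<in> carrier ?N" for m m'
    
    unfolding carrier_rep_module add_rep_module restrict_PiE_iff
    using rep_module_component[OF that(1)] rep_module_component[OF that(2)] by simp
  have zc: "\<zero>\<^bsub>?N\<^esub> \<in> carrier ?N" by (auto simp: carrier_rep_module zero_rep_module)
  show "abelian_group ?N"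
  proof (rule abelian_groupI)
    fix m m' m'' assume m: "m \<in> carrier ?N" "m' \<in> carrier ?N" "m'' \<in> carrier ?N"
    show "m \<oplus>\<^bsub>?N\<^esub> m' \<oplus>\<^bsub>?N\<^esub> m'' = m \<oplus>\<^bsub>?N\<^esub> (m' \<oplus>\<^bsub>?N\<^esub> m'')"
      using m by (intro eqI) (auto simp: addc add_rep_module_entry add.assoc)
  next
    fix m m' assume m: "m \<in> carrier ?N" "m' \<in> carrier ?N"
    show "m \<oplus>\<^bsub>?N\<^esub> m' = m' \<oplus>\<^bsub>?N\<^esub> m"
      using m by (intro eqI) (auto simp: addc add_rep_module_entry add.commute)
  next
    fix m assume m: "m \<in> carrier ?N"
    show "\<zero>\<^bsub>?N\<^esub> \<oplus>\<^bsub>?N\<^esub> m = m"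
      using m zc by (intro eqI) (auto simp: addc add_rep_module_entry zero_rep_module)
    let ?n = "\<lambda>v\<in>verts Q. - m v"
    have "?n \<in> carrier ?N" using rep_module_component[OF m] by (auto simp: carrier_rep_module)
    moreover from this have "?n \<oplus>\<^bsub>?N\<^esub> m = \<zero>\<^bsub>?N\<^esub>"
      using m zc carrier_vecD[OF rep_module_component[OF m]]
          by (intro eqI) (auto simp: addc add_rep_module_entry zero_rep_module)
    ultimately show "\<exists>n\<in>carrier ?N. n \<oplus>\<^bsub>?N\<^esub> m = \<zero>\<^bsub>?N\<^esub>" by blast
  qed (auto intro: addc zc)
  note sm = smult_rep_module[OF x]
  have smc: "a \<odot>\<^bsub>?N\<^esub> m \<in> carrier ?N" if "a \<in> carrier \<Lambda>" "m \<in> carrier ?N" for a m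
    using that carrier_LambdaE[OF that(1)] sm first_order_action_carrier by metis
  show "a \<odot>\<^bsub>?N\<^esub> m \<in> carrier ?N" if "a \<in> carrier \<Lambda>" "m \<in> carrier ?N" for a m
    using smc that .
  show "(a \<oplus>\<^bsub>\<Lambda>\<^esub> b) \<odot>\<^bsub>?N\<^esub> m = a \<odot>\<^bsub>?N\<^esub> m \<oplus>\<^bsub>?N\<^esub> b \<odot>\<^bsub>?N\<^esub> m"
    if ab: "a \<in> carrier \<Lambda>" "b \<in> carrier \<Lambda>" and m: "m \<in> carrier ?N" for a b m
  proof -
    obtain f where f: "f \<in> carrier PA" "a = cls f" using ab(1) by (rule carrier_LambdaE)
    obtain g where g: "g \<in> carrier PA" "b = cls g" using ab(2) by (rule carrier_LambdaE)
    have fg: "f \<oplus>\<^bsub>PA\<^esub> g \<in> carrier PA" using f g by simp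
    have "(a \<oplus>\<^bsub>\<Lambda>\<^esub> b) \<odot>\<^bsub>?N\<^esub> m = first_order_action Q d x (f \<oplus>\<^bsub>PA\<^esub> g) m"
      using sm[OF fg m] f g by simp
    also have "\<dots> = first_order_action Q d x f m \<oplus>\<^bsub>?N\<^esub> first_order_action Q d x g m"
      by (intro eqI first_order_action_carrier addc)
        (simp add: add_rep_module_entry first_order_action_carrier first_order_action_entry
          path_algebra_simps(3) distrib_right sum.distrib)
    finally show ?thesis using sm f g m by simp
  qed
  show "a \<odot>\<^bsub>?N\<^esub> (m \<oplus>\<^bsub>?N\<^esub> m') = a \<odot>\<^bsub>?N\<^esub> m \<oplus>\<^bsub>?N\<^esub> a \<odot>\<^bsub>?N\<^esub> m'"
    if a: "a \<in> carrier \<Lambda>" and m: "m \<in> carrier ?N" "m' \<in> carrier ?N" for a m m'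
  proof -
    obtain f where f: "f \<in> carrier PA" "a = cls f" using a by (rule carrier_LambdaE)
    have mm: "(x \<alpha> *\<^sub>v (m \<oplus>\<^bsub>?N\<^esub> m') (tail Q \<alpha>)) $ i =
        (x \<alpha> *\<^sub>v m (tail Q \<alpha>)) $ i + (x \<alpha> *\<^sub>v m' (tail Q \<alpha>)) $ i"
      if "\<alpha> \<in> arcs Q" "i < d (head Q \<alpha>)" for \<alpha> i
    proof -
      have t: "tail Q \<alpha> \<in> verts Q" using that by simp
      note c = rep_space_mat[OF xs that(1)] rep_module_component[OF m(1) t] rep_module_component[OF m(2) t]
      have "x \<alpha> *\<^sub>v (m \<oplus>\<^bsub>?N\<^esub> m') (tail Q \<alpha>) = x \<alpha> *\<^sub>v m (tail Q \<alpha>) + x \<alpha> *\<^sub>v m' (tail Q \<alpha>)"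
        using t mult_add_distrib_mat_vec[OF c] by (simp add: add_rep_module)
      then show ?thesis using that(2) c by (simp del: index_mult_mat_vec)
    qed
    have "first_order_action Q d x f (m \<oplus>\<^bsub>?N\<^esub> m') =
        first_order_action Q d x f m \<oplus>\<^bsub>?N\<^esub> first_order_action Q d x f m'"
    proof (intro eqI first_order_action_carrier addc)
      fix v i assume v: "v \<in> verts Q" "i < d v"
      have "(\<Sum>\<alpha> | \<alpha> \<in> arcs Q \<and> head Q \<alpha> = v. f (tail Q \<alpha>, [\<alpha>]) * (x \<alpha> *\<^sub>v (m \<oplus>\<^bsub>?N\<^esub> m') (tail Q \<alpha>)) $ i) =
        (\<Sum>\<alpha> | \<alpha> \<in> arcs Q \<and> head Q \<alpha> = v. f (tail Q \<alpha>, [\<alpha>]) * ((x \<alpha> *\<^sub>v m (tail Q \<alpha>)) $ i + (x \<alpha> *\<^sub>v m' (tail Q \<alpha>)) $ i))"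
        using mm v(2) by (intro sum.cong refl) auto
      then show "first_order_action Q d x f (m \<oplus>\<^bsub>?N\<^esub> m') v $ i =
          (first_order_action Q d x f m \<oplus>\<^bsub>?N\<^esub> first_order_action Q d x f m') v $ i"
        using v m by (simp add: add_rep_module_entry first_order_action_carrier first_order_action_entry
            distrib_left sum.distrib del: index_mult_mat_vec)
    qed
    then show ?thesis using sm f m addc by simp
  qed
  show "(a \<otimes>\<^bsub>\<Lambda>\<^esub> b) \<odot>\<^bsub>?N\<^esub> m = a \<odot>\<^bsub>?N\<^esub> (b \<odot>\<^bsub>?N\<^esub> m)"
    if ab: "a \<in> carrier \<Lambda>" "b \<in> carrier \<Lambda>" and m: "m \<in> carrier ?N" for a b m
  proof -
    obtain f where f: "f \<in> carrier PA" "a = cls f" using ab(1) by (rule carrier_LambdaE)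
    obtain g where g: "g \<in> carrier PA" "b = cls g" using ab(2) by (rule carrier_LambdaE)
    have fg: "f \<otimes>\<^bsub>PA\<^esub> g \<in> carrier PA" using f g by simp
    have "first_order_action Q d x (f \<otimes>\<^bsub>PA\<^esub> g) m = first_order_action Q d x f (first_order_action Q d x g m)"
    proof (intro eqI first_order_action_carrier)
      fix v i assume v: "v \<in> verts Q" "i < d v"
      have "(\<Sum>\<alpha> | \<alpha> \<in> arcs Q \<and> head Q \<alpha> = v.
            f (tail Q \<alpha>, [\<alpha>]) * (x \<alpha> *\<^sub>v first_order_action Q d x g m (tail Q \<alpha>)) $ i) =
          (\<Sum>\<alpha> | \<alpha> \<in> arcs Q \<and> head Q \<alpha> = v.
            f (tail Q \<alpha>, [\<alpha>]) * (g (tail Q \<alpha>, []) * (x \<alpha> *\<^sub>v m (tail Q \<alpha>)) $ i))"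
      proof (intro sum.cong refl)
        fix \<alpha> assume "\<alpha> \<in> {\<alpha>. \<alpha> \<in> arcs Q \<and> head Q \<alpha> = v}"
        then have a: "\<alpha> \<in> arcs Q" "i < dim_row (x \<alpha>)" using v rep_space_mat[OF xs, of \<alpha>] by auto
        then show "f (tail Q \<alpha>, [\<alpha>]) * (x \<alpha> *\<^sub>v first_order_action Q d x g m (tail Q \<alpha>)) $ i =
            f (tail Q \<alpha>, [\<alpha>]) * (g (tail Q \<alpha>, []) * (x \<alpha> *\<^sub>v m (tail Q \<alpha>)) $ i)"
          by (simp add: arrow_first_order_action[OF x m a(1)] del: index_mult_mat_vec)
      qed
      moreover have "(\<Sum>\<alpha> | \<alpha> \<in> arcs Q \<and> head Q \<alpha> = v.
            (f \<otimes>\<^bsub>PA\<^esub> g) (tail Q \<alpha>, [\<alpha>]) * (x \<alpha> *\<^sub>v m (tail Q \<alpha>)) $ i) =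
          (\<Sum>\<alpha> | \<alpha> \<in> arcs Q \<and> head Q \<alpha> = v.
            (f (tail Q \<alpha>, [\<alpha>]) * g (tail Q \<alpha>, []) + f (v, []) * g (tail Q \<alpha>, [\<alpha>])) * (x \<alpha> *\<^sub>v m (tail Q \<alpha>)) $ i)"
        by (intro sum.cong refl) (auto simp: path_mult_arrow)
      ultimately show "first_order_action Q d x (f \<otimes>\<^bsub>PA\<^esub> g) m v $ i =
          first_order_action Q d x f (first_order_action Q d x g m) v $ i"
        using v by (simp add: first_order_action_entry path_mult_nil distrib_left distrib_right
            sum.distrib sum_distrib_left mult.assoc del: index_mult_mat_vec)
    qed
    then show ?thesis using sm[OF fg m] sm[OF g(1) m] sm[OF f(1) first_order_action_carrier] f g by simp
  qed
  show "\<one>\<^bsub>\<Lambda>\<^esub> \<odot>\<^bsub>?N\<^esub> m = m" if m: "m \<in> carrier ?N" for m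
  proof -
    have "\<one>\<^bsub>\<Lambda>\<^esub> \<odot>\<^bsub>?N\<^esub> m = first_order_action Q d x \<one>\<^bsub>PA\<^esub> m" using sm[of "\<one>\<^bsub>PA\<^esub>"] m by simp
    also have "\<dots> = m"
      using m by (intro eqI first_order_action_carrier)
        (simp_all add: first_order_action_entry path_algebra_simps(4) del: index_mult_mat_vec)
    finally show ?thesis .
  qed
qed

section \<open>Vertex components and submodules\<close>

lemma vertex_embed_carrier:
  assumes "w \<in> carrier_vec (d v)"
  shows "vertex_embed Q d v w \<in> carrier (rep_module Q d x)"
  using assms by (auto simp: vertex_embed_def carrier_rep_module)

lemma vertex_embed_same [simp]: "v \<in> verts Q \<Longrightarrow> vertex_embed Q d v w v = w"
  by (simp add: vertex_embed_def)

lemma vertex_embed_entry: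
  "\<lbrakk>u \<in> verts Q; i < d u\<rbrakk> \<Longrightarrow> vertex_embed Q d v w u $ i = (if u = v then w $ i else 0)"
  by (simp add: vertex_embed_def)

lemma vertex_embed_zero: "vertex_embed Q d v (0\<^sub>v (d v)) = \<zero>\<^bsub>rep_module Q d x\<^esub>"
  by (auto simp: vertex_embed_def zero_rep_module)

lemma vertex_embed_eq_zero_iff:
  "v \<in> verts Q \<Longrightarrow> vertex_embed Q d v w = \<zero>\<^bsub>rep_module Q d x\<^esub> \<longleftrightarrow> w = 0\<^sub>v (d v)"
  using vertex_embed_zero[of d v x] by (auto simp: zero_rep_module dest: fun_cong[of _ _ v])

lemma vertex_embed_add:
  assumes "w \<in> carrier_vec (d v)" "w' \<in> carrier_vec (d v)"
  shows "vertex_embed Q d v (w + w') = vertex_embed Q d v w \<oplus>\<^bsub>rep_module Q d x\<^esub> vertex_embed Q d v w'"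
  using assms by (auto simp: vertex_embed_def add_rep_module)

lemma vertex_smult:
  assumes x: "x \<in> Rep Q I d" and m: "m \<in> carrier (rep_module Q d x)" and v: "v \<in> verts Q"
  shows "cls (vertex_elem k v) \<odot>\<^bsub>rep_module Q d x\<^esub> m = vertex_embed Q d v (k \<cdot>\<^sub>v m v)"
proof -
  note mv = rep_module_component[OF m v]
  have "cls (vertex_elem k v) \<odot>\<^bsub>rep_module Q d x\<^esub> m = first_order_action Q d x (vertex_elem k v) m"
    by (rule smult_rep_module[OF x vertex_elem_carrier[OF v] m])
  also have "\<dots> = vertex_embed Q d v (k \<cdot>\<^sub>v m v)"
    using mv by (intro rep_module_eqI[OF first_order_action_carrier] vertex_embed_carrier)
      (auto simp: first_order_action_entry vertex_elem_def vertex_embed_entry simp del: index_mult_mat_vec)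
  finally show ?thesis .
qed

lemma vertex_embed_smult:
  assumes x: "x \<in> Rep Q I d" and w: "w \<in> carrier_vec (d v)" and v: "v \<in> verts Q"
  shows "vertex_embed Q d v (k \<cdot>\<^sub>v w) = cls (vertex_elem k v) \<odot>\<^bsub>rep_module Q d x\<^esub> vertex_embed Q d v w"
  using vertex_smult[OF x vertex_embed_carrier[of w d v x, OF w] v] v by simp

lemma arrow_smult:
  assumes x: "x \<in> Rep Q I d" and m: "m \<in> carrier (rep_module Q d x)" and \<alpha>: "\<alpha> \<in> arcs Q"
  shows "cls (arrow_elem Q \<alpha>) \<odot>\<^bsub>rep_module Q d x\<^esub> m = vertex_embed Q d (head Q \<alpha>) (x \<alpha> *\<^sub>v m (tail Q \<alpha>))"
proof -
  have xs: "x \<in> rep_space Q d" using x by (simp add: Rep_iff)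
  have c: "x \<alpha> *\<^sub>v m (tail Q \<alpha>) \<in> carrier_vec (d (head Q \<alpha>))"
    using \<alpha> by (intro arrow_mult_vec[OF xs] rep_module_component[OF m]) auto
  have "cls (arrow_elem Q \<alpha>) \<odot>\<^bsub>rep_module Q d x\<^esub> m = first_order_action Q d x (arrow_elem Q \<alpha>) m"
    by (rule smult_rep_module[OF x arrow_elem_carrier[OF \<alpha>] m])
  also have "\<dots> = vertex_embed Q d (head Q \<alpha>) (x \<alpha> *\<^sub>v m (tail Q \<alpha>))"
  proof (intro rep_module_eqI[OF first_order_action_carrier] vertex_embed_carrier c)
    fix v i assume v: "v \<in> verts Q" "i < d v"
    have "(\<Sum>\<beta> | \<beta> \<in> arcs Q \<and> head Q \<beta> = v. arrow_elem Q \<alpha> (tail Q \<beta>, [\<beta>]) * (x \<beta> *\<^sub>v m (tail Q \<beta>)) $ i)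
      = (\<Sum>\<beta> | \<beta> \<in> arcs Q \<and> head Q \<beta> = v. if \<beta> = \<alpha> then (x \<alpha> *\<^sub>v m (tail Q \<alpha>)) $ i else 0)"
      by (intro sum.cong refl) (auto simp: arrow_elem_def)
    also have "\<dots> = (if v = head Q \<alpha> then (x \<alpha> *\<^sub>v m (tail Q \<alpha>)) $ i else 0)"
      using \<alpha> finite_arcs by (subst sum.delta) auto
    finally show "first_order_action Q d x (arrow_elem Q \<alpha>) m v $ i =
        vertex_embed Q d (head Q \<alpha>) (x \<alpha> *\<^sub>v m (tail Q \<alpha>)) v $ i"
      using v by (simp add: first_order_action_entry vertex_embed_entry arrow_elem_def del: index_mult_mat_vec)
  qed
  finally show ?thesis .
qed

lemma family_submodule:
  assumes x: "x \<in> Rep Q I d" and W: "\<And>v. v \<in> verts Q \<Longrightarrow> vec_subspace (d v) (W v)"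
    and arrow: "\<And>\<alpha> w. \<lbrakk>\<alpha> \<in> arcs Q; w \<in> W (tail Q \<alpha>)\<rbrakk> \<Longrightarrow> x \<alpha> *\<^sub>v w \<in> W (head Q \<alpha>)"
  shows "submodule (\<Pi>\<^sub>E v\<in>verts Q. W v) \<Lambda> (rep_module Q d x)"
proof -
  interpret N: left_module \<Lambda> "rep_module Q d x" by (rule left_module_rep[OF x])
  have sub: "W v \<subseteq> carrier_vec (d v)" if "v \<in> verts Q" for v using W[OF that] by (simp add: vec_subspace_def)
  have subN: "(\<Pi>\<^sub>E v\<in>verts Q. W v) \<subseteq> carrier (rep_module Q d x)"
    unfolding carrier_rep_module using sub by (intro PiE_mono) auto
  show ?thesis
  proof (rule N.left_submoduleI[OF subN])
    show "\<zero>\<^bsub>rep_module Q d x\<^esub> \<in> (\<Pi>\<^sub>E v\<in>verts Q. W v)"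
      using W by (auto simp: zero_rep_module vec_subspace_def)
  next
    fix m m' assume "m \<in> (\<Pi>\<^sub>E v\<in>verts Q. W v)" "m' \<in> (\<Pi>\<^sub>E v\<in>verts Q. W v)"
    then show "m \<oplus>\<^bsub>rep_module Q d x\<^esub> m' \<in> (\<Pi>\<^sub>E v\<in>verts Q. W v)"
      using W unfolding add_rep_module vec_subspace_def by (intro restrict_PiE_iff[THEN iffD2] ballI) blast
  next
    fix a m assume a: "a \<in> carrier \<Lambda>" and m: "m \<in> (\<Pi>\<^sub>E v\<in>verts Q. W v)"
    obtain f where f: "f \<in> carrier PA" "a = cls f" using a by (rule carrier_LambdaE)
    have "first_order_action Q d x f m \<in> (\<Pi>\<^sub>E v\<in>verts Q. W v)"
      unfolding first_order_action_def
    proof (intro restrict_PiE_iff[THEN iffD2] ballI)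
      fix v assume v: "v \<in> verts Q"
      show "vec (d v) (\<lambda>i. f (v, []) * m v $ i +
          (\<Sum>\<alpha> | \<alpha> \<in> arcs Q \<and> head Q \<alpha> = v. f (tail Q \<alpha>, [\<alpha>]) * (x \<alpha> *\<^sub>v m (tail Q \<alpha>)) $ i)) \<in> W v"
        using v finite_arcs arrow PiE_mem[OF m] by (intro vec_subspace_sum[OF W[OF v]]) auto
    qed
    then show "a \<odot>\<^bsub>rep_module Q d x\<^esub> m \<in> (\<Pi>\<^sub>E v\<in>verts Q. W v)"
      using smult_rep_module[OF x f(1) subsetD[OF subN m]] f(2) by simp
  qed
qed

lemma radical_smult_family:
  assumes x: "x \<in> Rep Q I d" and a: "a \<in> jacobson_radical \<Lambda>" and m: "m \<in> carrier (rep_module Q d x)"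
    and W: "\<And>v. v \<in> verts Q \<Longrightarrow> vec_subspace (d v) (W v)"
    and arrow: "\<And>\<alpha>. \<alpha> \<in> arcs Q \<Longrightarrow> x \<alpha> *\<^sub>v m (tail Q \<alpha>) \<in> W (head Q \<alpha>)"
  shows "a \<odot>\<^bsub>rep_module Q d x\<^esub> m \<in> (\<Pi>\<^sub>E v\<in>verts Q. W v)"
proof -
  obtain f where f: "f \<in> arrow_ideal_power Q 1" "a = cls f" using a unfolding jacobson_radical_eq by blast
  then have fc: "f \<in> carrier PA" "\<And>v. f (v, []) = 0" by (force simp: arrow_ideal_power_def)+
  have "first_order_action Q d x f m \<in> (\<Pi>\<^sub>E v\<in>verts Q. W v)"
    unfolding first_order_action_def
  proof (intro restrict_PiE_iff[THEN iffD2] ballI)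
    fix v assume v: "v \<in> verts Q"
    have "0\<^sub>v (d v) \<in> W v" using W[OF v] by (simp add: vec_subspace_def)
    \<comment> \<open>The summand with factor 0 only brings the expression into the form of
      \<open>vec_subspace_sum\<close>; it stands for the trivial path, whose coefficient in a
      radical element is 0.\<close>
    then have "vec (d v) (\<lambda>i. 0 * 0\<^sub>v (d v) $ i +
        (\<Sum>\<alpha> | \<alpha> \<in> arcs Q \<and> head Q \<alpha> = v. f (tail Q \<alpha>, [\<alpha>]) * (x \<alpha> *\<^sub>v m (tail Q \<alpha>)) $ i)) \<in> W v"
      using finite_arcs arrow by (intro vec_subspace_sum[OF W[OF v]]) auto
    then show "vec (d v) (\<lambda>i. f (v, []) * m v $ i +
        (\<Sum>\<alpha> | \<alpha> \<in> arcs Q \<and> head Q \<alpha> = v. f (tail Q \<alpha>, [\<alpha>]) * (x \<alpha> *\<^sub>v m (tail Q \<alpha>)) $ i)) \<in> W v"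
      by (simp add: fc(2) del: index_mult_mat_vec)
  qed
  then show ?thesis using smult_rep_module[OF x fc(1) m] f(2) by simp
qed

lemma submodule_component_subspace:
  assumes x: "x \<in> Rep Q I d" and S: "submodule S \<Lambda> (rep_module Q d x)" and v: "v \<in> verts Q"
  shows "vec_subspace (d v) {w \<in> carrier_vec (d v). vertex_embed Q d v w \<in> S}"
proof -
  interpret N: left_module \<Lambda> "rep_module Q d x" by (rule left_module_rep[OF x])
  note SD = N.left_submoduleD[OF S]
  show ?thesis
    unfolding vec_subspace_def
    using SD(2,3,4) v vertex_elem_carrier[OF v] vertex_embed_zero[of d v x]
    by (auto simp: vertex_embed_add[of _ d v _ x] vertex_embed_smult[OF x])
qed

text \<open>The element is assembled from its components one vertex at a time, as the quiver is
  finite.\<close>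

lemma rep_module_induct:
  assumes m: "m \<in> carrier (rep_module Q d x)"
    and zero: "P \<zero>\<^bsub>rep_module Q d x\<^esub>"
    and add: "\<And>m m'. \<lbrakk>P m; P m'\<rbrakk> \<Longrightarrow> P (m \<oplus>\<^bsub>rep_module Q d x\<^esub> m')"
    and embed: "\<And>v. v \<in> verts Q \<Longrightarrow> P (vertex_embed Q d v (m v))"
  shows "P m"
proof -
  have "P (\<lambda>v\<in>verts Q. if v \<in> A then m v else 0\<^sub>v (d v))" if "finite A" "A \<subseteq> verts Q" for A
    using that
  proof induction
    case empty
    show ?case using zero by (simp only: empty_iff if_False zero_rep_module)
  next
    case (insert u A)
    let ?m = "\<lambda>v\<in>verts Q. if v \<in> A then m v else 0\<^sub>v (d v)"
    have "P (vertex_embed Q d u (m u) \<oplus>\<^bsub>rep_module Q d x\<^esub> ?m)"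
    proof (rule add)
      show "P (vertex_embed Q d u (m u))" using embed insert.prems by blast
      show "P ?m" using insert.IH insert.prems by blast
    qed
    also have "vertex_embed Q d u (m u) \<oplus>\<^bsub>rep_module Q d x\<^esub> ?m =
        (\<lambda>v\<in>verts Q. if v \<in> insert u A then m v else 0\<^sub>v (d v))"
      unfolding add_rep_module using insert.hyps rep_module_component[OF m]
      by (intro restrict_ext) (auto simp: vertex_embed_def)
    finally show ?case .
  qed
  from this[OF finite_verts order_refl]
  have "P (\<lambda>v\<in>verts Q. if v \<in> verts Q then m v else 0\<^sub>v (d v))" .
  also have "(\<lambda>v\<in>verts Q. if v \<in> verts Q then m v else 0\<^sub>v (d v)) = restrict m (verts Q)"
    by (intro restrict_ext) simp
  also have "\<dots> = m" using m by (intro extensional_restrict) (auto simp: carrier_rep_module PiE_iff)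
  finally show "P m" .
qed

text \<open>The trivial path at \<open>v\<close> sends a member of \<open>S\<close> to its component
  at \<open>v\<close>, which is therefore in \<open>S\<close>; conversely every element is the sum
  of its components. Submodules can thus be treated vertex by vertex as vector subspaces.\<close>

lemma submodule_components:
  assumes x: "x \<in> Rep Q I d" and S: "submodule S \<Lambda> (rep_module Q d x)"
  shows "S = (\<Pi>\<^sub>E v\<in>verts Q. {w \<in> carrier_vec (d v). vertex_embed Q d v w \<in> S})"
proof -
  interpret N: left_module \<Lambda> "rep_module Q d x" by (rule left_module_rep[OF x])
  note SD = N.left_submoduleD[OF S]
  show ?thesis
  proof (intro equalityI subsetI)
    fix m assume mS: "m \<in> S"
    then have m: "m \<in> carrier (rep_module Q d x)" using SD(1) by blast
    have "vertex_embed Q d v (m v) \<in> S" if v: "v \<in> verts Q" for v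
    proof -
      have "cls (vertex_elem 1 v) \<odot>\<^bsub>rep_module Q d x\<^esub> m \<in> S"
        using vertex_elem_carrier[OF v] mS by (intro SD(4)) auto
      then show ?thesis using vertex_smult[OF x m v, of 1] by simp
    qed
    then show "m \<in> (\<Pi>\<^sub>E v\<in>verts Q. {w \<in> carrier_vec (d v). vertex_embed Q d v w \<in> S})"
      using m by (auto simp: carrier_rep_module PiE_iff)
  next
    fix m assume m: "m \<in> (\<Pi>\<^sub>E v\<in>verts Q. {w \<in> carrier_vec (d v). vertex_embed Q d v w \<in> S})"
    have "m \<in> carrier (rep_module Q d x)" using m by (auto simp: carrier_rep_module PiE_iff)
    then show "m \<in> S"
    proof (rule rep_module_induct[where P = "\<lambda>m. m \<in> S", OF _ SD(2,3)])
      fix v assume "v \<in> verts Q"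
      from PiE_mem[OF m this] show "vertex_embed Q d v (m v) \<in> S" by blast
    qed
  qed
qed

end

section \<open>The degeneration locus\<close>

text \<open>The span of the first \<open>e v\<close> columns plays the role of W_v. The frames can
  be demanded at each vertex separately because every condition on an arrow concerns the space at
  one of its ends only.\<close>

definition degeneration_locus ::
  "('v, 'e) pre_digraph \<Rightarrow> (('v, 'e) path \<Rightarrow> 'k::field) set \<Rightarrow> ('v \<Rightarrow> nat) \<Rightarrow> ('v \<Rightarrow> nat) \<Rightarrow> ('e \<Rightarrow> 'k mat) set" where
  "degeneration_locus Q I d e = {x \<in> Rep Q I d. \<forall>v\<in>verts Q. \<exists>g. frame (d v) g \<and>
     (\<forall>\<alpha>\<in>arcs Q. head Q \<alpha> = v \<longrightarrow> (\<forall>w\<in>carrier_vec (d (tail Q \<alpha>)). x \<alpha> *\<^sub>v w \<in> frame_span g (e v))) \<and>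
     (\<forall>\<alpha>\<in>arcs Q. tail Q \<alpha> = v \<longrightarrow> (\<forall>w\<in>frame_span g (e v). x \<alpha> *\<^sub>v w = 0\<^sub>v (d (head Q \<alpha>))))}"

context square_zero_quiver
begin

text \<open>Both epimorphisms map the space at \<open>v\<close> onto the component of
  \<open>T\<close> at \<open>v\<close>, so relating vectors with equal image identifies the two
  quotients. Used in both directions, this shows that the dimension of the kernel at
  \<open>v\<close> is determined by \<open>T\<close>.\<close>

lemma epi_dim_le:
  assumes x: "x \<in> Rep Q I d" and y: "y \<in> Rep Q I d" and T: "left_module \<Lambda> T"
    and p: "module_epi \<Lambda> (rep_module Q d x) T p" and q: "module_epi \<Lambda> (rep_module Q d y) T q"
    and v: "v \<in> verts Q" and g: "frame (d v) g" "a \<le> d v" and g': "frame (d v) g'" "b \<le> d v"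
    and W: "{w \<in> carrier_vec (d v). p (vertex_embed Q d v w) = \<zero>\<^bsub>T\<^esub>} = frame_span g a"
    and W': "{w \<in> carrier_vec (d v). q (vertex_embed Q d v w) = \<zero>\<^bsub>T\<^esub>} = frame_span g' b"
  shows "b \<le> a"
proof (rule quotient_relation_dim_le[OF g(1) g'(1) g(2) g'(2),
      where \<rho> = "\<lambda>w w'. p (vertex_embed Q d v w) = q (vertex_embed Q d v w')"])
  interpret T: left_module \<Lambda> T by fact
  interpret X: left_module \<Lambda> "rep_module Q d x" by (rule left_module_rep[OF x])
  interpret Y: left_module \<Lambda> "rep_module Q d y" by (rule left_module_rep[OF y])
  note P = module_epi_simps[OF p X.left_module_axioms T]
  note Q' = module_epi_simps[OF q Y.left_module_axioms T]
  have ec: "\<And>(w :: 'k vec) z. w \<in> carrier_vec (d v) \<Longrightarrow> vertex_embed Q d v w \<in> carrier (rep_module Q d z)"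
    by (rule vertex_embed_carrier)
  have cv: "cls (vertex_elem k v) \<in> carrier \<Lambda>" for k using vertex_elem_carrier[OF v] by simp
  fix w :: "'k vec" assume w: "w \<in> carrier_vec (d v)"
  have "p (vertex_embed Q d v w) \<in> carrier T" using P(1) ec w by blast
  then obtain n where n: "n \<in> carrier (rep_module Q d y)" "p (vertex_embed Q d v w) = q n"
    using q unfolding module_epi_def by (metis imageE)
  have nv: "n v \<in> carrier_vec (d v)" by (rule rep_module_component[OF n(1) v])
  \<comment> \<open>The preimage \<open>n\<close> need not be concentrated at \<open>v\<close>;
    multiplication by the trivial path replaces it by its component there.\<close>
  have "p (vertex_embed Q d v w) = p (cls (vertex_elem 1 v) \<odot>\<^bsub>rep_module Q d x\<^esub> vertex_embed Q d v w)"
    using vertex_smult[OF x ec[OF w] v, of 1] v by simp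
  also have "\<dots> = cls (vertex_elem 1 v) \<odot>\<^bsub>T\<^esub> p (vertex_embed Q d v w)" using P(3)[OF cv ec[OF w]] .
  also have "\<dots> = cls (vertex_elem 1 v) \<odot>\<^bsub>T\<^esub> q n" using n by simp
  also have "\<dots> = q (cls (vertex_elem 1 v) \<odot>\<^bsub>rep_module Q d y\<^esub> n)" using Q'(3)[OF cv n(1)] by simp
  also have "\<dots> = q (vertex_embed Q d v (n v))" using vertex_smult[OF y n(1) v, of 1] by simp
  finally show "\<exists>w0\<in>carrier_vec (d v). p (vertex_embed Q d v w) = q (vertex_embed Q d v w0)" using nv by blast
next
  interpret T: left_module \<Lambda> T by fact
  interpret X: left_module \<Lambda> "rep_module Q d x" by (rule left_module_rep[OF x])
  interpret Y: left_module \<Lambda> "rep_module Q d y" by (rule left_module_rep[OF y])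
  note P = module_epi_simps[OF p X.left_module_axioms T]
  note Q' = module_epi_simps[OF q Y.left_module_axioms T]
  have ec: "\<And>(w :: 'k vec) z. w \<in> carrier_vec (d v) \<Longrightarrow> vertex_embed Q d v w \<in> carrier (rep_module Q d z)"
    by (rule vertex_embed_carrier)
  have cv: "cls (vertex_elem k v) \<in> carrier \<Lambda>" for k using vertex_elem_carrier[OF v] by simp
  show "p (vertex_embed Q d v (0\<^sub>v (d v))) = q (vertex_embed Q d v (0\<^sub>v (d v)))"
    using P(4) Q'(4) vertex_embed_zero[of d v] by metis
  {
    fix w w0 u u0 :: "'k vec"
    assume c: "w \<in> carrier_vec (d v)" "w0 \<in> carrier_vec (d v)" "u \<in> carrier_vec (d v)" "u0 \<in> carrier_vec (d v)"
      and eq: "p (vertex_embed Q d v w) = q (vertex_embed Q d v w0)"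
          "p (vertex_embed Q d v u) = q (vertex_embed Q d v u0)"
    show "p (vertex_embed Q d v (w + u)) = q (vertex_embed Q d v (w0 + u0))"
      unfolding vertex_embed_add[of w d v u x, OF c(1,3)] vertex_embed_add[of w0 d v u0 y, OF c(2,4)]
      by (simp add: P(2)[OF ec[OF c(1)] ec[OF c(3)]] Q'(2)[OF ec[OF c(2)] ec[OF c(4)]] eq)
  }
  {
    fix k and w w0 :: "'k vec"
    assume c: "w \<in> carrier_vec (d v)" "w0 \<in> carrier_vec (d v)"
      and eq: "p (vertex_embed Q d v w) = q (vertex_embed Q d v w0)"
    show "p (vertex_embed Q d v (k \<cdot>\<^sub>v w)) = q (vertex_embed Q d v (k \<cdot>\<^sub>v w0))"
      unfolding vertex_embed_smult[OF x _ v, of w, OF c(1)] vertex_embed_smult[OF y _ v, of w0, OF c(2)]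
      by (simp add: P(3)[OF cv ec[OF c(1)]] Q'(3)[OF cv ec[OF c(2)]] eq)
  }
  fix w w0 :: "'k vec" assume "w \<in> carrier_vec (d v)" "p (vertex_embed Q d v w) = q (vertex_embed Q d v w0)"
      "w0 \<in> frame_span g' b"
  then show "w \<in> frame_span g a" unfolding W[symmetric] W'[symmetric] by simp
qed

text \<open>Arrows act as zero on the family, so the algebra acts on the part at \<open>v\<close>
  through the scalar of the trivial path. Every line at a vertex is then a simple submodule, and
  these lines generate.\<close>

lemma semisimple_family:
  assumes x: "x \<in> Rep Q I d" and U: "\<And>v. v \<in> verts Q \<Longrightarrow> vec_subspace (d v) (U v)"
    and arrow: "\<And>\<alpha> w. \<lbrakk>\<alpha> \<in> arcs Q; w \<in> U (tail Q \<alpha>)\<rbrakk> \<Longrightarrow> x \<alpha> *\<^sub>v w = 0\<^sub>v (d (head Q \<alpha>))"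
  shows "semisimple_module \<Lambda> (rep_module Q d x\<lparr>carrier := \<Pi>\<^sub>E v\<in>verts Q. U v\<rparr>)"
proof -
  let ?N = "rep_module Q d x" and ?S = "\<Pi>\<^sub>E v\<in>verts Q. U v"
  let ?U = "?N\<lparr>carrier := ?S\<rparr>"
  interpret N: left_module \<Lambda> ?N by (rule left_module_rep[OF x])
  have S: "submodule ?S \<Lambda> ?N"
  proof (rule family_submodule[OF x U])
    fix \<alpha> w assume a: "\<alpha> \<in> arcs Q" "w \<in> U (tail Q \<alpha>)"
    then have "vec_subspace (d (head Q \<alpha>)) (U (head Q \<alpha>))" by (intro U) simp
    then show "x \<alpha> *\<^sub>v w \<in> U (head Q \<alpha>)" using arrow[OF a] by (simp add: vec_subspace_def)
  qed
  note SD = N.left_submoduleD[OF S]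
  interpret U: left_module \<Lambda> ?U by (rule N.submodule_carrier_update[OF S])
  have embed: "vertex_embed Q d v w \<in> ?S" if "v \<in> verts Q" "w \<in> U v" for v w
    using that U by (auto simp: vertex_embed_def vec_subspace_def)
  have smult: "cls f \<odot>\<^bsub>?N\<^esub> vertex_embed Q d v w = vertex_embed Q d v (f (v, []) \<cdot>\<^sub>v w)"
    if f: "f \<in> carrier PA" and v: "v \<in> verts Q" and w: "w \<in> U v" for f v w
  proof -
    have wc: "w \<in> carrier_vec (d v)" using vec_subspace_carrier[OF U[OF v] w] .
    have "cls f \<odot>\<^bsub>?N\<^esub> vertex_embed Q d v w = first_order_action Q d x f (vertex_embed Q d v w)"
      by (rule smult_rep_module[OF x f vertex_embed_carrier[of w d v x, OF wc]])
    also have "\<dots> = vertex_embed Q d v (f (v, []) \<cdot>\<^sub>v w)"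
    proof (rule rep_module_eqI[OF first_order_action_carrier])
      show "vertex_embed Q d v (f (v, []) \<cdot>\<^sub>v w) \<in> carrier (rep_module Q d x)"
        using wc by (intro vertex_embed_carrier) simp
      fix u i assume u: "u \<in> verts Q" "i < d u"
      have
          "(\<Sum>\<alpha> | \<alpha> \<in> arcs Q \<and> head Q \<alpha> = u. f (tail Q \<alpha>, [\<alpha>]) * (x \<alpha> *\<^sub>v vertex_embed Q d v w (tail Q \<alpha>)) $ i) = 0"
      proof (intro sum.neutral ballI)
        fix \<alpha> assume a: "\<alpha> \<in> {\<alpha>. \<alpha> \<in> arcs Q \<and> head Q \<alpha> = u}"
        then have "vertex_embed Q d v w (tail Q \<alpha>) \<in> U (tail Q \<alpha>)"
          using PiE_mem[OF embed[OF v w], of "tail Q \<alpha>"] by simp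
        then have "x \<alpha> *\<^sub>v vertex_embed Q d v w (tail Q \<alpha>) = 0\<^sub>v (d u)" using arrow[of \<alpha>] a by auto
        then show "f (tail Q \<alpha>, [\<alpha>]) * (x \<alpha> *\<^sub>v vertex_embed Q d v w (tail Q \<alpha>)) $ i = 0" using u by simp
      qed
      then show
          "first_order_action Q d x f (vertex_embed Q d v w) u $ i = vertex_embed Q d v (f (v, []) \<cdot>\<^sub>v w) u $ i"
        using u wc by (cases "u = v") (simp_all add: first_order_action_entry vertex_embed_entry)
    qed
    finally show ?thesis .
  qed
  have simple: "simple_submodule \<Lambda> ?U (range (\<lambda>k. vertex_embed Q d v (k \<cdot>\<^sub>v w)))"
    if v: "v \<in> verts Q" and w: "w \<in> U v" "w \<noteq> 0\<^sub>v (d v)" for v w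
  proof -
    let ?L = "range (\<lambda>k. vertex_embed Q d v (k \<cdot>\<^sub>v w))"
    have wc: "w \<in> carrier_vec (d v)" using vec_subspace_carrier[OF U[OF v] w(1)] .
    have kw: "k \<cdot>\<^sub>v w \<in> U v" for k using U[OF v] w by (simp add: vec_subspace_def)
    have "submodule ?L \<Lambda> ?U"
    proof (rule U.left_submoduleI)
      show "?L \<subseteq> carrier ?U" using embed[OF v kw] by auto
      have "0 \<cdot>\<^sub>v w = 0\<^sub>v (d v)" using wc by (intro eq_vecI) auto
      then have "\<zero>\<^bsub>?U\<^esub> = vertex_embed Q d v (0 \<cdot>\<^sub>v w)" using vertex_embed_zero[of d v x] by simp
      then show "\<zero>\<^bsub>?U\<^esub> \<in> ?L" by blast
      fix m m' assume "m \<in> ?L" "m' \<in> ?L"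
      then obtain k k' where k: "m = vertex_embed Q d v (k \<cdot>\<^sub>v w)" "m' = vertex_embed Q d v (k' \<cdot>\<^sub>v w)" by blast
      have "m \<oplus>\<^bsub>?U\<^esub> m' = vertex_embed Q d v (k \<cdot>\<^sub>v w + k' \<cdot>\<^sub>v w)"
        unfolding k using wc by (simp add: vertex_embed_add[of _ d v _ x])
      also have "k \<cdot>\<^sub>v w + k' \<cdot>\<^sub>v w = (k + k') \<cdot>\<^sub>v w" by (rule add_smult_distrib_vec[symmetric])
      finally show "m \<oplus>\<^bsub>?U\<^esub> m' \<in> ?L" by blast
    next
      fix a m assume a: "a \<in> carrier \<Lambda>" and "m \<in> ?L"
      then obtain k where k: "m = vertex_embed Q d v (k \<cdot>\<^sub>v w)" by blast
      obtain f where f: "f \<in> carrier PA" "a = cls f" using a by (rule carrier_LambdaE)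
      have "a \<odot>\<^bsub>?U\<^esub> m = vertex_embed Q d v ((f (v, []) * k) \<cdot>\<^sub>v w)"
        unfolding k f(2) using smult[OF f(1) v kw] by (simp add: smult_smult_assoc)
      then show "a \<odot>\<^bsub>?U\<^esub> m \<in> ?L" by blast
    qed
    moreover have "?L \<noteq> {\<zero>\<^bsub>?U\<^esub>}"
    proof
      assume L0: "?L = {\<zero>\<^bsub>?U\<^esub>}"
      have "vertex_embed Q d v (1 \<cdot>\<^sub>v w) \<in> ?L" by blast
      then have "vertex_embed Q d v w = \<zero>\<^bsub>?N\<^esub>" using L0 by simp
      then show False using vertex_embed_eq_zero_iff[OF v] w(2) by blast
    qed
    moreover have "N' = {\<zero>\<^bsub>?U\<^esub>} \<or> N' = ?L" if N': "submodule N' \<Lambda> ?U" "N' \<subseteq> ?L" for N'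
    proof (rule disjCI)
      assume "N' \<noteq> ?L"
      note ND = U.left_submoduleD[OF N'(1)]
      have "m = \<zero>\<^bsub>?U\<^esub>" if m: "m \<in> N'" for m
      proof (rule ccontr)
        assume m0: "m \<noteq> \<zero>\<^bsub>?U\<^esub>"
        obtain k where k: "m = vertex_embed Q d v (k \<cdot>\<^sub>v w)" using m N'(2) by blast
        have "k \<noteq> 0"
        proof
          assume "k = 0"
          then have "k \<cdot>\<^sub>v w = 0\<^sub>v (d v)" using wc by (intro eq_vecI) auto
          then show False using m0 k vertex_embed_zero[of d v x] by simp
        qed
        have "vertex_embed Q d v (l \<cdot>\<^sub>v w) \<in> N'" for l
        proof -
          \<comment> \<open>The nonzero member \<open>m\<close>, which is \<open>w\<close> scaled by
            \<open>k\<close>, is rescaled to an arbitrary point of the line by the coefficient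
            \<open>l / k\<close>.\<close>
          have "cls (vertex_elem (l / k) v) \<odot>\<^bsub>?U\<^esub> m \<in> N'"
            using vertex_elem_carrier[OF v] m by (intro ND(4)) auto
          then show ?thesis using smult[OF vertex_elem_carrier[OF v] v kw] \<open>k \<noteq> 0\<close>
            by (simp add: k vertex_elem_def smult_smult_assoc)
        qed
        then have "?L \<subseteq> N'" by blast
        then show False using \<open>N' \<noteq> ?L\<close> N'(2) by blast
      qed
      then show "N' = {\<zero>\<^bsub>?U\<^esub>}" using ND(2) by blast
    qed
    ultimately show ?thesis unfolding simple_submodule_def by blast
  qed
  let ?G = "generate (add_monoid ?U) (\<Union>{S. simple_submodule \<Lambda> ?U S})"
  have "?S \<subseteq> ?G"
  proof
    fix m assume m: "m \<in> ?S"
    then have mN: "m \<in> carrier ?N" using SD(1) by blast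
    show "m \<in> ?G"
    proof (rule rep_module_induct[where P = "\<lambda>m. m \<in> ?G", OF mN])
      show "\<zero>\<^bsub>?N\<^esub> \<in> ?G" using generate.one[of "add_monoid ?U"] by simp
      show "\<And>m m'. m \<in> ?G \<Longrightarrow> m' \<in> ?G \<Longrightarrow> m \<oplus>\<^bsub>?N\<^esub> m' \<in> ?G"
        using generate.eng[of _ "add_monoid ?U"] by simp
      fix v assume v: "v \<in> verts Q"
      have mv: "m v \<in> U v" using PiE_mem[OF m v] .
      show "vertex_embed Q d v (m v) \<in> ?G"
      proof (cases "m v = 0\<^sub>v (d v)")
        case True
        then show ?thesis using vertex_embed_zero[of d v x] generate.one[of "add_monoid ?U"] by simp
      next
        case False
        have "vertex_embed Q d v (1 \<cdot>\<^sub>v m v) \<in> range (\<lambda>k. vertex_embed Q d v (k \<cdot>\<^sub>v m v))" by blast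
        then show ?thesis using simple[OF v mv False] by (intro generate.incl) auto
      qed
    qed
  qed
  moreover have "?G \<subseteq> ?S"
  proof -
    have "S \<subseteq> carrier ?U" if "simple_submodule \<Lambda> ?U S" for S
      using that U.left_submoduleD(1) unfolding simple_submodule_def by blast
    then have "?G \<subseteq> carrier ?U"
      by (intro U.generate_subset_submodule[OF U.carrier_submodule] Union_least) blast
    then show ?thesis by simp
  qed
  ultimately have "carrier ?U = ?G" by (simp add: subset_antisym)
  then show ?thesis unfolding semisimple_module_def using U.left_module_axioms by blast
qed

lemma minus_rep_module:
  assumes x: "x \<in> Rep Q I d" and m: "m \<in> carrier (rep_module Q d x)" "m' \<in> carrier (rep_module Q d x)"
    and v: "v \<in> verts Q"
  shows "(m \<ominus>\<^bsub>rep_module Q d x\<^esub> m') v = m v - m' v"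
proof -
  interpret N: left_module \<Lambda> "rep_module Q d x" by (rule left_module_rep[OF x])
  let ?n = "m \<ominus>\<^bsub>rep_module Q d x\<^esub> m'"
  have n: "?n \<in> carrier (rep_module Q d x)" using m by simp
  have nm: "?n \<oplus>\<^bsub>rep_module Q d x\<^esub> m' = m" using m by (simp add: a_minus_def N.a_assoc N.l_neg)
  have dims: "dim_vec (?n v) = d v" "dim_vec (m v) = d v" "dim_vec (m' v) = d v"
    using rep_module_component[OF n v] rep_module_component[OF m(1) v] rep_module_component[OF m(2) v] by auto
  show ?thesis
  proof (rule eq_vecI)
    fix i assume "i < dim_vec (m v - m' v)"
    then have i: "i < d v" using dims by simp
    have "?n v $ i + m' v $ i = m v $ i" using add_rep_module_entry[OF n m(2) v i] nm by simp
    then show "?n v $ i = (m v - m' v) $ i" using i dims by (simp add: algebra_simps)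
  qed (use dims in simp)
qed

text \<open>Up to arrow contributions, \<open>f\<close> acts at \<open>v\<close> as a scalar that
  does not depend on the representation. This is why linear maps that ignore the arrows can become
  homomorphisms on tops.\<close>

lemma first_order_action_split:
  assumes x: "x \<in> rep_space Q d" and m: "m \<in> carrier (rep_module Q d x)" and v: "v \<in> verts Q"
    and W: "vec_subspace (d v) W" and arrow: "\<And>\<alpha>. \<lbrakk>\<alpha> \<in> arcs Q; head Q \<alpha> = v\<rbrakk> \<Longrightarrow> x \<alpha> *\<^sub>v m (tail Q \<alpha>) \<in> W"
  shows "\<exists>z\<in>W. first_order_action Q d x f m v = f (v, []) \<cdot>\<^sub>v m v + z"
proof
  let ?z = "vec (d v) (\<lambda>i. 0 * 0\<^sub>v (d v) $ i +
    (\<Sum>\<alpha> | \<alpha> \<in> arcs Q \<and> head Q \<alpha> = v. f (tail Q \<alpha>, [\<alpha>]) * (x \<alpha> *\<^sub>v m (tail Q \<alpha>)) $ i))"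
  show "?z \<in> W" using W finite_arcs arrow by (intro vec_subspace_sum[OF W]) (auto simp: vec_subspace_def)
  have "dim_vec (m v) = d v" using rep_module_component[OF m v] by simp
  then show "first_order_action Q d x f m v = f (v, []) \<cdot>\<^sub>v m v + ?z"
    using v by (intro eq_vecI) (auto simp: first_order_action_def simp del: index_mult_mat_vec)
qed

section \<open>Radicals of representations and comparison of tops\<close>

lemma radical_component_arrow:
  assumes x: "x \<in> Rep Q I d" and \<alpha>: "\<alpha> \<in> arcs Q" and w: "w \<in> carrier_vec (d (tail Q \<alpha>))"
  shows "vertex_embed Q d (head Q \<alpha>) (x \<alpha> *\<^sub>v w) \<in> radical_submodule \<Lambda> (rep_module Q d x)"
  using arrow_smult[OF x vertex_embed_carrier[of w d "tail Q \<alpha>" x, OF w] \<alpha>] \<alpha>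
    radical_smult_in[OF arrow_elem_radical[OF \<alpha>] vertex_embed_carrier[of w d "tail Q \<alpha>" x, OF w]] by simp

lemma radical_family:
  assumes x: "x \<in> Rep Q I d"
  shows "radical_submodule \<Lambda> (rep_module Q d x) = (\<Pi>\<^sub>E v\<in>verts Q.
    {w \<in> carrier_vec (d v). vertex_embed Q d v w \<in> radical_submodule \<Lambda> (rep_module Q d x)})"
  by (rule submodule_components[OF x submodule_radical[OF left_module_rep[OF x]]])

lemma radical_subset_family:
  assumes x: "x \<in> Rep Q I d" and W: "\<And>v. v \<in> verts Q \<Longrightarrow> vec_subspace (d v) (W v)"
    and arrow: "\<And>\<alpha> w. \<lbrakk>\<alpha> \<in> arcs Q; w \<in> carrier_vec (d (tail Q \<alpha>))\<rbrakk> \<Longrightarrow> x \<alpha> *\<^sub>v w \<in> W (head Q \<alpha>)"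
  shows "radical_submodule \<Lambda> (rep_module Q d x) \<subseteq> (\<Pi>\<^sub>E v\<in>verts Q. W v)"
proof (rule radical_submodule_least[OF left_module_rep[OF x]])
  show "submodule (\<Pi>\<^sub>E v\<in>verts Q. W v) \<Lambda> (rep_module Q d x)"
    using vec_subspace_carrier[OF W] arrow by (intro family_submodule[OF x W]) auto
  fix a m assume "a \<in> jacobson_radical \<Lambda>" "m \<in> carrier (rep_module Q d x)"
  then show "a \<odot>\<^bsub>rep_module Q d x\<^esub> m \<in> (\<Pi>\<^sub>E v\<in>verts Q. W v)"
    using rep_module_component[of m d x] arrow by (intro radical_smult_family[OF x _ _ W]) auto
qed

text \<open>The comparison map applies \<open>A v\<close> at each vertex. It is linear over the
  algebra only modulo the radical \<open>W\<close> of \<open>y\<close>: the scalar parts on both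
  sides agree, and the arrow parts fall into \<open>W\<close>, by \<open>arrow\<close> for
  \<open>x\<close> and because \<open>W\<close> is the radical for \<open>y\<close>. On the side of
  \<open>x\<close> a subrepresentation \<open>S\<close> is allowed, so that the result covers a
  direct summand.\<close>

lemma top_isomorphic_family:
  assumes x: "x \<in> Rep Q I d" and y: "y \<in> Rep Q I d" and T: "left_module \<Lambda> T"
    and top: "module_isomorphic \<Lambda> (top_module \<Lambda> (rep_module Q d y)) T"
    and S: "submodule (\<Pi>\<^sub>E v\<in>verts Q. S v) \<Lambda> (rep_module Q d x)"
    and A: "\<And>v. v \<in> verts Q \<Longrightarrow> A v \<in> carrier_mat (d v) (d v)"
    and W: "\<And>v. v \<in> verts Q \<Longrightarrow> vec_subspace (d v) (W v)"
    and rad: "radical_submodule \<Lambda> (rep_module Q d y) = (\<Pi>\<^sub>E v\<in>verts Q. W v)"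
    and ker: "\<And>m. m \<in> (\<Pi>\<^sub>E v\<in>verts Q. S v) \<Longrightarrow>
      m \<in> radical_submodule \<Lambda> (rep_module Q d x\<lparr>carrier := \<Pi>\<^sub>E v\<in>verts Q. S v\<rparr>) \<longleftrightarrow>
        (\<forall>v\<in>verts Q. A v *\<^sub>v m v \<in> W v)"
    and arrow: "\<And>\<alpha> w. \<lbrakk>\<alpha> \<in> arcs Q; w \<in> carrier_vec (d (tail Q \<alpha>))\<rbrakk> \<Longrightarrow>
      A (head Q \<alpha>) *\<^sub>v (x \<alpha> *\<^sub>v w) \<in> W (head Q \<alpha>)"
    and surj: "\<And>v n. \<lbrakk>v \<in> verts Q; n \<in> carrier_vec (d v)\<rbrakk> \<Longrightarrow> \<exists>w\<in>S v. n - A v *\<^sub>v w \<in> W v"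
  shows "module_isomorphic \<Lambda>
    (top_module \<Lambda> (rep_module Q d x\<lparr>carrier := \<Pi>\<^sub>E v\<in>verts Q. S v\<rparr>)) T"
proof -
  interpret X: left_module \<Lambda> "rep_module Q d x" by (rule left_module_rep[OF x])
  interpret Y: left_module \<Lambda> "rep_module Q d y" by (rule left_module_rep[OF y])
  let ?S = "\<Pi>\<^sub>E v\<in>verts Q. S v"
  let ?M = "rep_module Q d x\<lparr>carrier := ?S\<rparr>"
  have xs: "x \<in> rep_space Q d" and ys: "y \<in> rep_space Q d" using x y by (auto simp: Rep_iff)
  have SN: "m \<in> carrier (rep_module Q d x)" if "m \<in> ?S" for m
    using that X.left_submoduleD(1)[OF S] by blast
  have Wc: "\<And>v w. v \<in> verts Q \<Longrightarrow> w \<in> W v \<Longrightarrow> w \<in> carrier_vec (d v)"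
    using vec_subspace_carrier[OF W] .
  have yarrow: "y \<alpha> *\<^sub>v w \<in> W (head Q \<alpha>)" if "\<alpha> \<in> arcs Q" "w \<in> carrier_vec (d (tail Q \<alpha>))" for \<alpha> w
  proof -
    have hv: "head Q \<alpha> \<in> verts Q" using that by simp
    have "vertex_embed Q d (head Q \<alpha>) (y \<alpha> *\<^sub>v w) \<in> (\<Pi>\<^sub>E v\<in>verts Q. W v)"
      using radical_component_arrow[OF y that] rad by simp
    from PiE_mem[OF this hv] show ?thesis using hv by simp
  qed
  define \<theta> where "\<theta> m = (\<lambda>v\<in>verts Q. A v *\<^sub>v m v)" for m :: "'v \<Rightarrow> 'k vec"
  have Am: "A v *\<^sub>v m v \<in> carrier_vec (d v)" if "m \<in> carrier (rep_module Q d x)" "v \<in> verts Q" for m v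
    using A[OF that(2)] rep_module_component[OF that] by (rule mult_mat_vec_carrier)
  have \<theta>c: "\<theta> m \<in> carrier (rep_module Q d y)" if "m \<in> carrier (rep_module Q d x)" for m
    unfolding \<theta>_def carrier_rep_module restrict_PiE_iff using Am[OF that] by blast
  show ?thesis
  proof (rule top_isomorphic_transfer[OF X.submodule_carrier_update[OF S] Y.left_module_axioms T top])
    fix m assume "m \<in> carrier ?M"
    then have m: "m \<in> ?S" by simp
    show "\<theta> m \<in> carrier (rep_module Q d y)" using \<theta>c SN m by blast
    show "\<theta> m \<in> radical_submodule \<Lambda> (rep_module Q d y) \<longleftrightarrow> m \<in> radical_submodule \<Lambda> ?M"
      unfolding rad ker[OF m] \<theta>_def restrict_PiE_iff ..
  next
    fix m m' assume "m \<in> carrier ?M" "m' \<in> carrier ?M"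
    then have m: "m \<in> carrier (rep_module Q d x)" "m' \<in> carrier (rep_module Q d x)" using SN by auto
    show "\<theta> (m \<oplus>\<^bsub>?M\<^esub> m') = \<theta> m \<oplus>\<^bsub>rep_module Q d y\<^esub> \<theta> m'"
      unfolding add_rep_module \<theta>_def
    proof (rule restrict_ext)
      fix v assume v: "v \<in> verts Q"
      show "A v *\<^sub>v (m \<oplus>\<^bsub>?M\<^esub> m') v = (\<lambda>v\<in>verts Q. A v *\<^sub>v m v) v + (\<lambda>v\<in>verts Q. A v *\<^sub>v m' v) v"
        using v mult_add_distrib_mat_vec[OF A[OF v] rep_module_component[OF m(1) v] rep_module_component[OF m(2) v]]
        by (simp add: add_rep_module)
    qed
  next
    fix a m assume a: "a \<in> carrier \<Lambda>" and "m \<in> carrier ?M"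
    then have m: "m \<in> carrier (rep_module Q d x)" using SN by simp
    obtain f where f: "f \<in> carrier PA" "a = cls f" using a by (rule carrier_LambdaE)
    let ?l = "\<theta> (a \<odot>\<^bsub>?M\<^esub> m)" and ?r = "a \<odot>\<^bsub>rep_module Q d y\<^esub> \<theta> m"
    have l: "?l = \<theta> (first_order_action Q d x f m)" using smult_rep_module[OF x f(1) m] f by simp
    have r: "?r = first_order_action Q d y f (\<theta> m)" using smult_rep_module[OF y f(1) \<theta>c[OF m]] f by simp
    have lc: "?l \<in> carrier (rep_module Q d y)" unfolding l by (intro \<theta>c first_order_action_carrier)
    have rc: "?r \<in> carrier (rep_module Q d y)" unfolding r by (intro first_order_action_carrier)
    have "(?l \<ominus>\<^bsub>rep_module Q d y\<^esub> ?r) v \<in> W v" if v: "v \<in> verts Q" for v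
    proof -
      note Av = A[OF v] and mv = rep_module_component[OF m v]
      \<comment> \<open>The vectors that \<open>A v\<close> sends into \<open>W v\<close>; they form
        a subspace containing the arrow terms of \<open>x\<close>.\<close>
      let ?V = "{w \<in> carrier_vec (d v). A v *\<^sub>v w \<in> W v}"
      obtain z where z: "z \<in> ?V" "first_order_action Q d x f m v = f (v, []) \<cdot>\<^sub>v m v + z"
      proof -
        have "x \<alpha> *\<^sub>v m (tail Q \<alpha>) \<in> ?V" if a: "\<alpha> \<in> arcs Q" "head Q \<alpha> = v" for \<alpha>
        proof -
          have "m (tail Q \<alpha>) \<in> carrier_vec (d (tail Q \<alpha>))" using a by (intro rep_module_component[OF m]) simp
          then show ?thesis using arrow[OF a(1)] arrow_mult_vec[OF xs a(1)] a(2) by auto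
        qed
        then show thesis using first_order_action_split[OF xs m v vimage_subspace[OF W[OF v] Av]] that by blast
      qed
      obtain z' where z': "z' \<in> W v" "first_order_action Q d y f (\<theta> m) v = f (v, []) \<cdot>\<^sub>v \<theta> m v + z'"
      proof -
        have "y \<alpha> *\<^sub>v \<theta> m (tail Q \<alpha>) \<in> W v" if a: "\<alpha> \<in> arcs Q" "head Q \<alpha> = v" for \<alpha>
          using yarrow[OF a(1)] rep_module_component[OF \<theta>c[OF m], of "tail Q \<alpha>"] a by auto
        then show thesis using first_order_action_split[OF ys \<theta>c[OF m] v W[OF v]] that by blast
      qed
      have zc: "z \<in> carrier_vec (d v)" "z' \<in> carrier_vec (d v)" "A v *\<^sub>v z \<in> carrier_vec (d v)"
        "A v *\<^sub>v m v \<in> carrier_vec (d v)"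
        using z z' Wc v Av mv by auto
      have "(?l \<ominus>\<^bsub>rep_module Q d y\<^esub> ?r) v = ?l v - ?r v" by (rule minus_rep_module[OF y lc rc v])
      also have "?l v = A v *\<^sub>v (f (v, []) \<cdot>\<^sub>v m v + z)" unfolding l using z v by (simp add: \<theta>_def)
      also have "\<dots> = f (v, []) \<cdot>\<^sub>v (A v *\<^sub>v m v) + A v *\<^sub>v z"
        using Av mv zc by (simp add: mult_add_distrib_mat_vec[OF Av] mult_mat_vec[OF Av])
      also have "?r v = f (v, []) \<cdot>\<^sub>v (A v *\<^sub>v m v) + z'" unfolding r using z' v by (simp add: \<theta>_def)
      also have "f (v, []) \<cdot>\<^sub>v (A v *\<^sub>v m v) + A v *\<^sub>v z - (f (v, []) \<cdot>\<^sub>v (A v *\<^sub>v m v) + z') = A v *\<^sub>v z - z'"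
        using zc by (intro vec_add_diff_cancel) auto
      finally show ?thesis using vec_subspace_diff[OF W[OF v]] z z' by simp
    qed
    moreover have "?l \<ominus>\<^bsub>rep_module Q d y\<^esub> ?r \<in> carrier (rep_module Q d y)" using lc rc by simp
    ultimately show "?l \<ominus>\<^bsub>rep_module Q d y\<^esub> ?r \<in> radical_submodule \<Lambda> (rep_module Q d y)"
      unfolding rad carrier_rep_module by (simp add: PiE_iff)
  next
    fix n assume n: "n \<in> carrier (rep_module Q d y)"
    have "\<forall>v\<in>verts Q. \<exists>w. w \<in> S v \<and> n v - A v *\<^sub>v w \<in> W v"
      using surj rep_module_component[OF n] by blast
    then obtain s where s: "\<forall>v\<in>verts Q. s v \<in> S v \<and> n v - A v *\<^sub>v s v \<in> W v" by (rule bchoice[THEN exE])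
    let ?s = "restrict s (verts Q)"
    have sS: "?s \<in> ?S" unfolding restrict_PiE_iff using s by blast
    note sN = \<theta>c[OF SN[OF sS]]
    have "(n \<ominus>\<^bsub>rep_module Q d y\<^esub> \<theta> ?s) v \<in> W v" if v: "v \<in> verts Q" for v
      using minus_rep_module[OF y n sN v] s v by (simp add: \<theta>_def)
    moreover have "n \<ominus>\<^bsub>rep_module Q d y\<^esub> \<theta> ?s \<in> carrier (rep_module Q d y)" using n sN by simp
    ultimately have "n \<ominus>\<^bsub>rep_module Q d y\<^esub> \<theta> ?s \<in> radical_submodule \<Lambda> (rep_module Q d y)"
      unfolding rad carrier_rep_module by (simp add: PiE_iff)
    then show "\<exists>m\<in>carrier ?M. n \<ominus>\<^bsub>rep_module Q d y\<^esub> \<theta> m \<in> radical_submodule \<Lambda> (rep_module Q d y)"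
      using sS by (intro bexI[of _ ?s]) simp_all
  qed
qed

lemma degeneration_locusE:
  assumes "x \<in> degeneration_locus Q I d e"
  obtains G where "\<And>v. v \<in> verts Q \<Longrightarrow> frame (d v) (G v)"
    "\<And>\<alpha> w. \<alpha> \<in> arcs Q \<Longrightarrow> w \<in> carrier_vec (d (tail Q \<alpha>)) \<Longrightarrow> x \<alpha> *\<^sub>v w \<in> frame_span (G (head Q \<alpha>)) (e (head Q \<alpha>))"
    "\<And>\<alpha> w. \<alpha> \<in> arcs Q \<Longrightarrow> w \<in> frame_span (G (tail Q \<alpha>)) (e (tail Q \<alpha>)) \<Longrightarrow> x \<alpha> *\<^sub>v w = 0\<^sub>v (d (head Q \<alpha>))"
proof -
  from assms obtain G where "\<forall>v\<in>verts Q. frame (d v) (G v) \<and>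
    (\<forall>\<alpha>\<in>arcs Q. head Q \<alpha> = v \<longrightarrow> (\<forall>w\<in>carrier_vec (d (tail Q \<alpha>)). x \<alpha> *\<^sub>v w \<in> frame_span (G v) (e v))) \<and>
    (\<forall>\<alpha>\<in>arcs Q. tail Q \<alpha> = v \<longrightarrow> (\<forall>w\<in>frame_span (G v) (e v). x \<alpha> *\<^sub>v w = 0\<^sub>v (d (head Q \<alpha>))))"
    unfolding degeneration_locus_def mem_Collect_eq by (elim conjE bchoice[THEN exE])
  then show thesis by (intro that[of G]) (use head_in_verts tail_in_verts in blast)+
qed

text \<open>Images land in \<open>W\<close>, which the next arrow kills. For fixed \<open>W\<close>
  both premises are linear in \<open>x\<close>, which makes them easy to verify along a
  line.\<close>

lemma RepI:
  assumes x: "x \<in> rep_space Q d"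
    and img: "\<And>\<alpha> w. \<lbrakk>\<alpha> \<in> arcs Q; w \<in> carrier_vec (d (tail Q \<alpha>))\<rbrakk> \<Longrightarrow> x \<alpha> *\<^sub>v w \<in> W (head Q \<alpha>)"
    and kill: "\<And>\<alpha> w. \<lbrakk>\<alpha> \<in> arcs Q; w \<in> W (tail Q \<alpha>)\<rbrakk> \<Longrightarrow> x \<alpha> *\<^sub>v w = 0\<^sub>v (d (head Q \<alpha>))"
  shows "x \<in> Rep Q I d"
proof -
  have "x \<beta> * x \<alpha> = 0\<^sub>m (d (head Q \<beta>)) (d (tail Q \<alpha>))"
    if ab: "\<alpha> \<in> arcs Q" "\<beta> \<in> arcs Q" "head Q \<alpha> = tail Q \<beta>" for \<alpha> \<beta>
  proof (rule eq_matI)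
    have a: "x \<alpha> \<in> carrier_mat (d (tail Q \<beta>)) (d (tail Q \<alpha>))" and b:
        "x \<beta> \<in> carrier_mat (d (head Q \<beta>)) (d (tail Q \<beta>))"
      using rep_space_mat[OF x ab(1)] rep_space_mat[OF x ab(2)] ab(3) by auto
    then show "dim_row (x \<beta> * x \<alpha>) = dim_row (0\<^sub>m (d (head Q \<beta>)) (d (tail Q \<alpha>)))"
      "dim_col (x \<beta> * x \<alpha>) = dim_col (0\<^sub>m (d (head Q \<beta>)) (d (tail Q \<alpha>)))" by auto
    fix i j assume "i < dim_row (0\<^sub>m (d (head Q \<beta>)) (d (tail Q \<alpha>)))"
        "j < dim_col (0\<^sub>m (d (head Q \<beta>)) (d (tail Q \<alpha>)))"
    then have i: "i < d (head Q \<beta>)" and j: "j < d (tail Q \<alpha>)" by auto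
    have "col (x \<alpha>) j \<in> W (tail Q \<beta>)"
      using img[OF ab(1), of "unit_vec (d (tail Q \<alpha>)) j"] mult_mat_unit_vec[OF a j] ab(3) by simp
    then have "x \<beta> *\<^sub>v col (x \<alpha>) j = 0\<^sub>v (d (head Q \<beta>))" by (rule kill[OF ab(2)])
    then have "(x \<beta> *\<^sub>v col (x \<alpha>) j) $ i = 0" using i by simp
    then show "(x \<beta> * x \<alpha>) $$ (i, j) = 0\<^sub>m (d (head Q \<beta>)) (d (tail Q \<alpha>)) $$ (i, j)"
      using i j a b by simp
  qed
  then show ?thesis using x by (simp add: Rep_iff zero_composites_def)
qed

end

text \<open>A reference point \<open>y\<close> with top \<open>T\<close> is fixed:
  \<open>e v\<close> is the dimension of its radical at \<open>v\<close>, and the first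
  \<open>e v\<close> columns of \<open>g0 v\<close> are a basis of that radical component.\<close>

locale realized_top = square_zero_quiver Q I
  for Q :: "('v, 'e) pre_digraph" and I :: "(('v, 'e) path \<Rightarrow> 'k::field) set" +
  fixes d e :: "'v \<Rightarrow> nat"
    and T :: "((('v, 'e) path \<Rightarrow> 'k) set, 't) module"
    and y :: "'e \<Rightarrow> 'k mat" and p :: "('v \<Rightarrow> 'k vec) \<Rightarrow> 't" and g0 :: "'v \<Rightarrow> 'k mat"
  assumes T: "left_module (quiver_algebra Q I) T"
    and y: "y \<in> Rep Q I d"
    and p: "module_epi (quiver_algebra Q I) (rep_module Q d y) T p"
    and p_kernel: "m \<in> carrier (rep_module Q d y) \<Longrightarrow>
      p m = \<zero>\<^bsub>T\<^esub> \<longleftrightarrow> m \<in> radical_submodule (quiver_algebra Q I) (rep_module Q d y)"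
    and g0: "v \<in> verts Q \<Longrightarrow> frame (d v) (g0 v)"
    and e_le: "v \<in> verts Q \<Longrightarrow> e v \<le> d v"
    and rad_component: "v \<in> verts Q \<Longrightarrow> {w \<in> carrier_vec (d v).
      vertex_embed Q d v w \<in> radical_submodule (quiver_algebra Q I) (rep_module Q d y)} = frame_span (g0 v) (e v)"
begin

section \<open>The degeneration locus and direct sums\<close>

lemma radical_y: "radical_submodule \<Lambda> (rep_module Q d y) = (\<Pi>\<^sub>E v\<in>verts Q. frame_span (g0 v) (e v))"
  by (subst radical_family[OF y]) (intro PiE_cong rad_component)

lemma top_y: "module_isomorphic \<Lambda> (top_module \<Lambda> (rep_module Q d y)) T"
  using top_isomorphic_iff[OF left_module_rep[OF y] T] p p_kernel by blast

lemma p_component: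
  assumes v: "v \<in> verts Q"
  shows "{w \<in> carrier_vec (d v). p (vertex_embed Q d v w) = \<zero>\<^bsub>T\<^esub>} = frame_span (g0 v) (e v)"
proof -
  have "p (vertex_embed Q d v w) = \<zero>\<^bsub>T\<^esub> \<longleftrightarrow> vertex_embed Q d v w \<in> radical_submodule \<Lambda> (rep_module Q d y)"
    if "w \<in> carrier_vec (d v)" for w
    using vertex_embed_carrier[of w d v y] that by (intro p_kernel) simp
  then show ?thesis unfolding rad_component[OF v, symmetric] by blast
qed

text \<open>W_v is the kernel of \<open>q\<close> at \<open>v\<close>. Comparison with
  \<open>y\<close> in both directions gives it dimension \<open>e v\<close>; \<open>q1\<close> says
  that it contains the images of arrows, \<open>q2\<close> that arrows kill it. Points with top
  \<open>T\<close> and sums of a module with top \<open>T\<close> and a semisimple one both supply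
  such a \<open>q\<close>.\<close>

lemma epi_in_locus:
  assumes x: "x \<in> Rep Q I d" and q: "module_epi \<Lambda> (rep_module Q d x) T q"
    and q1: "\<And>a m. \<lbrakk>a \<in> jacobson_radical \<Lambda>; m \<in> carrier (rep_module Q d x)\<rbrakk> \<Longrightarrow>
      q (a \<odot>\<^bsub>rep_module Q d x\<^esub> m) = \<zero>\<^bsub>T\<^esub>"
    and q2: "\<And>a m. \<lbrakk>a \<in> jacobson_radical \<Lambda>; m \<in> carrier (rep_module Q d x); q m = \<zero>\<^bsub>T\<^esub>\<rbrakk> \<Longrightarrow>
      a \<odot>\<^bsub>rep_module Q d x\<^esub> m = \<zero>\<^bsub>rep_module Q d x\<^esub>"
  shows "x \<in> degeneration_locus Q I d e"
proof -
  interpret X: left_module \<Lambda> "rep_module Q d x" by (rule left_module_rep[OF x])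
  let ?K = "{m \<in> carrier (rep_module Q d x). q m = \<zero>\<^bsub>T\<^esub>}"
  have K: "submodule ?K \<Lambda> (rep_module Q d x)" by (rule X.kernel_submodule[OF T q])
  have xs: "x \<in> rep_space Q d" using x by (simp add: Rep_iff)
  have "\<exists>g. frame (d v) g \<and>
     (\<forall>\<alpha>\<in>arcs Q. head Q \<alpha> = v \<longrightarrow> (\<forall>w\<in>carrier_vec (d (tail Q \<alpha>)). x \<alpha> *\<^sub>v w \<in> frame_span g (e v))) \<and>
     (\<forall>\<alpha>\<in>arcs Q. tail Q \<alpha> = v \<longrightarrow> (\<forall>w\<in>frame_span g (e v). x \<alpha> *\<^sub>v w = 0\<^sub>v (d (head Q \<alpha>))))"
    if v: "v \<in> verts Q" for v
  proof -
    let ?W = "{w \<in> carrier_vec (d v). q (vertex_embed Q d v w) = \<zero>\<^bsub>T\<^esub>}"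
    have ec: "vertex_embed Q d u w \<in> carrier (rep_module Q d x)" if "w \<in> carrier_vec (d u)" for u and w ::
        "'k vec"
      using that by (rule vertex_embed_carrier)
    have "?W = {w \<in> carrier_vec (d v). vertex_embed Q d v w \<in> ?K}" using ec by blast
    then have "vec_subspace (d v) ?W" using submodule_component_subspace[OF x K v] by simp
    then obtain g a where g: "frame (d v) g" "a \<le> d v" "?W = frame_span g a" by (rule subspace_frame)
    have "e v \<le> a"
      by (rule epi_dim_le[OF x y T q p v g(1,2) g0[OF v] e_le[OF v] g(3) p_component[OF v]])
    moreover have "a \<le> e v"
      by (rule epi_dim_le[OF y x T p q v g0[OF v] e_le[OF v] g(1,2) p_component[OF v] g(3)])
    ultimately have W: "?W = frame_span g (e v)" using g(3) by simp
    have "x \<alpha> *\<^sub>v w \<in> frame_span g (e v)" if a: "\<alpha> \<in> arcs Q" "head Q \<alpha> = v" and w: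
        "w \<in> carrier_vec (d (tail Q \<alpha>))" for \<alpha> w
    proof -
      have
          "cls (arrow_elem Q \<alpha>) \<odot>\<^bsub>rep_module Q d x\<^esub> vertex_embed Q d (tail Q \<alpha>) w = vertex_embed Q d v (x \<alpha> *\<^sub>v w)"
        using arrow_smult[OF x ec[OF w] a(1)] a by simp
      then have "q (vertex_embed Q d v (x \<alpha> *\<^sub>v w)) = \<zero>\<^bsub>T\<^esub>"
        using q1[OF arrow_elem_radical[OF a(1)] ec[OF w]] by simp
      then show ?thesis unfolding W[symmetric] using arrow_mult_vec[OF xs a(1) w] a(2) by simp
    qed
    moreover have "x \<alpha> *\<^sub>v w = 0\<^sub>v (d (head Q \<alpha>))"
      if a: "\<alpha> \<in> arcs Q" "tail Q \<alpha> = v" and w: "w \<in> frame_span g (e v)" for \<alpha> w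
    proof -
      have wc: "w \<in> carrier_vec (d v)" "q (vertex_embed Q d v w) = \<zero>\<^bsub>T\<^esub>" using w unfolding W[symmetric] by auto
      have
          "cls (arrow_elem Q \<alpha>) \<odot>\<^bsub>rep_module Q d x\<^esub> vertex_embed Q d v w = vertex_embed Q d (head Q \<alpha>) (x \<alpha> *\<^sub>v w)"
        using arrow_smult[OF x ec[OF wc(1)] a(1)] a v by simp
      then have "vertex_embed Q d (head Q \<alpha>) (x \<alpha> *\<^sub>v w) = \<zero>\<^bsub>rep_module Q d x\<^esub>"
        using q2[OF arrow_elem_radical[OF a(1)] ec[OF wc(1)] wc(2)] by simp
      then show ?thesis using vertex_embed_eq_zero_iff[of "head Q \<alpha>" d "x \<alpha> *\<^sub>v w" x] a by simp
    qed
    ultimately show ?thesis using g(1) by blast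
  qed
  then show ?thesis using x by (simp add: degeneration_locus_def)
qed

lemma Rep_top_subset_locus: "Rep_top Q I d T \<subseteq> degeneration_locus Q I d e"
proof
  fix x assume "x \<in> Rep_top Q I d T"
  then have x: "x \<in> Rep Q I d" and top: "module_isomorphic \<Lambda> (top_module \<Lambda> (rep_module Q d x)) T"
    by (auto simp: Rep_top_def)
  note X = left_module_rep[OF x]
  interpret X: left_module \<Lambda> "rep_module Q d x" by (rule X)
  obtain q where q: "module_epi \<Lambda> (rep_module Q d x) T q"
    "\<And>m. m \<in> carrier (rep_module Q d x) \<Longrightarrow> q m = \<zero>\<^bsub>T\<^esub> \<longleftrightarrow> m \<in> radical_submodule \<Lambda> (rep_module Q d x)"
    using top top_isomorphic_iff[OF X T] by blast
  show "x \<in> degeneration_locus Q I d e"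
  proof (rule epi_in_locus[OF x q(1)])
    fix a m assume a: "a \<in> jacobson_radical \<Lambda>" "m \<in> carrier (rep_module Q d x)"
    then have "a \<odot>\<^bsub>rep_module Q d x\<^esub> m \<in> carrier (rep_module Q d x)" using radical_carrier by simp
    then show "q (a \<odot>\<^bsub>rep_module Q d x\<^esub> m) = \<zero>\<^bsub>T\<^esub>" using q(2) radical_smult_in[OF a] by simp
    assume "q m = \<zero>\<^bsub>T\<^esub>"
    then show "a \<odot>\<^bsub>rep_module Q d x\<^esub> m = \<zero>\<^bsub>rep_module Q d x\<^esub>"
      using q(2) a radical_smult_radical_submodule[OF X] by blast
  qed
qed

lemma direct_sum_in_locus:
  assumes x: "x \<in> Rep Q I d" and M: "left_module \<Lambda> M"
    and top: "module_isomorphic \<Lambda> (top_module \<Lambda> M) T" and U: "semisimple_module \<Lambda> U"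
    and iso: "module_isomorphic \<Lambda> (rep_module Q d x) (direct_sum_module M U)"
  shows "x \<in> degeneration_locus Q I d e"
  using direct_sum_top_epi[OF left_module_rep[OF x] M T U top iso] epi_in_locus[OF x] by metis

text \<open>In the coordinates given by \<open>h\<close>, the module \<open>S\<close> omits the
  block from \<open>r v\<close> to \<open>e v\<close>, and its radical is the block below
  \<open>r v\<close>. Its top is therefore described by the coordinates from \<open>e v\<close> on,
  just as for \<open>y\<close> in the frame \<open>g0\<close>. The case \<open>r = e\<close> omits
  nothing and covers a whole representation.\<close>

lemma top_isomorphic_frames:
  assumes x: "x \<in> Rep Q I d"
    and g: "\<And>v. v \<in> verts Q \<Longrightarrow> frame (d v) (g v)"
    and h: "\<And>v. v \<in> verts Q \<Longrightarrow> frame (d v) (h v)"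
    and hg: "\<And>v. v \<in> verts Q \<Longrightarrow> h v * g v = 1\<^sub>m (d v)"
    and gh: "\<And>v. v \<in> verts Q \<Longrightarrow> g v * h v = 1\<^sub>m (d v)"
    and r: "\<And>v. v \<in> verts Q \<Longrightarrow> r v \<le> e v"
    and image: "\<And>\<alpha> w. \<lbrakk>\<alpha> \<in> arcs Q; w \<in> carrier_vec (d (tail Q \<alpha>))\<rbrakk> \<Longrightarrow>
      x \<alpha> *\<^sub>v w \<in> frame_span (g (head Q \<alpha>)) (e (head Q \<alpha>))"
    and S: "\<And>v. v \<in> verts Q \<Longrightarrow>
      S v = {w \<in> carrier_vec (d v). \<forall>i<d v. r v \<le> i \<and> i < e v \<longrightarrow> (h v *\<^sub>v w) $ i = 0}"
    and sub: "submodule (\<Pi>\<^sub>E v\<in>verts Q. S v) \<Lambda> (rep_module Q d x)"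
    and rad: "radical_submodule \<Lambda> (rep_module Q d x\<lparr>carrier := \<Pi>\<^sub>E v\<in>verts Q. S v\<rparr>) =
      (\<Pi>\<^sub>E v\<in>verts Q. frame_span (g v) (r v))"
  shows "module_isomorphic \<Lambda> (top_module \<Lambda> (rep_module Q d x\<lparr>carrier := \<Pi>\<^sub>E v\<in>verts Q. S v\<rparr>)) T"
proof (rule top_isomorphic_family[OF x y T top_y sub])
  show "g0 v * h v \<in> carrier_mat (d v) (d v)" if "v \<in> verts Q" for v
    by (rule frame_carrier[OF frame_mult[OF g0[OF that] h[OF that]]])
  show "vec_subspace (d v) (frame_span (g0 v) (e v))" if "v \<in> verts Q" for v
    by (rule vec_subspace_frame_span[OF frame_carrier[OF g0[OF that]]])
  note iff = transport_frame_span_iff[OF g h hg gh g0]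
  show "m \<in> radical_submodule \<Lambda> (rep_module Q d x\<lparr>carrier := \<Pi>\<^sub>E v\<in>verts Q. S v\<rparr>) \<longleftrightarrow>
      (\<forall>v\<in>verts Q. (g0 v * h v) *\<^sub>v m v \<in> frame_span (g0 v) (e v))"
    if m: "m \<in> (\<Pi>\<^sub>E v\<in>verts Q. S v)" for m
  proof -
    have "m v \<in> frame_span (g v) (r v) \<longleftrightarrow> (g0 v * h v) *\<^sub>v m v \<in> frame_span (g0 v) (e v)"
      if v: "v \<in> verts Q" for v
    proof -
      have mS: "m v \<in> carrier_vec (d v)" "\<forall>i<d v. r v \<le> i \<and> i < e v \<longrightarrow> (h v *\<^sub>v m v) $ i = 0"
        using PiE_mem[OF m v] S[OF v] by auto
      have "m v \<in> frame_span (g v) (r v) \<longleftrightarrow> m v \<in> frame_span (g v) (e v)"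
        unfolding frame_span_iff[OF g[OF v] h[OF v] hg[OF v] gh[OF v]]
        using mS r[OF v] by (metis le_trans not_less)
      then show ?thesis using iff[OF v v v v v mS(1)] by simp
    qed
    then show ?thesis unfolding rad using m by (auto simp: PiE_iff)
  qed
  show "(g0 (head Q \<alpha>) * h (head Q \<alpha>)) *\<^sub>v (x \<alpha> *\<^sub>v w) \<in> frame_span (g0 (head Q \<alpha>)) (e (head Q \<alpha>))"
    if a: "\<alpha> \<in> arcs Q" and w: "w \<in> carrier_vec (d (tail Q \<alpha>))" for \<alpha> w
  proof -
    have v: "head Q \<alpha> \<in> verts Q" using a by simp
    have "x \<alpha> *\<^sub>v w \<in> carrier_vec (d (head Q \<alpha>))" using arrow_mult_vec[of x d, OF _ a w] x
        by (simp add: Rep_iff)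
    then show ?thesis using iff[OF v v v v v] image[OF a w] by simp
  qed
  show "\<exists>w\<in>S v. n - (g0 v * h v) *\<^sub>v w \<in> frame_span (g0 v) (e v)"
    if v: "v \<in> verts Q" and n: "n \<in> carrier_vec (d v)" for v n
  proof -
    obtain h0 where h0: "frame (d v) h0" "h0 * g0 v = 1\<^sub>m (d v)" "g0 v * h0 = 1\<^sub>m (d v)"
      using frame_inverse[OF g0[OF v]] .
    \<comment> \<open>The coordinates in the omitted block are dropped. This changes
      \<open>n\<close> only by a vector in the span of the first \<open>e v\<close> columns of
      \<open>g0 v\<close>, that is, in the radical of \<open>y\<close>.\<close>
    let ?c = "h0 *\<^sub>v n" and ?c' = "vec (d v) (\<lambda>i. if r v \<le> i \<and> i < e v then 0 else (h0 *\<^sub>v n) $ i)"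
    have c: "?c \<in> carrier_vec (d v)" "?c' \<in> carrier_vec (d v)" using h0 n by auto
    let ?w = "g v *\<^sub>v ?c'"
    have w: "?w \<in> carrier_vec (d v)" using g[OF v] by simp
    have hw: "h v *\<^sub>v ?w = ?c'"
      using inverse_mult_vec[OF hg[OF v]] frame_carrier[OF h[OF v]] frame_carrier[OF g[OF v]] c(2) by simp
    have "?w \<in> S v" unfolding S[OF v] using w hw by (simp del: index_mult_mat_vec)
    moreover have "(g0 v * h v) *\<^sub>v ?w = g0 v *\<^sub>v ?c'"
      using assoc_mult_mat_vec[OF frame_carrier[OF g0[OF v]] frame_carrier[OF h[OF v]] w] hw by simp
    moreover have "n = g0 v *\<^sub>v ?c"
      using inverse_mult_vec[OF h0(3) frame_carrier[OF g0[OF v]] frame_carrier[OF h0(1)] n] by simp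
    moreover have "g0 v *\<^sub>v (?c - ?c') \<in> frame_span (g0 v) (e v)"
      using c by (intro frame_span_memI[OF frame_carrier[OF g0[OF v]]]) (auto simp del: index_mult_mat_vec)
    ultimately show ?thesis
      using mult_minus_distrib_mat_vec[OF frame_carrier[OF g0[OF v]] c] by (metis (no_types, lifting))
  qed
qed (rule radical_y)

text \<open>At each vertex a frame is adapted to the radical inside W_v: indices below
  \<open>r v\<close> span the radical, those below \<open>e v\<close> span W_v. \<open>U\<close>
  takes the block in between and \<open>M\<close> all other coordinates. \<open>M\<close> contains
  the radical and so is stable under arrows; \<open>U\<close> lies in W_v and is killed by
  them.\<close>

lemma locus_direct_sum:
  assumes x: "x \<in> degeneration_locus Q I d e"
  shows "\<exists>(M :: ((('v, 'e) path \<Rightarrow> 'k) set, 'v \<Rightarrow> 'k vec) module)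
    (U :: ((('v, 'e) path \<Rightarrow> 'k) set, 'v \<Rightarrow> 'k vec) module).
      left_module \<Lambda> M \<and> module_isomorphic \<Lambda> (top_module \<Lambda> M) T \<and> semisimple_module \<Lambda> U \<and>
      module_isomorphic \<Lambda> (rep_module Q d x) (direct_sum_module M U)"
proof -
  have xR: "x \<in> Rep Q I d" using x by (simp add: degeneration_locus_def)
  then have xs: "x \<in> rep_space Q d" by (simp add: Rep_iff)
  let ?N = "rep_module Q d x"
  interpret N: left_module \<Lambda> ?N by (rule left_module_rep[OF xR])
  let ?rad = "radical_submodule \<Lambda> ?N"
  have radN: "submodule ?rad \<Lambda> ?N" by (rule submodule_radical[OF N.left_module_axioms])
  let ?R = "\<lambda>v. {w \<in> carrier_vec (d v). vertex_embed Q d v w \<in> ?rad}"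
  obtain G where G: "\<And>v. v \<in> verts Q \<Longrightarrow> frame (d v) (G v)"
    and G1:
        "\<And>\<alpha> w. \<alpha> \<in> arcs Q \<Longrightarrow> w \<in> carrier_vec (d (tail Q \<alpha>)) \<Longrightarrow> x \<alpha> *\<^sub>v w \<in> frame_span (G (head Q \<alpha>)) (e (head Q \<alpha>))"
    and G2: "\<And>\<alpha> w. \<alpha> \<in> arcs Q \<Longrightarrow> w \<in> frame_span (G (tail Q \<alpha>)) (e (tail Q \<alpha>)) \<Longrightarrow> x \<alpha> *\<^sub>v w = 0\<^sub>v (d (head Q \<alpha>))"
    by (rule degeneration_locusE[OF x]) blast
  have W: "vec_subspace (d v) (frame_span (G v) (e v))" if "v \<in> verts Q" for v
    by (rule vec_subspace_frame_span[OF frame_carrier[OF G[OF that]]])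
  have rad_le: "?rad \<subseteq> (\<Pi>\<^sub>E v\<in>verts Q. frame_span (G v) (e v))"
    by (rule radical_subset_family[OF xR W G1])
  have R_le: "?R v \<subseteq> frame_span (G v) (e v)" if v: "v \<in> verts Q" for v
  proof
    fix w assume "w \<in> ?R v"
    then have "vertex_embed Q d v w \<in> (\<Pi>\<^sub>E v\<in>verts Q. frame_span (G v) (e v))" using rad_le by blast
    from PiE_mem[OF this v] show "w \<in> frame_span (G v) (e v)" using v by simp
  qed
  have "\<exists>g h r. frame (d v) g \<and> frame (d v) h \<and> h * g = 1\<^sub>m (d v) \<and> g * h = 1\<^sub>m (d v) \<and> r \<le> e v \<and>
      ?R v = frame_span g r \<and> frame_span (G v) (e v) = frame_span g (e v)" if v: "v \<in> verts Q" for v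
  proof -
    obtain g1 r where g1: "frame (d v) g1" "r \<le> d v" "?R v = frame_span g1 r"
      using subspace_frame[OF submodule_component_subspace[OF xR radN v]] .
    have "frame_span g1 r \<subseteq> frame_span (G v) (e v)" using R_le[OF v] g1(3) by simp
    from subspace_frame_extend[OF g1(1,2) W[OF v] this]
    obtain g s where g: "frame (d v) g" "r \<le> s" "s \<le> d v" "frame_span g r = frame_span g1 r"
      "frame_span (G v) (e v) = frame_span g s" by metis
    have "e v = s" by (rule frame_span_eq_dim[OF G[OF v] g(1) e_le[OF v] g(3,5)])
    moreover obtain h where "frame (d v) h" "h * g = 1\<^sub>m (d v)" "g * h = 1\<^sub>m (d v)"
        using frame_inverse[OF g(1)] .
    ultimately show ?thesis using g g1 by blast
  qed
  then have "\<forall>v. \<exists>g h r. v \<in> verts Q \<longrightarrow> frame (d v) g \<and> frame (d v) h \<and> h * g = 1\<^sub>m (d v) \<and> g * h = 1\<^sub>m (d v) \<and>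
      r \<le> e v \<and> ?R v = frame_span g r \<and> frame_span (G v) (e v) = frame_span g (e v)" by blast
  then obtain g h r where "\<forall>v. v \<in> verts Q \<longrightarrow> frame (d v) (g v) \<and> frame (d v) (h v) \<and> h v * g v = 1\<^sub>m (d v) \<and>
      g v * h v = 1\<^sub>m (d v) \<and> r v \<le> e v \<and> ?R v = frame_span (g v) (r v) \<and>
      frame_span (G v) (e v) = frame_span (g v) (e v)" unfolding choice_iff by blast
  then have g: "\<And>v. v \<in> verts Q \<Longrightarrow> frame (d v) (g v)" and h: "\<And>v. v \<in> verts Q \<Longrightarrow> frame (d v) (h v)"
    and hg: "\<And>v. v \<in> verts Q \<Longrightarrow> h v * g v = 1\<^sub>m (d v)" and gh: "\<And>v. v \<in> verts Q \<Longrightarrow> g v * h v = 1\<^sub>m (d v)"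
    and r: "\<And>v. v \<in> verts Q \<Longrightarrow> r v \<le> e v" and R: "\<And>v. v \<in> verts Q \<Longrightarrow> ?R v = frame_span (g v) (r v)"
    and gG: "\<And>v. v \<in> verts Q \<Longrightarrow> frame_span (G v) (e v) = frame_span (g v) (e v)" by blast+
  note fs = frame_span_iff[OF g h hg gh]
  define M where "M v = {w \<in> carrier_vec (d v). \<forall>i<d v. r v \<le> i \<and> i < e v \<longrightarrow> (h v *\<^sub>v w) $ i = 0}" for v
  define U where "U v = {w \<in> carrier_vec (d v). \<forall>i<d v. \<not> (r v \<le> i \<and> i < e v) \<longrightarrow> (h v *\<^sub>v w) $ i = 0}" for v
  have Ms: "vec_subspace (d v) (M v)" and Us: "vec_subspace (d v) (U v)" if "v \<in> verts Q" for v
    unfolding M_def U_def by (rule coordinate_subspace[OF frame_carrier[OF h[OF that]]])+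
  have R_M: "frame_span (g v) (r v) \<subseteq> M v" if v: "v \<in> verts Q" for v
    unfolding M_def using fs[OF v v v v] by blast
  have xR': "x \<alpha> *\<^sub>v w \<in> frame_span (g (head Q \<alpha>)) (r (head Q \<alpha>))"
    if a: "\<alpha> \<in> arcs Q" "w \<in> carrier_vec (d (tail Q \<alpha>))" for \<alpha> w
  proof -
    have v: "head Q \<alpha> \<in> verts Q" using a by simp
    show ?thesis unfolding R[OF v, symmetric]
      using radical_component_arrow[OF xR a] arrow_mult_vec[OF xs a] by simp
  qed
  have xU: "x \<alpha> *\<^sub>v w = 0\<^sub>v (d (head Q \<alpha>))" if a: "\<alpha> \<in> arcs Q" and w: "w \<in> U (tail Q \<alpha>)" for \<alpha> w
  proof -
    have v: "tail Q \<alpha> \<in> verts Q" using a by simp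
    have "w \<in> frame_span (g (tail Q \<alpha>)) (e (tail Q \<alpha>))"
      unfolding fs[OF v v v v] using w unfolding U_def by (auto simp del: index_mult_mat_vec)
    then show ?thesis using G2[OF a] gG[OF v] by simp
  qed
  let ?MS = "\<Pi>\<^sub>E v\<in>verts Q. M v" and ?US = "\<Pi>\<^sub>E v\<in>verts Q. U v"
  let ?M = "?N\<lparr>carrier := ?MS\<rparr>" and ?U = "?N\<lparr>carrier := ?US\<rparr>"
  have subM: "submodule ?MS \<Lambda> ?N"
  proof (rule family_submodule[OF xR Ms])
    fix \<alpha> w assume a: "\<alpha> \<in> arcs Q" "w \<in> M (tail Q \<alpha>)"
    then have "w \<in> carrier_vec (d (tail Q \<alpha>))" by (simp add: M_def)
    then show "x \<alpha> *\<^sub>v w \<in> M (head Q \<alpha>)" using xR'[OF a(1)] R_M[of "head Q \<alpha>"] a(1) by auto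
  qed
  have subU: "submodule ?US \<Lambda> ?N"
  proof (rule family_submodule[OF xR Us])
    fix \<alpha> w assume a: "\<alpha> \<in> arcs Q" "w \<in> U (tail Q \<alpha>)"
    have "0\<^sub>v (d (head Q \<alpha>)) \<in> U (head Q \<alpha>)" using Us[of "head Q \<alpha>"] a by (simp add: vec_subspace_def)
    then show "x \<alpha> *\<^sub>v w \<in> U (head Q \<alpha>)" using xU[OF a] by simp
  qed
  have ssU: "semisimple_module \<Lambda> ?U" by (rule semisimple_family[OF xR Us xU])
  note MD = N.left_submoduleD[OF subM] and UD = N.left_submoduleD[OF subU] and RD = N.left_submoduleD[OF radN]
  interpret M: left_module \<Lambda> ?M by (rule N.submodule_carrier_update[OF subM])
  have sum: "\<exists>a\<in>?MS. \<exists>b\<in>?US. m = a \<oplus>\<^bsub>?N\<^esub> b" if m: "m \<in> carrier ?N" for m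
  proof -
    have "\<exists>a b. a \<in> M v \<and> b \<in> U v \<and> m v = a + b" if v: "v \<in> verts Q" for v
      using coordinate_split[OF g[OF v] h[OF v] hg[OF v] gh[OF v] rep_module_component[OF m v], of
          "\<lambda>i. r v \<le> i \<and> i < e v"]
      unfolding M_def U_def by blast
    then have "\<forall>v. \<exists>a b. v \<in> verts Q \<longrightarrow> a \<in> M v \<and> b \<in> U v \<and> m v = a + b" by blast
    then obtain a b where ab: "\<And>v. v \<in> verts Q \<Longrightarrow> a v \<in> M v \<and> b v \<in> U v \<and> m v = a v + b v"
      unfolding choice_iff by blast
    have aM: "restrict a (verts Q) \<in> ?MS" and bU: "restrict b (verts Q) \<in> ?US"
      unfolding restrict_PiE_iff using ab by blast+
    have "m = restrict a (verts Q) \<oplus>\<^bsub>?N\<^esub> restrict b (verts Q)"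
    proof (rule PiE_ext[where k = "verts Q"])
      show "m \<in> (\<Pi>\<^sub>E v\<in>verts Q. carrier_vec (d v))" using m by (simp only: carrier_rep_module)
      show "restrict a (verts Q) \<oplus>\<^bsub>?N\<^esub> restrict b (verts Q) \<in> (\<Pi>\<^sub>E v\<in>verts Q. carrier_vec (d v))"
        using N.a_closed[OF subsetD[OF MD(1) aM] subsetD[OF UD(1) bU]] by (simp only: carrier_rep_module)
    qed (use ab in \<open>simp add: add_rep_module\<close>)
    then show ?thesis using aM bU by blast
  qed
  have disj: "?MS \<inter> ?US \<subseteq> {\<zero>\<^bsub>?N\<^esub>}"
  proof
    fix m assume m: "m \<in> ?MS \<inter> ?US"
    then have mN: "m \<in> carrier ?N" using MD(1) by blast
    have "m v = 0\<^sub>v (d v)" if v: "v \<in> verts Q" for v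
    proof -
      note hv = frame_carrier[OF h[OF v]]
      have "m v \<in> M v" "m v \<in> U v" using m v by (auto simp: PiE_iff)
      then have mv: "m v \<in> carrier_vec (d v)" "\<And>i. i < d v \<Longrightarrow> (h v *\<^sub>v m v) $ i = 0"
        unfolding M_def U_def by (auto simp del: index_mult_mat_vec)
      then have "h v *\<^sub>v m v = 0\<^sub>v (d v)" using hv by (intro eq_vecI) (auto simp del: index_mult_mat_vec)
      then show ?thesis using frame_mult_eq_0[OF h[OF v] mv(1)] by simp
    qed
    then have "m = \<zero>\<^bsub>?N\<^esub>" by (intro rep_module_eqI[OF mN N.zero_closed]) (simp add: zero_rep_module)
    then show "m \<in> {\<zero>\<^bsub>?N\<^esub>}" by simp
  qed
  have rad_eq: "?rad = (\<Pi>\<^sub>E v\<in>verts Q. frame_span (g v) (r v))"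
    by (subst radical_family[OF xR]) (intro PiE_cong R)
  have rad_M: "?rad \<subseteq> ?MS" unfolding rad_eq by (intro PiE_mono R_M)
  \<comment> \<open>Since J kills the summand \<open>U\<close>, the radical of the whole module is
    already produced by \<open>M\<close>.\<close>
  have radM: "radical_submodule \<Lambda> ?M = ?rad"
  proof
    show "radical_submodule \<Lambda> ?M \<subseteq> ?rad"
    proof (rule radical_submodule_least[OF M.left_module_axioms])
      show "submodule ?rad \<Lambda> ?M" using RD(2-4) rad_M by (intro M.left_submoduleI) auto
      fix a m assume "a \<in> jacobson_radical \<Lambda>" "m \<in> carrier ?M"
      then show "a \<odot>\<^bsub>?M\<^esub> m \<in> ?rad" using radical_smult_in[of a m ?N] MD(1) by auto
    qed
    show "?rad \<subseteq> radical_submodule \<Lambda> ?M"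
    proof (rule radical_submodule_least[OF N.left_module_axioms])
      show "submodule (radical_submodule \<Lambda> ?M) \<Lambda> ?N"
        by (rule N.submodule_trans[OF subM submodule_radical[OF M.left_module_axioms]])
      fix a n assume a: "a \<in> jacobson_radical \<Lambda>" and "n \<in> carrier ?N"
      then obtain m u where mu: "m \<in> ?MS" "u \<in> ?US" "n = m \<oplus>\<^bsub>?N\<^esub> u" using sum by blast
      have c: "m \<in> carrier ?N" "u \<in> carrier ?N" using mu MD(1) UD(1) by blast+
      have ac: "a \<in> carrier \<Lambda>" by (rule radical_carrier[OF a])
      have "a \<odot>\<^bsub>?N\<^esub> u = \<zero>\<^bsub>?N\<^esub>" using radical_smult_semisimple[OF ssU a, of u] mu(2) by simp
      then have "a \<odot>\<^bsub>?N\<^esub> n = a \<odot>\<^bsub>?M\<^esub> m" using ac c mu(3) N.smult_r_distr by simp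
      then show "a \<odot>\<^bsub>?N\<^esub> n \<in> radical_submodule \<Lambda> ?M" using radical_smult_in[OF a, of m ?M] mu(1) by simp
    qed
  qed
  have top: "module_isomorphic \<Lambda> (top_module \<Lambda> ?M) T"
  proof (rule top_isomorphic_frames[where S = M, OF xR g h hg gh r _ M_def subM trans[OF radM rad_eq]])
    fix \<alpha> and w :: "'k vec" assume a: "\<alpha> \<in> arcs Q" "w \<in> carrier_vec (d (tail Q \<alpha>))"
    then have v: "head Q \<alpha> \<in> verts Q" by simp
    show "x \<alpha> *\<^sub>v w \<in> frame_span (g (head Q \<alpha>)) (e (head Q \<alpha>))" using G1[OF a] gG[OF v] by simp
  qed
  show ?thesis
    using M.left_module_axioms top ssU N.isomorphic_internal_direct_sum[OF subM subU sum disj] by blast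
qed

end

section \<open>The Zariski closure\<close>

text \<open>The polynomial \<open>q + 1\<close> takes only the value 1, so it has no root and must
  be constant.\<close>

lemma alg_closed_poly_zero:
  fixes q :: "'k::alg_closed_field poly"
  assumes "\<And>c. poly q c = 0"
  shows "q = 0"
proof -
  have "degree (q + 1) = 0"
  proof (rule ccontr)
    assume "degree (q + 1) \<noteq> 0"
    then obtain c where "poly (q + 1) c = 0" using alg_closed_imp_poly_has_root[of "q + 1"] by auto
    then show False using assms[of c] by simp
  qed
  then obtain a where "q + 1 = [:a:]" by (rule degree_eq_zeroE)
  then have "q = [:a - 1:]" by (metis add_diff_cancel_right' diff_pCons one_pCons diff_zero)
  then show ?thesis using assms[of 0] by simp
qed

section \<open>Polynomial functions and closures\<close>

lemma rep_polys_sum: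
  assumes "finite A" "\<And>a. a \<in> A \<Longrightarrow> f a \<in> rep_polys Q d"
  shows "(\<lambda>x. \<Sum>a\<in>A. f a x) \<in> rep_polys Q d"
  using assms by (induction rule: finite_induct) (auto intro: rep_polys.intros)

lemma rep_polys_prod:
  assumes "finite A" "\<And>a. a \<in> A \<Longrightarrow> f a \<in> rep_polys Q d"
  shows "(\<lambda>x. \<Prod>a\<in>A. f a x) \<in> rep_polys Q d"
  using assms by (induction rule: finite_induct) (auto intro: rep_polys.intros)

lemma rep_polys_det:
  assumes "\<And>i j. \<lbrakk>i < n; j < n\<rbrakk> \<Longrightarrow> F i j \<in> rep_polys Q d"
  shows "(\<lambda>x. det (mat n n (\<lambda>(i, j). F i j x))) \<in> rep_polys Q d"
proof -
  have "(\<lambda>x. det (mat n n (\<lambda>(i, j). F i j x))) =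
    (\<lambda>x. \<Sum>p | p permutes {0..<n}. signof p * (\<Prod>i = 0..<n. F i (p i) x))"
  proof
    fix x
    have "(\<Prod>i = 0..<n. mat n n (\<lambda>(i, j). F i j x) $$ (i, p i)) = (\<Prod>i = 0..<n. F i (p i) x)"
      if "p permutes {0..<n}" for p
      using permutes_in_image[OF that] by (intro prod.cong) auto
    then show "det (mat n n (\<lambda>(i, j). F i j x)) =
        (\<Sum>p | p permutes {0..<n}. signof p * (\<Prod>i = 0..<n. F i (p i) x))"
      by (subst det_def'[of _ n]) auto
  qed
  also have "\<dots> \<in> rep_polys Q d"
  proof (intro rep_polys_sum)
    fix p assume "p \<in> {p. p permutes {0..<n}}"
    then have "\<And>i. i < n \<Longrightarrow> p i < n" using permutes_in_image by fastforce
    then show "(\<lambda>x. signof p * (\<Prod>i = 0..<n. F i (p i) x)) \<in> rep_polys Q d"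
      using assms by (intro rep_polys.mult rep_polys.const rep_polys_prod) auto
  qed (simp add: finite_permutations)
  finally show ?thesis .
qed

text \<open>\<open>P\<close> consists of vector valued functions of the point, so the
  \<open>m + 1\<close> members selected at \<open>x\<close> can be followed to every
  \<open>z\<close> in \<open>X\<close>. With the remaining columns frozen, the determinant is a
  polynomial function that vanishes on \<open>X\<close> and hence at \<open>x\<close>.\<close>

lemma rank_le_closed:
  assumes poly: "\<And>q i. \<lbrakk>q \<in> P; i < n\<rbrakk> \<Longrightarrow> (\<lambda>x. q x $ i) \<in> rep_polys Q d"
    and dim: "\<And>q z. q \<in> P \<Longrightarrow> q z \<in> carrier_vec n"
    and X: "\<And>z. z \<in> X \<Longrightarrow> rank_le n m ((\<lambda>q. q z) ` P)"
    and x: "\<And>f. \<lbrakk>f \<in> rep_polys Q d; \<And>z. z \<in> X \<Longrightarrow> f z = 0\<rbrakk> \<Longrightarrow> f x = 0"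
  shows "rank_le n m ((\<lambda>q. q x) ` P)"
  unfolding rank_le_def
proof (intro impI ballI)
  fix g :: "'b mat" assume mn: "m < n" and g: "g \<in> carrier_mat n n" and cols: "\<forall>i\<le>m. col g i \<in> (\<lambda>q. q x) ` P"
  then have "\<forall>i. \<exists>q. i \<le> m \<longrightarrow> q \<in> P \<and> col g i = q x" by blast
  then obtain q where q: "\<And>i. i \<le> m \<Longrightarrow> q i \<in> P" "\<And>i. i \<le> m \<Longrightarrow> col g i = q i x" unfolding choice_iff by blast
  let ?A = "\<lambda>z. mat n n (\<lambda>(i, j). (if j \<le> m then \<lambda>z. q j z $ i else (\<lambda>_. g $$ (i, j))) z)"
  have f: "(\<lambda>z. det (?A z)) \<in> rep_polys Q d"
    using q poly by (intro rep_polys_det) (auto intro: rep_polys.const)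
  have "det (?A z) = 0" if "z \<in> X" for z
  proof -
    have "col (?A z) i \<in> (\<lambda>q. q z) ` P" if i: "i \<le> m" for i
    proof -
      have "col (?A z) i = q i z" using i mn carrier_vecD[OF dim[OF q(1)[OF i]]] by (intro eq_vecI) auto
      then show ?thesis using q(1)[OF i] by blast
    qed
    then show ?thesis using X[OF that] mn unfolding rank_le_def by (simp del: det_dim_zero)
  qed
  then have "det (?A x) = 0" using x[OF f] by blast
  moreover have "?A x = g"
  proof (rule eq_matI)
    fix i j assume ij: "i < dim_row g" "j < dim_col g"
    then have n: "i < n" "j < n" using g by auto
    show "?A x $$ (i, j) = g $$ (i, j)"
    proof (cases "j \<le> m")
      case True
      have "g $$ (i, j) = col g j $ i" using ij by simp
      then show ?thesis using True q(2)[OF True] n by simp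
    qed (use n in simp)
  qed (use g in auto)
  ultimately show "det g = 0" by simp
qed

lemma topspace_zariski: "topspace (zariski_topology Q d) = rep_space Q d"
proof (rule antisym)
  show "topspace (zariski_topology Q d) \<subseteq> rep_space Q d"
    unfolding topspace_def openin_zariski_topology by blast
  have "rep_space Q d = rep_space Q d - zero_locus Q d {\<lambda>_. 1}" by (auto simp: zero_locus_def)
  then have "openin (zariski_topology Q d) (rep_space Q d)"
    unfolding openin_zariski_topology by (intro exI[of _ "{\<lambda>_. 1}"]) (auto intro: rep_polys.const)
  then show "rep_space Q d \<subseteq> topspace (zariski_topology Q d)" by (rule openin_subset)
qed

text \<open>A neighbourhood of \<open>x\<close> can be shrunk to the points where one polynomial is
  nonzero, so the closure is cut out by the polynomials that vanish on \<open>X\<close>.\<close>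

lemma Rep_closure_iff:
  assumes X: "X \<subseteq> Rep Q I d"
  shows "x \<in> Rep_topology Q I d closure_of X \<longleftrightarrow>
    x \<in> Rep Q I d \<and> (\<forall>f\<in>rep_polys Q d. (\<forall>z\<in>X. f z = 0) \<longrightarrow> f x = 0)"
proof
  have sub: "Rep Q I d \<subseteq> rep_space Q d" by (auto simp: Rep_def)
  then have top: "topspace (Rep_topology Q I d) = Rep Q I d"
    unfolding Rep_topology_def topspace_subtopology topspace_zariski by blast
  have op: "openin (Rep_topology Q I d) T \<longleftrightarrow>
    (\<exists>F\<subseteq>rep_polys Q d. T = (rep_space Q d - zero_locus Q d F) \<inter> Rep Q I d)" for T
    unfolding Rep_topology_def openin_subtopology openin_zariski_topology by blast
  {
    assume cl: "x \<in> Rep_topology Q I d closure_of X"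
    then have x: "x \<in> Rep Q I d" using top by (simp add: in_closure_of)
    have "f x = 0" if f: "f \<in> rep_polys Q d" "\<forall>z\<in>X. f z = 0" for f
    proof (rule ccontr)
      assume fx: "f x \<noteq> 0"
      let ?T = "(rep_space Q d - zero_locus Q d {f}) \<inter> Rep Q I d"
      have "openin (Rep_topology Q I d) ?T" unfolding op using f(1) by blast
      moreover have "x \<in> ?T" using x sub fx by (auto simp: zero_locus_def)
      ultimately obtain z where "z \<in> X" "z \<in> ?T"
        using cl[unfolded in_closure_of, THEN conjunct2, THEN spec, of ?T] by blast
      then show False using f(2) by (auto simp: zero_locus_def)
    qed
    with x show "x \<in> Rep Q I d \<and> (\<forall>f\<in>rep_polys Q d. (\<forall>z\<in>X. f z = 0) \<longrightarrow> f x = 0)" by blast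
  }
  assume x: "x \<in> Rep Q I d \<and> (\<forall>f\<in>rep_polys Q d. (\<forall>z\<in>X. f z = 0) \<longrightarrow> f x = 0)"
  have "\<exists>z. z \<in> X \<and> z \<in> T" if T: "x \<in> T" "openin (Rep_topology Q I d) T" for T
  proof -
    obtain F where F: "F \<subseteq> rep_polys Q d" "T = (rep_space Q d - zero_locus Q d F) \<inter> Rep Q I d"
      using T(2) op by blast
    then obtain f where f: "f \<in> F" "f x \<noteq> 0" using T(1) by (auto simp: zero_locus_def)
    then obtain z where "z \<in> X" "f z \<noteq> 0" using x F(1) by blast
    then have "z \<in> T" unfolding F(2) using X sub f(1) by (auto simp: zero_locus_def)
    then show ?thesis using \<open>z \<in> X\<close> by blast
  qed
  with x show "x \<in> Rep_topology Q I d closure_of X" unfolding in_closure_of top by simp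
qed

text \<open>Along a curve with polynomial coordinates, polynomial functions become polynomials in
  one variable; the curve will be a line.\<close>

lemma rep_polys_curve:
  assumes coord: "\<And>\<alpha> i j. \<lbrakk>\<alpha> \<in> arcs Q; i < d (head Q \<alpha>); j < d (tail Q \<alpha>)\<rbrakk> \<Longrightarrow>
      \<exists>q. \<forall>c. L c \<alpha> $$ (i, j) = poly q c"
    and f: "f \<in> rep_polys Q d"
  shows "\<exists>q. \<forall>c. f (L c) = poly q c"
  using f
proof induction
  case (const c)
  show ?case by (intro exI[of _ "[:c:]"]) simp
next
  case (coord \<alpha> i j)
  then show ?case by (rule assms(1))
next
  case (add f g)
  then obtain p q where "\<And>c. f (L c) = poly p c" "\<And>c. g (L c) = poly q c" by blast
  then show ?case by (intro exI[of _ "p + q"]) simp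
next
  case (mult f g)
  then obtain p q where "\<And>c. f (L c) = poly p c" "\<And>c. g (L c) = poly q c" by blast
  then show ?case by (intro exI[of _ "p * q"]) simp
qed

section \<open>Rank conditions at limit points\<close>

context realized_top
begin

text \<open>Columns are kept as functions of the point, so that a selection made at one point can be
  evaluated at another.\<close>

definition in_columns :: "'v \<Rightarrow> (('e \<Rightarrow> 'k mat) \<Rightarrow> 'k vec) set" where
  "in_columns v = {\<lambda>x. vec (d v) (\<lambda>i. x \<alpha> $$ (i, j)) | \<alpha> j. \<alpha> \<in> arcs Q \<and> head Q \<alpha> = v \<and> j < d (tail Q \<alpha>)}"

definition out_rows :: "'v \<Rightarrow> (('e \<Rightarrow> 'k mat) \<Rightarrow> 'k vec) set" where
  "out_rows v = {\<lambda>x. vec (d v) (\<lambda>j. x \<alpha> $$ (i, j)) | \<alpha> i. \<alpha> \<in> arcs Q \<and> tail Q \<alpha> = v \<and> i < d (head Q \<alpha>)}"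

lemma in_columns_at:
  assumes "z \<in> rep_space Q d"
  shows "(\<lambda>q. q z) ` in_columns v = {col (z \<alpha>) j | \<alpha> j. \<alpha> \<in> arcs Q \<and> head Q \<alpha> = v \<and> j < d (tail Q \<alpha>)}"
proof -
  have "vec (d v) (\<lambda>i. z \<alpha> $$ (i, j)) = col (z \<alpha>) j" if "\<alpha> \<in> arcs Q" "head Q \<alpha> = v" "j < d (tail Q \<alpha>)" for \<alpha> j
    using rep_space_mat[OF assms that(1)] that by (intro eq_vecI) auto
  then show ?thesis unfolding in_columns_def by (auto simp: image_iff) metis+
qed

lemma out_rows_at:
  assumes "z \<in> rep_space Q d"
  shows "(\<lambda>q. q z) ` out_rows v = {row (z \<alpha>) i | \<alpha> i. \<alpha> \<in> arcs Q \<and> tail Q \<alpha> = v \<and> i < d (head Q \<alpha>)}"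
proof -
  have "vec (d v) (\<lambda>j. z \<alpha> $$ (i, j)) = row (z \<alpha>) i" if "\<alpha> \<in> arcs Q" "tail Q \<alpha> = v" "i < d (head Q \<alpha>)" for \<alpha> i
    using rep_space_mat[OF assms that(1)] that by (intro eq_vecI) auto
  then show ?thesis unfolding out_rows_def by (auto simp: image_iff) metis+
qed

lemma columns_rows_carrier:
  "q \<in> in_columns v \<Longrightarrow> q z \<in> carrier_vec (d v)" "q \<in> out_rows v \<Longrightarrow> q z \<in> carrier_vec (d v)"
  by (auto simp: in_columns_def out_rows_def)

lemma columns_rows_polys:
  "q \<in> in_columns v \<Longrightarrow> i < d v \<Longrightarrow> (\<lambda>x. q x $ i) \<in> rep_polys Q d"
  "q \<in> out_rows v \<Longrightarrow> i < d v \<Longrightarrow> (\<lambda>x. q x $ i) \<in> rep_polys Q d"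
  by (auto simp: in_columns_def out_rows_def intro: rep_polys.coord)

text \<open>Links the rank of the outgoing rows with the common kernel S_v: an upper bound for the
  former is a lower bound for the dimension of the latter.\<close>

lemma annihilator_out_rows:
  assumes z: "z \<in> rep_space Q d"
  shows "w \<in> annihilator (d v) ((\<lambda>q. q z) ` out_rows v) \<longleftrightarrow> w \<in> carrier_vec (d v) \<and>
    (\<forall>\<alpha>\<in>arcs Q. tail Q \<alpha> = v \<longrightarrow> z \<alpha> *\<^sub>v w = 0\<^sub>v (d (head Q \<alpha>)))"
proof -
  have "z \<alpha> *\<^sub>v w = 0\<^sub>v (d (head Q \<alpha>)) \<longleftrightarrow> (\<forall>i<d (head Q \<alpha>). row (z \<alpha>) i \<bullet> w = 0)"
    if "\<alpha> \<in> arcs Q" for \<alpha>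
  proof -
    have d: "dim_row (z \<alpha>) = d (head Q \<alpha>)" using rep_space_mat[OF z that] by simp
    show ?thesis
    proof
      assume eq: "z \<alpha> *\<^sub>v w = 0\<^sub>v (d (head Q \<alpha>))"
      show "\<forall>i<d (head Q \<alpha>). row (z \<alpha>) i \<bullet> w = 0"
      proof (intro allI impI)
        fix i assume i: "i < d (head Q \<alpha>)"
        then have "(z \<alpha> *\<^sub>v w) $ i = row (z \<alpha>) i \<bullet> w" using d by simp
        then show "row (z \<alpha>) i \<bullet> w = 0" using eq i by simp
      qed
    qed (use d in \<open>auto intro!: eq_vecI\<close>)
  qed
  then show ?thesis unfolding annihilator_def out_rows_at[OF z] by auto
qed

text \<open>At points with top \<open>T\<close> the incoming columns at \<open>v\<close> have rank
  at most \<open>e v\<close> and the outgoing rows rank at most \<open>d v - e v\<close>; both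
  bounds pass to the closure. The spaces W_v vary with the point, so they are rebuilt at
  \<open>x\<close> from these bounds by \<open>intermediate_frame\<close>.\<close>

lemma closure_subset_locus:
  assumes x: "x \<in> Rep_topology Q I d closure_of Rep_top Q I d T"
  shows "x \<in> degeneration_locus Q I d e"
proof -
  have "Rep_top Q I d T \<subseteq> Rep Q I d" by (auto simp: Rep_top_def)
  from Rep_closure_iff[OF this] x have xR: "x \<in> Rep Q I d"
    and cl: "\<And>f. f \<in> rep_polys Q d \<Longrightarrow> (\<And>z. z \<in> Rep_top Q I d T \<Longrightarrow> f z = 0) \<Longrightarrow> f x = 0" by blast+
  have xs: "x \<in> rep_space Q d" "zero_composites Q d x" using xR by (auto simp: Rep_iff)
  have "\<exists>g. frame (d v) g \<and>
     (\<forall>\<alpha>\<in>arcs Q. head Q \<alpha> = v \<longrightarrow> (\<forall>w\<in>carrier_vec (d (tail Q \<alpha>)). x \<alpha> *\<^sub>v w \<in> frame_span g (e v))) \<and>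
     (\<forall>\<alpha>\<in>arcs Q. tail Q \<alpha> = v \<longrightarrow> (\<forall>w\<in>frame_span g (e v). x \<alpha> *\<^sub>v w = 0\<^sub>v (d (head Q \<alpha>))))"
    if v: "v \<in> verts Q" for v
  proof -
    let ?C = "\<lambda>z. (\<lambda>q. q z) ` in_columns v" and ?R = "\<lambda>z. (\<lambda>q. q z) ` out_rows v"
    have "rank_le (d v) (e v) (?C z) \<and> rank_le (d v) (d v - e v) (?R z)" if "z \<in> Rep_top Q I d T" for z
    proof -
      have zl: "z \<in> degeneration_locus Q I d e" using Rep_top_subset_locus that by blast
      then have zs: "z \<in> rep_space Q d" by (simp add: degeneration_locus_def Rep_iff)
      obtain g where g: "frame (d v) g"
        "\<forall>\<alpha>\<in>arcs Q. head Q \<alpha> = v \<longrightarrow> (\<forall>w\<in>carrier_vec (d (tail Q \<alpha>)). z \<alpha> *\<^sub>v w \<in> frame_span g (e v))"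
        "\<forall>\<alpha>\<in>arcs Q. tail Q \<alpha> = v \<longrightarrow> (\<forall>w\<in>frame_span g (e v). z \<alpha> *\<^sub>v w = 0\<^sub>v (d (head Q \<alpha>)))"
        using zl v unfolding degeneration_locus_def by blast
      have "?C z \<subseteq> frame_span g (e v)"
      proof
        fix u assume "u \<in> ?C z"
        then obtain \<alpha> j where a: "u = col (z \<alpha>) j" "\<alpha> \<in> arcs Q" "head Q \<alpha> = v" "j < d (tail Q \<alpha>)"
          unfolding in_columns_at[OF zs] by blast
        have "z \<alpha> *\<^sub>v unit_vec (d (tail Q \<alpha>)) j \<in> frame_span g (e v)" using g(2) a by simp
        then show "u \<in> frame_span g (e v)"
            using mult_mat_unit_vec[OF rep_space_mat[OF zs a(2)] a(4)] a(1) by simp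
      qed
      moreover have "frame_span g (e v) \<subseteq> annihilator (d v) (?R z)"
      proof
        fix w assume w: "w \<in> frame_span g (e v)"
        have "w \<in> carrier_vec (d v)"
          by (rule vec_subspace_carrier[OF vec_subspace_frame_span[OF frame_carrier[OF g(1)]] w])
        then show "w \<in> annihilator (d v) (?R z)" unfolding annihilator_out_rows[OF zs] using g(3) w by blast
      qed
      ultimately show ?thesis
        using rank_le_frame_span[OF g(1)] rank_le_annihilator[OF g(1) e_le[OF v]] by blast
    qed
    note rank_z = this
    have "rank_le (d v) (e v) (?C x)"
    proof (rule rank_le_closed[where X = "Rep_top Q I d T" and Q = Q and d = d])
      show "rank_le (d v) (e v) (?C z)" if "z \<in> Rep_top Q I d T" for z using rank_z[OF that] ..
    qed (fact columns_rows_polys(1) columns_rows_carrier(1) cl)+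
    moreover have "rank_le (d v) (d v - e v) (?R x)"
    proof (rule rank_le_closed[where X = "Rep_top Q I d T" and Q = Q and d = d])
      show "rank_le (d v) (d v - e v) (?R z)" if "z \<in> Rep_top Q I d T" for z using rank_z[OF that] ..
    qed (fact columns_rows_polys(2) columns_rows_carrier(2) cl)+
    ultimately have rk: "rank_le (d v) (e v) (?C x)" "rank_le (d v) (d v - e v) (?R x)" .
    have Rc: "?R x \<subseteq> carrier_vec (d v)" and Cc: "?C x \<subseteq> carrier_vec (d v)" using columns_rows_carrier by auto
    obtain g1 s where g1: "frame (d v) g1" "s \<le> e v" "s \<le> d v" "\<And>i. i < s \<Longrightarrow> col g1 i \<in> ?C x"
        "?C x \<subseteq> frame_span g1 s"
      by (rule rank_leD[OF rk(1) Cc]) blast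
    \<comment> \<open>This inclusion is not obtained from the rank bounds; it comes from the
      relations that \<open>x\<close> itself satisfies.\<close>
    have "?C x \<subseteq> annihilator (d v) (?R x)"
    proof
      fix u assume "u \<in> ?C x"
      then obtain \<alpha> j where a: "u = col (x \<alpha>) j" "\<alpha> \<in> arcs Q" "head Q \<alpha> = v" "j < d (tail Q \<alpha>)"
        unfolding in_columns_at[OF xs(1)] by blast
      have "x \<beta> *\<^sub>v u = 0\<^sub>v (d (head Q \<beta>))" if b: "\<beta> \<in> arcs Q" "tail Q \<beta> = v" for \<beta>
      proof -
        have "x \<beta> *\<^sub>v u = col (x \<beta> * x \<alpha>) j" unfolding a(1)
          using rep_space_mat[OF xs(1) a(2)] rep_space_mat[OF xs(1) b(1)] a b
              by (intro col_mult2[symmetric]) auto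
        also have "x \<beta> * x \<alpha> = 0\<^sub>m (d (head Q \<beta>)) (d (tail Q \<alpha>))" using xs(2) a b
            by (simp add: zero_composites_def)
        finally show ?thesis using a(4) by simp
      qed
      moreover have "u \<in> carrier_vec (d v)" using Cc \<open>u \<in> ?C x\<close> by blast
      ultimately show "u \<in> annihilator (d v) (?R x)" unfolding annihilator_out_rows[OF xs(1)] by blast
    qed
    then have sub: "frame_span g1 s \<subseteq> annihilator (d v) (?R x)"
      using g1 by (intro frame_span_subset[OF vec_subspace_annihilator[OF Rc]]) auto
    have "frame_span g1 s \<subseteq> frame_span g1 (e v)" by (rule frame_span_mono[OF g1(2)])
    then have "rank_le (d v) (e v) (frame_span g1 s)" by (rule rank_le_frame_span[OF g1(1)])
    from intermediate_frame[OF Rc rk(2) e_le[OF v] vec_subspace_frame_span[OF frame_carrier[OF g1(1)]] this sub]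
    obtain g where g: "frame (d v) g" "frame_span g1 s \<subseteq> frame_span g (e v)"
      "frame_span g (e v) \<subseteq> annihilator (d v) (?R x)" by blast
    have gs: "vec_subspace (d v) (frame_span g (e v))"
        by (rule vec_subspace_frame_span[OF frame_carrier[OF g(1)]])
    have "x \<alpha> *\<^sub>v w \<in> frame_span g (e v)" if a: "\<alpha> \<in> arcs Q" "head Q \<alpha> = v" and w:
        "w \<in> carrier_vec (d (tail Q \<alpha>))" for \<alpha> w
    proof (rule mult_mat_vec_in_subspace[OF gs _ order_refl _ w])
      show "x \<alpha> \<in> carrier_mat (d v) (d (tail Q \<alpha>))" using rep_space_mat[OF xs(1) a(1)] a(2) by simp
      fix j assume "j < d (tail Q \<alpha>)"
      then have "col (x \<alpha>) j \<in> ?C x" unfolding in_columns_at[OF xs(1)] using a by blast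
      then show "col (x \<alpha>) j \<in> frame_span g (e v)" using g1(5) g(2) by blast
    qed simp
    moreover have "x \<alpha> *\<^sub>v w = 0\<^sub>v (d (head Q \<alpha>))" if a: "\<alpha> \<in> arcs Q" "tail Q \<alpha> = v" and w:
        "w \<in> frame_span g (e v)" for \<alpha> w
      using subsetD[OF g(3) w] a unfolding annihilator_out_rows[OF xs(1)] by blast
    ultimately show ?thesis using g(1) by blast
  qed
  then show ?thesis using xR by (simp add: degeneration_locus_def)
qed

section \<open>Generic points on a line\<close>

lemma y_image:
  assumes a: "\<alpha> \<in> arcs Q" "w \<in> carrier_vec (d (tail Q \<alpha>))"
  shows "y \<alpha> *\<^sub>v w \<in> frame_span (g0 (head Q \<alpha>)) (e (head Q \<alpha>))"
proof -
  have v: "head Q \<alpha> \<in> verts Q" using a by simp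
  have ys: "y \<in> rep_space Q d" using y by (simp add: Rep_iff)
  show ?thesis unfolding rad_component[OF v, symmetric]
    using radical_component_arrow[OF y a] arrow_mult_vec[OF ys a] by simp
qed

lemma y_kill:
  assumes a: "\<alpha> \<in> arcs Q" and w: "w \<in> frame_span (g0 (tail Q \<alpha>)) (e (tail Q \<alpha>))"
  shows "y \<alpha> *\<^sub>v w = 0\<^sub>v (d (head Q \<alpha>))"
proof -
  have v: "tail Q \<alpha> \<in> verts Q" "head Q \<alpha> \<in> verts Q" using a by auto
  have w': "w \<in> carrier_vec (d (tail Q \<alpha>))"
    "vertex_embed Q d (tail Q \<alpha>) w \<in> radical_submodule \<Lambda> (rep_module Q d y)"
    using w unfolding rad_component[OF v(1), symmetric] by auto
  have "vertex_embed Q d (head Q \<alpha>) (y \<alpha> *\<^sub>v w) =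
      cls (arrow_elem Q \<alpha>) \<odot>\<^bsub>rep_module Q d y\<^esub> vertex_embed Q d (tail Q \<alpha>) w"
    using arrow_smult[OF y vertex_embed_carrier[of w d "tail Q \<alpha>" y, OF w'(1)] a] v by simp
  also have "\<dots> = \<zero>\<^bsub>rep_module Q d y\<^esub>"
    by (rule radical_smult_radical_submodule[OF left_module_rep[OF y] w'(2) arrow_elem_radical[OF a]])
  finally show ?thesis using vertex_embed_eq_zero_iff[of "head Q \<alpha>" d "y \<alpha> *\<^sub>v w" y] v by simp
qed

lemma column_radical:
  assumes z: "z \<in> Rep Q I d" and q: "q \<in> in_columns v"
  shows "vertex_embed Q d v (q z) \<in> radical_submodule \<Lambda> (rep_module Q d z)"
proof -
  have zs: "z \<in> rep_space Q d" using z by (simp add: Rep_iff)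
  have "q z \<in> (\<lambda>q. q z) ` in_columns v" using q by blast
  then obtain \<alpha> j where a: "q z = col (z \<alpha>) j" "\<alpha> \<in> arcs Q" "head Q \<alpha> = v" "j < d (tail Q \<alpha>)"
    unfolding in_columns_at[OF zs] by blast
  have "q z = z \<alpha> *\<^sub>v unit_vec (d (tail Q \<alpha>)) j"
    using mult_mat_unit_vec[OF rep_space_mat[OF zs a(2)] a(4)] a(1) by simp
  then show ?thesis using radical_component_arrow[OF z a(2), of "unit_vec (d (tail Q \<alpha>)) j"] a(3) by simp
qed

text \<open>The images bound the radical from above by the spans of \<open>G\<close>, and
  \<open>e v\<close> independent incoming columns bound it from below. Both have dimension
  \<open>e v\<close>, so the radical is known exactly and \<open>top_isomorphic_frames\<close>
  applies with \<open>r = e\<close>.\<close>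

lemma in_Rep_top_frames:
  assumes z: "z \<in> Rep Q I d"
    and G: "\<And>v. v \<in> verts Q \<Longrightarrow> frame (d v) (G v)"
    and image: "\<And>\<alpha> w. \<lbrakk>\<alpha> \<in> arcs Q; w \<in> carrier_vec (d (tail Q \<alpha>))\<rbrakk> \<Longrightarrow>
      z \<alpha> *\<^sub>v w \<in> frame_span (G (head Q \<alpha>)) (e (head Q \<alpha>))"
    and frames: "\<And>v. v \<in> verts Q \<Longrightarrow> \<exists>\<Gamma>. frame (d v) \<Gamma> \<and> (\<forall>i<e v. \<exists>q\<in>in_columns v. col \<Gamma> i = q z)"
  shows "z \<in> Rep_top Q I d T"
proof -
  interpret Z: left_module \<Lambda> "rep_module Q d z" by (rule left_module_rep[OF z])
  let ?rad = "radical_submodule \<Lambda> (rep_module Q d z)"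
  have W: "vec_subspace (d v) (frame_span (G v) (e v))" if "v \<in> verts Q" for v
    by (rule vec_subspace_frame_span[OF frame_carrier[OF G[OF that]]])
  have rad_le: "?rad \<subseteq> (\<Pi>\<^sub>E v\<in>verts Q. frame_span (G v) (e v))" by (rule radical_subset_family[OF z W image])
  have radZ: "submodule ?rad \<Lambda> (rep_module Q d z)" by (rule submodule_radical[OF Z.left_module_axioms])
  have comp: "{w \<in> carrier_vec (d v). vertex_embed Q d v w \<in> ?rad} = frame_span (G v) (e v)" if v:
      "v \<in> verts Q" for v
  proof
    let ?R = "{w \<in> carrier_vec (d v). vertex_embed Q d v w \<in> ?rad}"
    show R: "?R \<subseteq> frame_span (G v) (e v)"
    proof
      fix w assume "w \<in> ?R"
      then have "vertex_embed Q d v w \<in> (\<Pi>\<^sub>E v\<in>verts Q. frame_span (G v) (e v))" using rad_le by blast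
      from PiE_mem[OF this v] show "w \<in> frame_span (G v) (e v)" using v by simp
    qed
    obtain \<Gamma> where \<Gamma>: "frame (d v) \<Gamma>" "\<forall>i<e v. \<exists>q\<in>in_columns v. col \<Gamma> i = q z" using frames[OF v] by blast
    have "col \<Gamma> i \<in> ?R" if i: "i < e v" for i
    proof -
      obtain q where q: "q \<in> in_columns v" "col \<Gamma> i = q z" using \<Gamma>(2) i by blast
      show ?thesis unfolding q(2) using column_radical[OF z q(1)] columns_rows_carrier(1)[OF q(1)] by simp
    qed
    then have "frame_span \<Gamma> (e v) \<subseteq> ?R"
      by (intro frame_span_subset[OF submodule_component_subspace[OF z radZ v] frame_carrier[OF \<Gamma>(1)] e_le[OF v]])
    moreover from this R have "frame_span \<Gamma> (e v) = frame_span (G v) (e v)"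
      by (intro frame_span_subset_eq[OF G[OF v] \<Gamma>(1) e_le[OF v]]) blast
    ultimately show "frame_span (G v) (e v) \<subseteq> ?R" by simp
  qed
  have rad_eq: "?rad = (\<Pi>\<^sub>E v\<in>verts Q. frame_span (G v) (e v))"
    by (subst radical_family[OF z]) (intro PiE_cong comp)
  have "\<forall>v. \<exists>h. v \<in> verts Q \<longrightarrow> frame (d v) h \<and> h * G v = 1\<^sub>m (d v) \<and> G v * h = 1\<^sub>m (d v)"
    using frame_inverse[OF G] by metis
  then obtain H where H: "\<And>v. v \<in> verts Q \<Longrightarrow> frame (d v) (H v) \<and> H v * G v = 1\<^sub>m (d v) \<and> G v * H v = 1\<^sub>m (d v)"
    unfolding choice_iff by blast
  \<comment> \<open>With nothing omitted, \<open>S\<close> is the whole carrier, and the carrier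
    update changes nothing.\<close>
  let ?S = "\<Pi>\<^sub>E v\<in>verts Q. carrier_vec (d v)"
  have upd: "rep_module Q d z\<lparr>carrier := ?S\<rparr> = rep_module Q d z" by (simp add: rep_module_def)
  have "module_isomorphic \<Lambda> (top_module \<Lambda> (rep_module Q d z\<lparr>carrier := ?S\<rparr>)) T"
  proof (rule top_isomorphic_frames[where S = "\<lambda>v. carrier_vec (d v)" and h = H, OF z G _ _ _ order_refl image])
    show "submodule ?S \<Lambda> (rep_module Q d z)" using Z.carrier_submodule by (simp only: carrier_rep_module)
    show "radical_submodule \<Lambda> (rep_module Q d z\<lparr>carrier := ?S\<rparr>) = (\<Pi>\<^sub>E v\<in>verts Q. frame_span (G v) (e v))"
      unfolding upd by (rule rad_eq)
  qed (use H in auto)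
  then show ?thesis unfolding upd using z by (simp add: Rep_top_def)
qed

text \<open>Moving the radical layer of \<open>y\<close> onto that prescribed by the frames \<open>G\<close> gives a point \<open>y1\<close> of
  \<^term>\<open>Rep_top Q I d T\<close>, and the line through \<open>x\<close> and \<open>y1\<close> meets \<^term>\<open>Rep_top Q I d T\<close> in all points at
  which finitely many minors, nonzero at \<open>y1\<close>, do not vanish.\<close>

lemma locus_subset_closure:
  assumes poly_zero: "\<And>q :: 'k poly. (\<And>c. poly q c = 0) \<Longrightarrow> q = 0"
    and x: "x \<in> degeneration_locus Q I d e"
  shows "x \<in> Rep_topology Q I d closure_of Rep_top Q I d T"
proof -
  have xR: "x \<in> Rep Q I d" using x by (simp add: degeneration_locus_def)
  then have xs: "x \<in> rep_space Q d" by (simp add: Rep_iff)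
  have ys: "y \<in> rep_space Q d" using y by (simp add: Rep_iff)
  obtain G where G: "\<And>v. v \<in> verts Q \<Longrightarrow> frame (d v) (G v)"
    and G1:
        "\<And>\<alpha> w. \<alpha> \<in> arcs Q \<Longrightarrow> w \<in> carrier_vec (d (tail Q \<alpha>)) \<Longrightarrow> x \<alpha> *\<^sub>v w \<in> frame_span (G (head Q \<alpha>)) (e (head Q \<alpha>))"
    and G2: "\<And>\<alpha> w. \<alpha> \<in> arcs Q \<Longrightarrow> w \<in> frame_span (G (tail Q \<alpha>)) (e (tail Q \<alpha>)) \<Longrightarrow> x \<alpha> *\<^sub>v w = 0\<^sub>v (d (head Q \<alpha>))"
    by (rule degeneration_locusE[OF x]) blast
  let ?W = "\<lambda>v. frame_span (G v) (e v)"
  have W: "vec_subspace (d v) (?W v)" if "v \<in> verts Q" for v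
    by (rule vec_subspace_frame_span[OF frame_carrier[OF G[OF that]]])
  have "\<forall>v. \<exists>h h0. v \<in> verts Q \<longrightarrow> frame (d v) h \<and> h * G v = 1\<^sub>m (d v) \<and> G v * h = 1\<^sub>m (d v) \<and>
      frame (d v) h0 \<and> h0 * g0 v = 1\<^sub>m (d v) \<and> g0 v * h0 = 1\<^sub>m (d v)"
    using frame_inverse[OF G] frame_inverse[OF g0] by metis
  then obtain H h0 where Hh:
      "\<And>v. v \<in> verts Q \<Longrightarrow> frame (d v) (H v) \<and> H v * G v = 1\<^sub>m (d v) \<and> G v * H v = 1\<^sub>m (d v) \<and>
      frame (d v) (h0 v) \<and> h0 v * g0 v = 1\<^sub>m (d v) \<and> g0 v * h0 v = 1\<^sub>m (d v)"
    unfolding choice_iff by blast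
  then have H: "\<And>v. v \<in> verts Q \<Longrightarrow> frame (d v) (H v)" "\<And>v. v \<in> verts Q \<Longrightarrow> H v * G v = 1\<^sub>m (d v)"
    "\<And>v. v \<in> verts Q \<Longrightarrow> G v * H v = 1\<^sub>m (d v)"
    and h0: "\<And>v. v \<in> verts Q \<Longrightarrow> frame (d v) (h0 v)" "\<And>v. v \<in> verts Q \<Longrightarrow> h0 v * g0 v = 1\<^sub>m (d v)"
    "\<And>v. v \<in> verts Q \<Longrightarrow> g0 v * h0 v = 1\<^sub>m (d v)" by blast+
  \<comment> \<open>\<open>A v\<close> carries the radical of \<open>y\<close> at \<open>v\<close>
    onto W_v and \<open>B v\<close> is its inverse. Conjugation by them turns \<open>y\<close> into
    an isomorphic point \<open>y1\<close> with radical W.\<close>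
  define A where "A v = G v * h0 v" for v
  define B where "B v = g0 v * H v" for v
  have A: "A v \<in> carrier_mat (d v) (d v)" and B: "B v \<in> carrier_mat (d v) (d v)" if "v \<in> verts Q" for v
    unfolding A_def B_def
    by (rule frame_carrier[OF frame_mult[OF G[OF that] h0(1)[OF that]]] frame_carrier[OF frame_mult[OF g0[OF that] H(1)[OF that]]])+
  have A_iff: "A v *\<^sub>v w \<in> ?W v \<longleftrightarrow> w \<in> frame_span (g0 v) (e v)" if "v \<in> verts Q" "w \<in> carrier_vec (d v)" for v w
    unfolding A_def by (rule transport_frame_span_iff) (use that G g0 h0 in auto)
  have B_iff: "B v *\<^sub>v w \<in> frame_span (g0 v) (e v) \<longleftrightarrow> w \<in> ?W v" if "v \<in> verts Q" "w \<in> carrier_vec (d v)" for v w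
    unfolding B_def by (rule transport_frame_span_iff) (use that G g0 H in auto)
  have BA: "B v *\<^sub>v (A v *\<^sub>v w) = w" if v: "v \<in> verts Q" and w: "w \<in> carrier_vec (d v)" for v w
  proof -
    note c = frame_carrier[OF G[OF v]] frame_carrier[OF g0[OF v]] frame_carrier[OF H(1)[OF v]] frame_carrier[OF h0(1)[OF v]]
    have hw: "h0 v *\<^sub>v w \<in> carrier_vec (d v)" using c(4) w by simp
    have "A v *\<^sub>v w = G v *\<^sub>v (h0 v *\<^sub>v w)" unfolding A_def by (rule assoc_mult_mat_vec[OF c(1,4) w])
    moreover have "B v *\<^sub>v (G v *\<^sub>v (h0 v *\<^sub>v w)) = g0 v *\<^sub>v (H v *\<^sub>v (G v *\<^sub>v (h0 v *\<^sub>v w)))"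
      unfolding B_def using c(1) hw by (intro assoc_mult_mat_vec[OF c(2,3)]) simp
    ultimately show ?thesis
      using inverse_mult_vec[OF H(2)[OF v] c(3,1) hw] inverse_mult_vec[OF h0(3)[OF v] c(2,4) w] by simp
  qed
  define y1 where "y1 = (\<lambda>\<alpha>\<in>arcs Q. A (head Q \<alpha>) * y \<alpha> * B (tail Q \<alpha>))"
  have y1_at: "y1 \<alpha> = A (head Q \<alpha>) * y \<alpha> * B (tail Q \<alpha>)" if "\<alpha> \<in> arcs Q" for \<alpha> using that by (simp add: y1_def)
  have y1c: "y1 \<alpha> \<in> carrier_mat (d (head Q \<alpha>)) (d (tail Q \<alpha>))" if a: "\<alpha> \<in> arcs Q" for \<alpha>
    unfolding y1_at[OF a] using A[of "head Q \<alpha>"] B[of "tail Q \<alpha>"] rep_space_mat[OF ys a] a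
    by (intro mult_carrier_mat) auto
  have y1s: "y1 \<in> rep_space Q d" unfolding rep_space_def using y1c by (auto simp: y1_def)
  have y1_mult: "y1 \<alpha> *\<^sub>v w = A (head Q \<alpha>) *\<^sub>v (y \<alpha> *\<^sub>v (B (tail Q \<alpha>) *\<^sub>v w))"
    if a: "\<alpha> \<in> arcs Q" and w: "w \<in> carrier_vec (d (tail Q \<alpha>))" for \<alpha> w
  proof -
    have v: "head Q \<alpha> \<in> verts Q" "tail Q \<alpha> \<in> verts Q" using a by auto
    have Bw: "B (tail Q \<alpha>) *\<^sub>v w \<in> carrier_vec (d (tail Q \<alpha>))" by (rule mult_mat_vec_carrier[OF B[OF v(2)] w])
    have "y1 \<alpha> *\<^sub>v w = (A (head Q \<alpha>) * y \<alpha>) *\<^sub>v (B (tail Q \<alpha>) *\<^sub>v w)"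
      unfolding y1_at[OF a]
          by (rule assoc_mult_mat_vec[OF mult_carrier_mat[OF A[OF v(1)] rep_space_mat[OF ys a]] B[OF v(2)] w])
    also have "\<dots> = A (head Q \<alpha>) *\<^sub>v (y \<alpha> *\<^sub>v (B (tail Q \<alpha>) *\<^sub>v w))"
      by (rule assoc_mult_mat_vec[OF A[OF v(1)] rep_space_mat[OF ys a] Bw])
    finally show ?thesis .
  qed
  have y1_image: "y1 \<alpha> *\<^sub>v w \<in> ?W (head Q \<alpha>)" if a: "\<alpha> \<in> arcs Q" and w: "w \<in> carrier_vec (d (tail Q \<alpha>))" for \<alpha> w
  proof -
    have v: "head Q \<alpha> \<in> verts Q" "tail Q \<alpha> \<in> verts Q" using a by auto
    have Bw: "B (tail Q \<alpha>) *\<^sub>v w \<in> carrier_vec (d (tail Q \<alpha>))" by (rule mult_mat_vec_carrier[OF B[OF v(2)] w])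
    show ?thesis unfolding y1_mult[OF a w] A_iff[OF v(1) arrow_mult_vec[OF ys a Bw]] by (rule y_image[OF a Bw])
  qed
  have y1_kill: "y1 \<alpha> *\<^sub>v w = 0\<^sub>v (d (head Q \<alpha>))" if a: "\<alpha> \<in> arcs Q" and w: "w \<in> ?W (tail Q \<alpha>)" for \<alpha> w
  proof -
    have v: "head Q \<alpha> \<in> verts Q" "tail Q \<alpha> \<in> verts Q" using a by auto
    have wc: "w \<in> carrier_vec (d (tail Q \<alpha>))" by (rule vec_subspace_carrier[OF W[OF v(2)] w])
    have "y \<alpha> *\<^sub>v (B (tail Q \<alpha>) *\<^sub>v w) = 0\<^sub>v (d (head Q \<alpha>))" using y_kill[OF a] B_iff[OF v(2) wc] w by simp
    then show ?thesis unfolding y1_mult[OF a wc] using mult_mat_zero_vec[OF A[OF v(1)]] by simp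
  qed
  \<comment> \<open>The line with \<open>x\<close> at parameter 0 and \<open>y1\<close> at parameter
    1. Both send everything into W and kill W, and these conditions are inherited by all points of
    the line.\<close>
  define z where "z c = (\<lambda>\<alpha>\<in>arcs Q. x \<alpha> + c \<cdot>\<^sub>m (y1 \<alpha> - x \<alpha>))" for c
  have z_at: "z c \<alpha> = x \<alpha> + c \<cdot>\<^sub>m (y1 \<alpha> - x \<alpha>)" if "\<alpha> \<in> arcs Q" for c \<alpha> using that by (simp add: z_def)
  have zs: "z c \<in> rep_space Q d" for c
    unfolding rep_space_def z_def restrict_PiE_iff
    by (intro ballI add_carrier_mat smult_carrier_mat minus_carrier_mat rep_space_mat[OF xs])
  have z_mult: "z c \<alpha> *\<^sub>v w = x \<alpha> *\<^sub>v w + c \<cdot>\<^sub>v (y1 \<alpha> *\<^sub>v w - x \<alpha> *\<^sub>v w)"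
    if a: "\<alpha> \<in> arcs Q" and w: "w \<in> carrier_vec (d (tail Q \<alpha>))" for c \<alpha> w
    unfolding z_at[OF a] by (rule line_mult_mat_vec[OF rep_space_mat[OF xs a] y1c[OF a] w])
  have z_image: "z c \<alpha> *\<^sub>v w \<in> ?W (head Q \<alpha>)" if a: "\<alpha> \<in> arcs Q" and w: "w \<in> carrier_vec (d (tail Q \<alpha>))"
      for c \<alpha> w
  proof -
    have sub: "vec_subspace (d (head Q \<alpha>)) (?W (head Q \<alpha>))" using a by (intro W) simp
    then show ?thesis unfolding z_mult[OF a w]
      using vec_subspace_diff[OF sub y1_image[OF a w] G1[OF a w]] G1[OF a w] by (simp add: vec_subspace_def)
  qed
  have z_kill: "z c \<alpha> *\<^sub>v w = 0\<^sub>v (d (head Q \<alpha>))" if a: "\<alpha> \<in> arcs Q" and w: "w \<in> ?W (tail Q \<alpha>)" for c \<alpha> w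
  proof -
    have wc: "w \<in> carrier_vec (d (tail Q \<alpha>))" using a by (intro vec_subspace_carrier[OF W w]) simp
    show ?thesis unfolding z_mult[OF a wc] G2[OF a w] y1_kill[OF a w] by (intro eq_vecI) auto
  qed
  have zR: "z c \<in> Rep Q I d" for c by (rule RepI[where W = ?W, OF zs z_image z_kill])
  \<comment> \<open>An independent family spanning the incoming columns of \<open>y1\<close> is
    selected; the column functions behind it will be evaluated along the line.\<close>
  have "\<exists>g s. frame (d v) g \<and> s \<le> d v \<and> (\<forall>i<s. \<exists>q\<in>in_columns v. col g i = q y1) \<and>
      (\<lambda>q. q y1) ` in_columns v \<subseteq> frame_span g s" for v
  proof -
    have "(\<lambda>q. q y1) ` in_columns v \<subseteq> carrier_vec (d v)" using columns_rows_carrier(1) by blast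
    note C = this
    obtain g s where gs: "frame (d v) g" "s \<le> d v" "\<And>i. i < s \<Longrightarrow> col g i \<in> (\<lambda>q. q y1) ` in_columns v"
      "(\<lambda>q. q y1) ` in_columns v \<subseteq> frame_span g s"
      by (rule frame_extend[OF frame_one _ C, of 0]) auto
    have "\<exists>q\<in>in_columns v. col g i = q y1" if "i < s" for i using gs(3)[OF that] by blast
    then show ?thesis using gs(1,2,4) by blast
  qed
  then obtain g s where gs: "\<And>v. frame (d v) (g v)" "\<And>v. s v \<le> d v"
    "\<And>v i. i < s v \<Longrightarrow> \<exists>q\<in>in_columns v. col (g v) i = q y1"
    "\<And>v. (\<lambda>q. q y1) ` in_columns v \<subseteq> frame_span (g v) (s v)" by metis
  have gsub: "vec_subspace (d v) (frame_span (g v) (s v))" for v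
    by (rule vec_subspace_frame_span[OF frame_carrier[OF gs(1)]])
  have y1_gs: "y1 \<alpha> *\<^sub>v w \<in> frame_span (g (head Q \<alpha>)) (s (head Q \<alpha>))"
    if a: "\<alpha> \<in> arcs Q" and w: "w \<in> carrier_vec (d (tail Q \<alpha>))" for \<alpha> w
  proof (rule mult_mat_vec_in_subspace[OF gsub y1c[OF a] order_refl _ w])
    fix j assume "j < d (tail Q \<alpha>)"
    then have "col (y1 \<alpha>) j \<in> (\<lambda>q. q y1) ` in_columns (head Q \<alpha>)" unfolding in_columns_at[OF y1s]
        using a by blast
    then show "col (y1 \<alpha>) j \<in> frame_span (g (head Q \<alpha>)) (s (head Q \<alpha>))" using gs(4) by blast
  qed simp
  \<comment> \<open>Because \<open>A\<close> intertwines \<open>y\<close> with \<open>y1\<close>,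
    the preimage under \<open>A\<close> of the span of the columns of \<open>y1\<close> contains all
    images of \<open>y\<close>, and hence its radical. This yields \<open>e v \<le> s v\<close>
    below.\<close>
  have rad_sub: "radical_submodule \<Lambda> (rep_module Q d y) \<subseteq>
      (\<Pi>\<^sub>E v\<in>verts Q. {w \<in> carrier_vec (d v). A v *\<^sub>v w \<in> frame_span (g v) (s v)})"
  proof (rule radical_subset_family[OF y])
    fix v assume "v \<in> verts Q"
    then show "vec_subspace (d v) {w \<in> carrier_vec (d v). A v *\<^sub>v w \<in> frame_span (g v) (s v)}"
      by (intro vimage_subspace gsub A)
  next
    fix \<alpha> and w :: "'k vec" assume a: "\<alpha> \<in> arcs Q" and w: "w \<in> carrier_vec (d (tail Q \<alpha>))"
    have v: "tail Q \<alpha> \<in> verts Q" using a by simp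
    have Aw: "A (tail Q \<alpha>) *\<^sub>v w \<in> carrier_vec (d (tail Q \<alpha>))" by (rule mult_mat_vec_carrier[OF A[OF v] w])
    have "A (head Q \<alpha>) *\<^sub>v (y \<alpha> *\<^sub>v w) = y1 \<alpha> *\<^sub>v (A (tail Q \<alpha>) *\<^sub>v w)"
      unfolding y1_mult[OF a Aw] BA[OF v w] ..
    then show
        "y \<alpha> *\<^sub>v w \<in> {w \<in> carrier_vec (d (head Q \<alpha>)). A (head Q \<alpha>) *\<^sub>v w \<in> frame_span (g (head Q \<alpha>)) (s (head Q \<alpha>))}"
      using y1_gs[OF a Aw] arrow_mult_vec[OF ys a w] by simp
  qed
  have s_eq: "s v = e v" if v: "v \<in> verts Q" for v
  proof (rule antisym)
    show "s v \<le> e v"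
    proof (rule frame_span_dim_le[OF gs(1) G[OF v] gs(2)])
      fix i assume "i < s v"
      then have "col (g v) i \<in> (\<lambda>q. q y1) ` in_columns v" using gs(3) by blast
      then obtain \<alpha> j where a: "col (g v) i = col (y1 \<alpha>) j" "\<alpha> \<in> arcs Q" "head Q \<alpha> = v" "j < d (tail Q \<alpha>)"
        unfolding in_columns_at[OF y1s] by blast
      then show "col (g v) i \<in> ?W v"
        using y1_image[OF a(2), of "unit_vec (d (tail Q \<alpha>)) j"] mult_mat_unit_vec[OF y1c[OF a(2)] a(4)] by simp
    qed
    show "e v \<le> s v"
    proof (rule frame_span_dim_le[OF G[OF v] gs(1) e_le[OF v]])
      fix i assume i: "i < e v"
      note c = frame_carrier[OF G[OF v]] frame_carrier[OF g0[OF v]] frame_carrier[OF h0(1)[OF v]]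
      have id: "i < d v" using i e_le[OF v] by simp
      have "col (g0 v) i \<in> frame_span (g0 v) (e v)" by (rule col_in_frame_span[OF c(2) i id])
      then have "vertex_embed Q d v (col (g0 v) i) \<in> radical_submodule \<Lambda> (rep_module Q d y)"
        unfolding rad_component[OF v, symmetric] by blast
      from PiE_mem[OF subsetD[OF rad_sub this] v] have "A v *\<^sub>v col (g0 v) i \<in> frame_span (g v) (s v)"
          using v by simp
      also have "A v *\<^sub>v col (g0 v) i = col (A v * g0 v) i" by (rule col_mult2[OF A[OF v] c(2) id, symmetric])
      also have "A v * g0 v = G v"
        unfolding A_def using assoc_mult_mat[OF c(1,3,2)] h0(2)[OF v] right_mult_one_mat[OF c(1)] by simp
      finally show "col (G v) i \<in> frame_span (g v) (s v)" .
    qed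
  qed
  have "\<forall>v i. \<exists>q. v \<in> verts Q \<and> i < e v \<longrightarrow> q \<in> in_columns v \<and> col (g v) i = q y1"
    using gs(3) s_eq by metis
  then obtain q where q: "\<And>v i. v \<in> verts Q \<Longrightarrow> i < e v \<Longrightarrow> q v i \<in> in_columns v"
    "\<And>v i. v \<in> verts Q \<Longrightarrow> i < e v \<Longrightarrow> col (g v) i = q v i y1" by metis
  \<comment> \<open>The first \<open>e v\<close> columns follow the selected column functions, the
    others stay as in \<open>g v\<close>. At \<open>y1\<close> the result is \<open>g v\<close>
    itself, so the determinant does not vanish identically on the line.\<close>
  define \<Gamma> where
      "\<Gamma> v z' = mat (d v) (d v) (\<lambda>(i, j). (if j < e v then \<lambda>z. q v j z $ i else (\<lambda>_. g v $$ (i, j))) z')"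
          for v z'
  have poly\<Gamma>: "(\<lambda>z. det (\<Gamma> v z)) \<in> rep_polys Q d" if v: "v \<in> verts Q" for v
    unfolding \<Gamma>_def using columns_rows_polys(1)[OF q(1)[OF v]]
    by (intro rep_polys_det) (auto intro: rep_polys.const)
  have "\<Gamma> v y1 = g v" if v: "v \<in> verts Q" for v
  proof (rule eq_matI)
    have gv: "g v \<in> carrier_mat (d v) (d v)" by (rule frame_carrier[OF gs(1)])
    then show "dim_row (\<Gamma> v y1) = dim_row (g v)" "dim_col (\<Gamma> v y1) = dim_col (g v)" by (auto simp: \<Gamma>_def)
    fix i j assume "i < dim_row (g v)" "j < dim_col (g v)"
    then have ij: "i < d v" "j < d v" "col (g v) j $ i = g v $$ (i, j)" using gv by auto
    then show "\<Gamma> v y1 $$ (i, j) = g v $$ (i, j)" using q(2)[OF v, of j, symmetric] by (simp add: \<Gamma>_def)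
  qed
  then have det_y1: "det (\<Gamma> v y1) \<noteq> 0" if "v \<in> verts Q" for v
    using that gs(1)[of v] unfolding frame_def by simp
  have z_top: "z c \<in> Rep_top Q I d T" if det: "\<And>v. v \<in> verts Q \<Longrightarrow> det (\<Gamma> v (z c)) \<noteq> 0" for c
  proof (rule in_Rep_top_frames[OF zR G z_image])
    fix v assume v: "v \<in> verts Q"
    have "col (\<Gamma> v (z c)) i = q v i (z c)" if i: "i < e v" for i
      using carrier_vecD[OF columns_rows_carrier(1)[OF q(1)[OF v i], of "z c"]] i e_le[OF v]
      by (intro eq_vecI) (auto simp: \<Gamma>_def)
    moreover have "frame (d v) (\<Gamma> v (z c))" using det[OF v] unfolding frame_def by (simp add: \<Gamma>_def)
    ultimately show "\<exists>\<Gamma>. frame (d v) \<Gamma> \<and> (\<forall>i<e v. \<exists>q\<in>in_columns v. col \<Gamma> i = q (z c))"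
      using q(1)[OF v] by blast
  qed
  have z0: "z 0 = x"
  proof (rule PiE_ext)
    show "z 0 \<in> (\<Pi>\<^sub>E \<alpha>\<in>arcs Q. carrier_mat (d (head Q \<alpha>)) (d (tail Q \<alpha>)))"
      "x \<in> (\<Pi>\<^sub>E \<alpha>\<in>arcs Q. carrier_mat (d (head Q \<alpha>)) (d (tail Q \<alpha>)))"
      using zs xs by (simp_all add: rep_space_def)
    fix \<alpha> assume a: "\<alpha> \<in> arcs Q"
    show "z 0 \<alpha> = x \<alpha>" unfolding z_at[OF a] using rep_space_mat[OF xs a] y1c[OF a] by (intro eq_matI) auto
  qed
  have z1: "z 1 = y1"
  proof (rule PiE_ext)
    show "z 1 \<in> (\<Pi>\<^sub>E \<alpha>\<in>arcs Q. carrier_mat (d (head Q \<alpha>)) (d (tail Q \<alpha>)))"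
      "y1 \<in> (\<Pi>\<^sub>E \<alpha>\<in>arcs Q. carrier_mat (d (head Q \<alpha>)) (d (tail Q \<alpha>)))"
      using zs y1s by (simp_all add: rep_space_def)
    fix \<alpha> assume a: "\<alpha> \<in> arcs Q"
    show "z 1 \<alpha> = y1 \<alpha>" unfolding z_at[OF a] using rep_space_mat[OF xs a] y1c[OF a] by (intro eq_matI) auto
  qed
  have curve: "\<exists>r. \<forall>c. f (z c) = poly r c" if f: "f \<in> rep_polys Q d" for f
  proof (rule rep_polys_curve[OF _ f])
    fix \<alpha> i j assume a: "\<alpha> \<in> arcs Q" "i < d (head Q \<alpha>)" "j < d (tail Q \<alpha>)"
    then show "\<exists>r. \<forall>c. z c \<alpha> $$ (i, j) = poly r c"
      using rep_space_mat[OF xs a(1)] y1c[OF a(1)]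
      by (intro exI[of _ "[:x \<alpha> $$ (i, j), y1 \<alpha> $$ (i, j) - x \<alpha> $$ (i, j):]"]) (simp add: z_at)
  qed
  have "\<exists>r. \<forall>c. det (\<Gamma> v (z c)) = poly r c" if "v \<in> verts Q" for v using curve[OF poly\<Gamma>[OF that]] .
  then obtain D where D: "\<And>v c. v \<in> verts Q \<Longrightarrow> det (\<Gamma> v (z c)) = poly (D v) c" by metis
  have D_nonzero: "D v \<noteq> 0" if v: "v \<in> verts Q" for v using D[OF v, of 1] det_y1[OF v] z1 by auto
  have "f x = 0" if f: "f \<in> rep_polys Q d" "\<forall>u\<in>Rep_top Q I d T. f u = 0" for f
  proof -
    obtain r where r: "\<And>c. f (z c) = poly r c" using curve[OF f(1)] by blast
    have "poly (r * (\<Prod>v\<in>verts Q. D v)) c = 0" for c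
    proof (cases "\<exists>v\<in>verts Q. poly (D v) c = 0")
      case True
      then show ?thesis using finite_verts by (auto simp: poly_prod)
    next
      case False
      then have "f (z c) = 0" using f(2) z_top D by metis
      then show ?thesis using r by simp
    qed
    then have "r * (\<Prod>v\<in>verts Q. D v) = 0" by (rule poly_zero)
    then have "r = 0" using D_nonzero finite_verts by simp
    then show ?thesis using r[of 0] z0 by simp
  qed
  moreover have "Rep_top Q I d T \<subseteq> Rep Q I d" by (auto simp: Rep_top_def)
  ultimately show ?thesis using Rep_closure_iff xR by blast
qed

end

theorem corollary4p2:
  fixes Q :: "('v, 'e) pre_digraph"
    and I :: "(('v, 'e) path \<Rightarrow> 'k::alg_closed_field) set"
    and d :: "'v \<Rightarrow> nat"
    and T :: "((('v, 'e) path \<Rightarrow> 'k) set, 't) module"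
  assumes quiver: "fin_digraph Q"
    and admissible: "admissible_ideal Q I"
    and radical_square_zero:
      "ideal_prod (quiver_algebra Q I)
         (jacobson_radical (quiver_algebra Q I)) (jacobson_radical (quiver_algebra Q I))
       = {\<zero>\<^bsub>quiver_algebra Q I\<^esub>}"
    and T_semisimple: "semisimple_module (quiver_algebra Q I) T"
    and T_realizable: "realizable Q I d T"
  shows "Rep_topology Q I d closure_of Rep_top Q I d T =
    {x \<in> Rep Q I d.
       \<exists>(M :: ((('v, 'e) path \<Rightarrow> 'k) set, 'v \<Rightarrow> 'k vec) module)
        (U :: ((('v, 'e) path \<Rightarrow> 'k) set, 'v \<Rightarrow> 'k vec) module).
         left_module (quiver_algebra Q I) M \<and>
         module_isomorphic (quiver_algebra Q I) (top_module (quiver_algebra Q I) M) T \<and>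
         semisimple_module (quiver_algebra Q I) U \<and>
         module_isomorphic (quiver_algebra Q I) (rep_module Q d x) (direct_sum_module M U)}"
proof -
  interpret square_zero_quiver Q I
    using quiver admissible radical_square_zero by (rule square_zero_quiver.intro)
  have T: "left_module \<Lambda> T" using T_semisimple by (simp add: semisimple_module_def)
  obtain y where y: "y \<in> Rep Q I d" "module_isomorphic \<Lambda> (top_module \<Lambda> (rep_module Q d y)) T"
    using T_realizable by (auto simp: realizable_def Rep_top_def)
  let ?rad = "radical_submodule \<Lambda> (rep_module Q d y)"
  note Y = left_module_rep[OF y(1)]
  obtain p where p: "module_epi \<Lambda> (rep_module Q d y) T p"
    "\<forall>m\<in>carrier (rep_module Q d y). p m = \<zero>\<^bsub>T\<^esub> \<longleftrightarrow> m \<in> ?rad"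
    using y(2) top_isomorphic_iff[OF Y T] by blast
  \<comment> \<open>The numbers \<open>e v\<close> are read off from the radical of one realizing
    point \<open>y\<close>; by \<open>epi_dim_le\<close> every other point with top \<open>T\<close>
    gives the same numbers.\<close>
  have "\<exists>g e. frame (d v) g \<and> e \<le> d v \<and>
      {w \<in> carrier_vec (d v). vertex_embed Q d v w \<in> ?rad} = frame_span g e" if v: "v \<in> verts Q" for v
  proof -
    obtain g e where "frame (d v) g" "e \<le> d v"
      "{w \<in> carrier_vec (d v). vertex_embed Q d v w \<in> ?rad} = frame_span g e"
      by (rule subspace_frame[OF submodule_component_subspace[OF y(1) submodule_radical[OF Y] v]])
    then show ?thesis by blast
  qed
  then have "\<forall>v. \<exists>g e. v \<in> verts Q \<longrightarrow> frame (d v) g \<and> e \<le> d v \<and>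
      {w \<in> carrier_vec (d v). vertex_embed Q d v w \<in> ?rad} = frame_span g e" by blast
  then obtain g e where g: "\<And>v. v \<in> verts Q \<Longrightarrow> frame (d v) (g v) \<and> e v \<le> d v \<and>
      {w \<in> carrier_vec (d v). vertex_embed Q d v w \<in> ?rad} = frame_span (g v) (e v)"
    unfolding choice_iff by blast
  interpret realized_top Q I d e T y p g
    by (intro realized_top.intro realized_top_axioms.intro square_zero_quiver_axioms T y(1) p(1))
      (use p(2) g in blast)+
  have "Rep_topology Q I d closure_of Rep_top Q I d T = degeneration_locus Q I d e"
    using closure_subset_locus locus_subset_closure[OF alg_closed_poly_zero] by blast
  also have "\<dots> = {x \<in> Rep Q I d.
       \<exists>(M :: ((('v, 'e) path \<Rightarrow> 'k) set, 'v \<Rightarrow> 'k vec) module)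
        (U :: ((('v, 'e) path \<Rightarrow> 'k) set, 'v \<Rightarrow> 'k vec) module).
         left_module \<Lambda> M \<and> module_isomorphic \<Lambda> (top_module \<Lambda> M) T \<and> semisimple_module \<Lambda> U \<and>
         module_isomorphic \<Lambda> (rep_module Q d x) (direct_sum_module M U)}"
  proof (intro equalityI subsetI CollectI conjI)
    fix x assume x: "x \<in> degeneration_locus Q I d e"
    then show "x \<in> Rep Q I d" by (simp add: degeneration_locus_def)
    show "\<exists>(M :: ((('v, 'e) path \<Rightarrow> 'k) set, 'v \<Rightarrow> 'k vec) module)
        (U :: ((('v, 'e) path \<Rightarrow> 'k) set, 'v \<Rightarrow> 'k vec) module).
         left_module \<Lambda> M \<and> module_isomorphic \<Lambda> (top_module \<Lambda> M) T \<and> semisimple_module \<Lambda> U \<and>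
         module_isomorphic \<Lambda> (rep_module Q d x) (direct_sum_module M U)"
      by (rule locus_direct_sum[OF x])
  qed (use direct_sum_in_locus in blast)
  finally show ?thesis .
qed

end
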